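(* Let $\mathbf f^n\in L^2(\Omega)^d$ and $g^n,p_0,\varphi_0\in L^2(\Omega)$ be given for each time instant $n\in\{1,\dots,N\}$. Then for each $n\in\{1,\dots,N\}$ there exists a unique $((\mathbf d^n,\mu^n,\varphi^n),\lambda^n)\in\mathbf V\times Q$ such that $$\langle\mathcal A(\mathbf d^n,\mu^n,\varphi^n),(\mathbf d^*,\mu^*,\varphi^* )\rangle+\langle\mathcal B(\mathbf d^*,\mu^*,\varphi^* ),\lambda^n\rangle=(\mathbf f^n,\mathbf d^* )+\tau(g^n,\mu^* )-(p_0,\varphi^* )\quad\forall(\mathbf d^*,\mu^*,\varphi^* )\in\mathbf V,$$ $$\langle\mathcal B(\mathbf d^n,\mu^n,\varphi^n),\lambda^*\rangle=-(\varphi_0,\lambda^* )\quad\forall\lambda^*\in Q.$$ Moreover, there is a constant $C>0$, independent of the physical constants $\rho_0,\tau,\mathbb C_{\mathrm{Hooke}},\beta,\mathbf K,M$ (and of the data), such that $$\|((\mathbf d^n,\mu^n,\varphi^n),\lambda^n)\|_{\mathbf V\times Q}\le C\max\left\{\frac1{\alpha_0},\frac{2\sqrt{\alpha_1}}{\sqrt{\alpha_0}},\alpha_1\right\}\left(\|\mathbf f^n\|_{0,\Omega}+\tau\|g^n\|_{0,\Omega}+\|p_0\|_{0,\Omega}+\|\varphi_0\|_{0,\Omega}\right),$$ where $\alpha_0=\min\left\{\frac{\rho_0}{\tau^2},\mathbb C^{\min}_{\mathrm{Hooke}},2\beta,\tau\mathbf K^{\min},M\right\}$ and $\alpha_1=\max\left\{\frac{\rho_0}{\tau^2},\mathbb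 C^{\max}_{\mathrm{Hooke}},2\beta,\tau\mathbf K^{\max},M\right\}$.
   Context: $\Omega\subset\mathbb R^d$, $d\in\{2,3\}$, is a bounded domain with Lipschitz boundary; $(\cdot,\cdot)$ is the $L^2(\Omega)$ inner product (scalar, vector or tensor), $\|\cdot\|_{0,\Omega}$, $\|\cdot\|_{1,\Omega}$ are the $L^2(\Omega)$ and $H^1(\Omega)$ norms, and $\boldsymbol\varepsilon(\mathbf d)$ is the symmetric part of $\nabla\mathbf d$. Parameters: $\rho_0>0$ (density), $\tau>0$ (time step), $\beta>0$, $M\ge0$ are constants (if $M=0$, so that $\alpha_0=0$, the a priori bound is understood as trivial, with $1/\alpha_0=+\infty$). The permeability $\mathbf K$ is a symmetric $d\times d$ tensor (field) with $\mathbf K^{\min}|\boldsymbol\xi|^2\le\boldsymbol\xi^{t}\mathbf K\boldsymbol\xi\le\mathbf K^{\max}|\boldsymbol\xi|^2$ for all $\boldsymbol\xi\in\mathbb R^d$, where $0<\mathbf K^{\min}\le\mathbf K^{\max}<\infty$. The Hooke tensor $\mathbb C_{\mathrm{Hooke}}$ is a symmetric fourth-order tensor with $\mathbb C^{\min}_{\mathrm{Hooke}}|\boldsymbol\tau|^2\le\boldsymbol\tau:\mathbb C_{\mathrm{Hooke}}:\boldsymbol\tau\le\mathbb C^{\max}_{\mathrm{Hooke}}|\boldsymbol\tau|^2$ for all symmetric $\boldsymbol\tau\in\mathbb R^{d\times d}$, where $0<\mathbb C^{\min}_{\mathrm{Hooke}}\le\mathbb C^{\max}_{\mathrm{Hooke}}<\infty$.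 Spaces: $\mathbf V:=H^1_0(\Omega)^d\times H^1_0(\Omega)\times L^2(\Omega)$ with $\|(\mathbf d,\mu,\varphi)\|_{\mathbf V}^2:=\|\mathbf d\|_{1,\Omega}^2+\|\mu\|_{1,\Omega}^2+\|\varphi\|_{0,\Omega}^2$; $Q:=L^2(\Omega)$ with norm $\|\cdot\|_{0,\Omega}$; $\mathbf V\times Q$ carries the product norm. Operators: $\mathcal A:\mathbf V\to\mathbf V'$ is given by $$\langle\mathcal A(\mathbf d,\mu,\varphi),(\mathbf d^*,\mu^*,\varphi^* )\rangle:=\tfrac{\rho_0}{\tau^2}(\mathbf d,\mathbf d^* )+(\mathbb C_{\mathrm{Hooke}}:\boldsymbol\varepsilon(\mathbf d),\boldsymbol\varepsilon(\mathbf d^* ))+\beta(\varphi,\operatorname{div}\mathbf d^* )+\tau(\mathbf K\nabla\mu,\nabla\mu^* )+(\varphi,\mu^* )+\beta(\operatorname{div}\mathbf d,\varphi^* )-(\mu,\varphi^* )+M(\varphi,\varphi^* ),$$ and $\mathcal B:\mathbf V\to Q'$ by $\langle\mathcal B(\mathbf d,\mu,\varphi),\lambda^*\rangle:=(\lambda^*,\operatorname{div}\mathbf d)-(\varphi,\lambda^* )$. The data $\mathbf f^n,g^n$ at step $n$ are understood to already incorporate the known terms coming from the discretization of the time derivatives. *)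

theory Defs
  imports "HOL-Analysis.Analysis"
begin

section \<open>Bounded Lipschitz domains\<close>

text \<open>Near every boundary point the set is, in suitable orthonormal coordinates, the strict
  epigraph of a Lipschitz function of \<open>d - 1\<close> variables. The last coordinate axis is the unit
  vector \<open>e\<close>; the other coordinates range over its orthogonal complement, so that no type for
  \<open>d - 1\<close> dimensions is needed.\<close>

definition lipschitz_boundary :: "(real ^ 'd) set \<Rightarrow> bool" where
  "lipschitz_boundary \<Omega> \<longleftrightarrow>
     (\<forall>x\<in>frontier \<Omega>. \<exists>r>0. \<exists>e \<gamma> L. norm e = 1 \<and> L-lipschitz_on {z. z \<bullet> e = 0} \<gamma> \<and>
        \<Omega> \<inter> ball x r = {y \<in> ball x r. y \<bullet> e > (\<gamma> (y - (y \<bullet> e) *\<^sub>R e) :: real)})"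

definition bounded_lipschitz_domain :: "(real ^ 'd) set \<Rightarrow> bool" where
  "bounded_lipschitz_domain \<Omega> \<longleftrightarrow>
     open \<Omega> \<and> connected \<Omega> \<and> \<Omega> \<noteq> {} \<and> bounded \<Omega> \<and> lipschitz_boundary \<Omega>"


section \<open>Lebesgue and Sobolev spaces\<close>

text \<open>Elements of \<open>L\<^sup>2(\<Omega>)\<close> are represented by functions on the whole space, whose values outside
  \<open>\<Omega>\<close> are irrelevant; equality in \<open>L\<^sup>2(\<Omega>)\<close> is \<open>eq_ae\<close>.\<close>

definition L2 :: "(real ^ 'd) set \<Rightarrow> (real ^ 'd \<Rightarrow> 'b::euclidean_space) set" where
  "L2 \<Omega> = {u. u \<in> borel_measurable (lebesgue_on \<Omega>) \<and>
              integrable (lebesgue_on \<Omega>) (\<lambda>x. (norm (u x))\<^sup>2)}"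

definition eq_ae :: "(real ^ 'd) set \<Rightarrow> (real ^ 'd \<Rightarrow> 'b::euclidean_space) \<Rightarrow> (real ^ 'd \<Rightarrow> 'b) \<Rightarrow> bool" where
  "eq_ae \<Omega> u v \<longleftrightarrow> (AE x in lebesgue_on \<Omega>. u x = v x)"

definition inner_L2 :: "(real ^ 'd) set \<Rightarrow> (real ^ 'd \<Rightarrow> 'b::euclidean_space) \<Rightarrow> (real ^ 'd \<Rightarrow> 'b) \<Rightarrow> real" where
  "inner_L2 \<Omega> u v = integral\<^sup>L (lebesgue_on \<Omega>) (\<lambda>x. u x \<bullet> v x)"

definition norm_L2 :: "(real ^ 'd) set \<Rightarrow> (real ^ 'd \<Rightarrow> 'b::euclidean_space) \<Rightarrow> real" where
  "norm_L2 \<Omega> u = sqrt (integral\<^sup>L (lebesgue_on \<Omega>) (\<lambda>x. (norm (u x))\<^sup>2))"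

definition pderiv_cl :: "'d \<Rightarrow> (real ^ 'd \<Rightarrow> real) \<Rightarrow> real ^ 'd \<Rightarrow> real" where
  "pderiv_cl i \<psi> x = frechet_derivative \<psi> (at x) (axis i 1)"

primrec C_k :: "nat \<Rightarrow> (real ^ 'd \<Rightarrow> real) \<Rightarrow> bool" where
  "C_k 0 \<psi> \<longleftrightarrow> continuous_on UNIV \<psi>"
| "C_k (Suc k) \<psi> \<longleftrightarrow> (\<forall>x. \<psi> differentiable (at x)) \<and> (\<forall>i. C_k k (pderiv_cl i \<psi>))"

definition test_functions :: "(real ^ 'd) set \<Rightarrow> (real ^ 'd \<Rightarrow> real) set" where
  "test_functions \<Omega> =
     {\<psi>. (\<forall>k. C_k k \<psi>) \<and> compact (closure {x. \<psi> x \<noteq> 0}) \<and> closure {x. \<psi> x \<noteq> 0} \<subseteq> \<Omega>}"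

definition is_weak_grad :: "(real ^ 'd) set \<Rightarrow> (real ^ 'd \<Rightarrow> real) \<Rightarrow> (real ^ 'd \<Rightarrow> real ^ 'd) \<Rightarrow> bool" where
  "is_weak_grad \<Omega> u g \<longleftrightarrow>
     (\<forall>\<psi>\<in>test_functions \<Omega>. \<forall>i.
        integral\<^sup>L (lebesgue_on \<Omega>) (\<lambda>x. u x * pderiv_cl i \<psi> x)
          = - integral\<^sup>L (lebesgue_on \<Omega>) (\<lambda>x. g x $ i * \<psi> x))"

definition H1 :: "(real ^ 'd) set \<Rightarrow> (real ^ 'd \<Rightarrow> real) set" where
  "H1 \<Omega> = {u \<in> L2 \<Omega>. \<exists>g \<in> L2 \<Omega>. is_weak_grad \<Omega> u g}"

text \<open>The weak gradient is determined almost everywhere in \<open>\<Omega>\<close>; one representative is chosen.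
  Meaningful for \<open>u \<in> H1 \<Omega>\<close> only.\<close>

definition grad :: "(real ^ 'd) set \<Rightarrow> (real ^ 'd \<Rightarrow> real) \<Rightarrow> real ^ 'd \<Rightarrow> real ^ 'd" where
  "grad \<Omega> u = (SOME g. g \<in> L2 \<Omega> \<and> is_weak_grad \<Omega> u g)"

definition norm_H1 :: "(real ^ 'd) set \<Rightarrow> (real ^ 'd \<Rightarrow> real) \<Rightarrow> real" where
  "norm_H1 \<Omega> u = sqrt ((norm_L2 \<Omega> u)\<^sup>2 + (norm_L2 \<Omega> (grad \<Omega> u))\<^sup>2)"

text \<open>The closure of the test functions in \<open>H1 \<Omega>\<close>.\<close>

definition H10 :: "(real ^ 'd) set \<Rightarrow> (real ^ 'd \<Rightarrow> real) set" where
  "H10 \<Omega> = {u \<in> H1 \<Omega>. \<exists>\<psi> :: nat \<Rightarrow> real ^ 'd \<Rightarrow> real. (\<forall>k. \<psi> k \<in> test_functions \<Omega>) \<and>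
                (\<lambda>k. norm_H1 \<Omega> (\<lambda>x. u x - \<psi> k x)) \<longlonglongrightarrow> 0}"


section \<open>Vector fields\<close>

definition H10_vec :: "(real ^ 'd) set \<Rightarrow> (real ^ 'd \<Rightarrow> real ^ 'd) set" where
  "H10_vec \<Omega> = {d. \<forall>i. (\<lambda>x. d x $ i) \<in> H10 \<Omega>}"

definition grad_vec :: "(real ^ 'd) set \<Rightarrow> (real ^ 'd \<Rightarrow> real ^ 'd) \<Rightarrow> real ^ 'd \<Rightarrow> real ^ 'd ^ 'd" where
  "grad_vec \<Omega> d x = (\<chi> i. grad \<Omega> (\<lambda>y. d y $ i) x)"

definition strain :: "(real ^ 'd) set \<Rightarrow> (real ^ 'd \<Rightarrow> real ^ 'd) \<Rightarrow> real ^ 'd \<Rightarrow> real ^ 'd ^ 'd" where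
  "strain \<Omega> d x = (1/2) *\<^sub>R (grad_vec \<Omega> d x + transpose (grad_vec \<Omega> d x))"

definition dvg :: "(real ^ 'd) set \<Rightarrow> (real ^ 'd \<Rightarrow> real ^ 'd) \<Rightarrow> real ^ 'd \<Rightarrow> real" where
  "dvg \<Omega> d x = trace (grad_vec \<Omega> d x)"

definition norm_H1_vec :: "(real ^ 'd) set \<Rightarrow> (real ^ 'd \<Rightarrow> real ^ 'd) \<Rightarrow> real" where
  "norm_H1_vec \<Omega> d = sqrt ((norm_L2 \<Omega> d)\<^sup>2 + (norm_L2 \<Omega> (grad_vec \<Omega> d))\<^sup>2)"


section \<open>Material tensors\<close>

definition permeability_tensor :: "(real ^ 'd) set \<Rightarrow> (real ^ 'd \<Rightarrow> real ^ 'd ^ 'd) \<Rightarrow> real \<Rightarrow> real \<Rightarrow> bool" where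
  "permeability_tensor \<Omega> K kmin kmax \<longleftrightarrow>
     0 < kmin \<and> kmin \<le> kmax \<and> K \<in> borel_measurable (lebesgue_on \<Omega>) \<and>
     (AE x in lebesgue_on \<Omega>. transpose (K x) = K x \<and>
        (\<forall>\<xi>. kmin * (norm \<xi>)\<^sup>2 \<le> \<xi> \<bullet> (K x *v \<xi>) \<and> \<xi> \<bullet> (K x *v \<xi>) \<le> kmax * (norm \<xi>)\<^sup>2))"

definition tensor_apply :: "real ^ 'd ^ 'd ^ 'd ^ 'd \<Rightarrow> real ^ 'd ^ 'd \<Rightarrow> real ^ 'd ^ 'd" where
  "tensor_apply H \<sigma> = (\<chi> i j. \<Sum>k\<in>UNIV. \<Sum>l\<in>UNIV. H $ i $ j $ k $ l * \<sigma> $ k $ l)"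

text \<open>Symmetry is \<open>H\<^sub>i\<^sub>j\<^sub>k\<^sub>l = H\<^sub>k\<^sub>l\<^sub>i\<^sub>j\<close>; the minor symmetries of elasticity are not needed. On
  matrices, \<open>\<bullet>\<close> and \<open>norm\<close> are the Frobenius inner product and norm.\<close>

definition hooke_tensor :: "real ^ 'd ^ 'd ^ 'd ^ 'd \<Rightarrow> real \<Rightarrow> real \<Rightarrow> bool" where
  "hooke_tensor H cmin cmax \<longleftrightarrow>
     0 < cmin \<and> cmin \<le> cmax \<and>
     (\<forall>i j k l. H $ i $ j $ k $ l = H $ k $ l $ i $ j) \<and>
     (\<forall>\<sigma>. transpose \<sigma> = \<sigma> \<longrightarrow>
        cmin * (norm \<sigma>)\<^sup>2 \<le> \<sigma> \<bullet> tensor_apply H \<sigma> \<and> \<sigma> \<bullet> tensor_apply H \<sigma> \<le> cmax * (norm \<sigma>)\<^sup>2)"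


section \<open>The saddle point problem\<close>

type_synonym 'd field3 = "(real ^ 'd \<Rightarrow> real ^ 'd) \<times> (real ^ 'd \<Rightarrow> real) \<times> (real ^ 'd \<Rightarrow> real)"

definition V_space :: "(real ^ 'd) set \<Rightarrow> 'd field3 set" where
  "V_space \<Omega> = H10_vec \<Omega> \<times> H10 \<Omega> \<times> L2 \<Omega>"

fun norm_V :: "(real ^ 'd) set \<Rightarrow> 'd field3 \<Rightarrow> real" where
  "norm_V \<Omega> (d, \<mu>, \<phi>) = sqrt ((norm_H1_vec \<Omega> d)\<^sup>2 + (norm_H1 \<Omega> \<mu>)\<^sup>2 + (norm_L2 \<Omega> \<phi>)\<^sup>2)"

definition norm_VQ :: "(real ^ 'd) set \<Rightarrow> 'd field3 \<Rightarrow> (real ^ 'd \<Rightarrow> real) \<Rightarrow> real" where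
  "norm_VQ \<Omega> v q = sqrt ((norm_V \<Omega> v)\<^sup>2 + (norm_L2 \<Omega> q)\<^sup>2)"

fun eq_V :: "(real ^ 'd) set \<Rightarrow> 'd field3 \<Rightarrow> 'd field3 \<Rightarrow> bool" where
  "eq_V \<Omega> (d, \<mu>, \<phi>) (d', \<mu>', \<phi>') \<longleftrightarrow> eq_ae \<Omega> d d' \<and> eq_ae \<Omega> \<mu> \<mu>' \<and> eq_ae \<Omega> \<phi> \<phi>'"

text \<open>\<open>form_A \<dots> u v\<close> and \<open>form_B \<dots> v q\<close> are the duality pairings \<open>\<langle>A u, v\<rangle>\<close> and \<open>\<langle>B v, q\<rangle>\<close>.\<close>

fun form_A :: "(real ^ 'd) set \<Rightarrow> real \<Rightarrow> real \<Rightarrow> real \<Rightarrow> real \<Rightarrow> (real ^ 'd \<Rightarrow> real ^ 'd ^ 'd) \<Rightarrow>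
    real ^ 'd ^ 'd ^ 'd ^ 'd \<Rightarrow> 'd field3 \<Rightarrow> 'd field3 \<Rightarrow> real" where
  "form_A \<Omega> \<rho> \<tau> \<beta> M K H (d, \<mu>, \<phi>) (d', \<mu>', \<phi>') =
     \<rho> / \<tau>\<^sup>2 * inner_L2 \<Omega> d d'
     + inner_L2 \<Omega> (\<lambda>x. tensor_apply H (strain \<Omega> d x)) (strain \<Omega> d')
     + \<beta> * inner_L2 \<Omega> \<phi> (dvg \<Omega> d')
     + \<tau> * inner_L2 \<Omega> (\<lambda>x. K x *v grad \<Omega> \<mu> x) (grad \<Omega> \<mu>')
     + inner_L2 \<Omega> \<phi> \<mu>'
     + \<beta> * inner_L2 \<Omega> (dvg \<Omega> d) \<phi>'
     - inner_L2 \<Omega> \<mu> \<phi>'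
     + M * inner_L2 \<Omega> \<phi> \<phi>'"

fun form_B :: "(real ^ 'd) set \<Rightarrow> 'd field3 \<Rightarrow> (real ^ 'd \<Rightarrow> real) \<Rightarrow> real" where
  "form_B \<Omega> (d, \<mu>, \<phi>) q = inner_L2 \<Omega> q (dvg \<Omega> d) - inner_L2 \<Omega> \<phi> q"

definition step_solution :: "(real ^ 'd) set \<Rightarrow> real \<Rightarrow> real \<Rightarrow> real \<Rightarrow> real \<Rightarrow>
    (real ^ 'd \<Rightarrow> real ^ 'd ^ 'd) \<Rightarrow> real ^ 'd ^ 'd ^ 'd ^ 'd \<Rightarrow>
    (real ^ 'd \<Rightarrow> real ^ 'd) \<Rightarrow> (real ^ 'd \<Rightarrow> real) \<Rightarrow> (real ^ 'd \<Rightarrow> real) \<Rightarrow> (real ^ 'd \<Rightarrow> real) \<Rightarrow>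
    'd field3 \<Rightarrow> (real ^ 'd \<Rightarrow> real) \<Rightarrow> bool" where
  "step_solution \<Omega> \<rho> \<tau> \<beta> M K H f g p0 \<phi>0 u q \<longleftrightarrow>
     u \<in> V_space \<Omega> \<and> q \<in> L2 \<Omega> \<and>
     (\<forall>d' \<mu>' \<phi>'. (d', \<mu>', \<phi>') \<in> V_space \<Omega> \<longrightarrow>
        form_A \<Omega> \<rho> \<tau> \<beta> M K H u (d', \<mu>', \<phi>') + form_B \<Omega> (d', \<mu>', \<phi>') q
          = inner_L2 \<Omega> f d' + \<tau> * inner_L2 \<Omega> g \<mu>' - inner_L2 \<Omega> p0 \<phi>') \<and>
     (\<forall>q'\<in>L2 \<Omega>. form_B \<Omega> u q' = - inner_L2 \<Omega> \<phi>0 q')"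

end

theory Submission
  imports Defs
begin

text \<open>
  Two of the four unknowns can be eliminated by hand. The constraint says
  \<open>\<phi> = div d + \<phi>\<^sub>0\<close>, and testing the first equation with \<open>\<phi>\<^sup>*\<close> alone says
  \<open>\<lambda> = (\<beta> + M) div d + M \<phi>\<^sub>0 - \<mu> + p\<^sub>0\<close>. What remains is a problem for \<open>(d, \<mu>)\<close> in
  \<open>H\<^sup>1\<^sub>0(\<Omega>)\<^sup>d \<times> H\<^sup>1\<^sub>0(\<Omega>)\<close>. Its bilinear form is a symmetric form plus the skew coupling
  \<open>(div d, \<mu>\<^sup>*) - (\<mu>, div d\<^sup>*)\<close>. The coupling vanishes on the diagonal, so by the inequalities of
  Korn and Poincare the form is coercive, and the Lax-Milgram theorem applies
  (\<open>elliptic_saddle.solves_exists\<close>, \<open>elliptic_saddle.solves_unique\<close>).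

  For the a priori bound let \<open>E\<^sup>2\<close> be the value of the form at the solution and \<open>N\<close> the sum of
  the data norms. The data enter the energy identity through
  terms bounded by \<open>N |(d, \<mu>)|\<close>, and through \<open>(\<beta> + M) (\<phi>\<^sub>0, div d)\<close>. The energy contains
  \<open>(2 \<beta> + M) |div d|\<^sup>2\<close>, so the latter is at most \<open>2 \<surd>\<alpha>\<^sub>1 N E\<close>. Together with
  \<open>\<alpha>\<^sub>0 |(d, \<mu>)|\<^sup>2 \<lesssim> E\<^sup>2\<close> this gives the entries \<open>1 / \<alpha>\<^sub>0\<close> and \<open>\<surd>\<alpha>\<^sub>1 / \<surd>\<alpha>\<^sub>0\<close> of the maximum. The multiplier
  contains \<open>(\<beta> + M) div d\<close>, of norm at most \<open>2 \<surd>\<alpha>\<^sub>1 E\<close>, which brings in the entry \<open>\<alpha>\<^sub>1\<close>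
  (\<open>elliptic_saddle.solves_bound\<close>). Because the skew coupling drops out of the energy identity,
  its coefficient, which is \<open>1\<close> and not controlled by \<open>\<alpha>\<^sub>1\<close>, never enters the bound.

  The function spaces are made into Hilbert spaces as follows. The type \<open>l2\<close> of classes of
  square-integrable functions on the whole space is a complete inner product space. A function
  \<open>u\<close> in \<open>H\<^sup>1(\<Omega>)\<close> is replaced by its \<open>jet\<close>, the classes of \<open>u\<close> and of the components of
  its gradient, both extended by zero. Then \<open>H\<^sup>1\<^sub>0(\<Omega>)\<close> becomes the closure of the jets of
  test functions (\<open>H10_iff\<close>, \<open>H10_jets_surj\<close>). It is a closed subspace by
  construction, and every closed condition on jets needs to be checked for test functions only. In this
  way the Poincare inequality (\<open>H10_jets_poincare\<close>) and the symmetry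
  \<open>(\<partial>\<^sub>i u, \<partial>\<^sub>j v) = (\<partial>\<^sub>j u, \<partial>\<^sub>i v)\<close> behind Korn's inequality (\<open>H10_jets_swap\<close>, \<open>korn\<close>) reduce to
  integrations by parts. The gradient of a function in \<open>H\<^sup>1(\<Omega>)\<close> is an arbitrarily chosen
  representative; that its class is unique, so that jets are linear, is the fundamental lemma of
  the calculus of variations (\<open>AE_zero_if_orthogonal_to_test_functions\<close>).
\<close>

section \<open>The Lax-Milgram theorem on a closed subspace\<close>

lemma quadratic_nonneg_imp_zero:
  fixes b c :: real
  assumes "\<And>t. 0 \<le> 2 * t * b + t\<^sup>2 * c"
  shows "b = 0"
proof -
  define k where "k = 1 + \<bar>c\<bar>"
  have k: "0 < k" "c \<le> k" by (auto simp: k_def)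
  have "0 \<le> 2 * (- b / k) * b + (- b / k)\<^sup>2 * c" by (rule assms)
  also have "\<dots> \<le> 2 * (- b / k) * b + (- b / k)\<^sup>2 * k"
    using k by (intro add_left_mono mult_left_mono) auto
  also have "\<dots> = - (b\<^sup>2 / k)" using k by (simp add: field_simps power2_eq_square)
  finally have "b\<^sup>2 / k \<le> 0" by simp
  then show ?thesis using k by (simp add: divide_le_0_iff)
qed

text \<open>The direct method: a minimizing sequence of \<open>|u|\<^sup>2 - 2 l u\<close> on \<open>W\<close> is Cauchy by the
  parallelogram law, and the first variation at its limit is the asserted identity.\<close>

lemma riesz_closed_subspace:
  fixes W :: "'a::{real_inner,complete_space} set"
  assumes W: "subspace W" "closed W" and l: "bounded_linear l"
  shows "\<exists>w\<in>W. \<forall>v\<in>W. inner w v = l v"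
proof -
  interpret l: bounded_linear l by fact
  obtain B where B: "\<And>u. \<bar>l u\<bar> \<le> norm u * B" using l.bounded by (metis real_norm_def)
  define J where "J u = inner u u - 2 * l u" for u
  have lower: "- B\<^sup>2 \<le> J u" for u
  proof -
    have "2 * l u \<le> 2 * (norm u * B)" using B[of u] by linarith
    also have "\<dots> \<le> (norm u)\<^sup>2 + B\<^sup>2" using sum_squares_bound[of "norm u" B] by (simp add: mult.assoc)
    finally show ?thesis by (simp add: J_def power2_norm_eq_inner)
  qed
  have bdd: "bdd_below (J ` W)" by (rule bdd_belowI2) (rule lower)
  have ne: "W \<noteq> {}" using W(1) subspace_0 by blast
  define m where "m = Inf (J ` W)"
  have m_le: "m \<le> J u" if "u \<in> W" for u unfolding m_def using bdd that by (intro cInf_lower) auto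
  have "\<exists>w\<in>W. J w < m + 1 / real (Suc n)" for n
    using cInf_lessD[of "J ` W" "m + 1 / real (Suc n)"] ne by (auto simp: m_def)
  then obtain w where wW: "\<And>n. w n \<in> W" and wJ: "\<And>n. J (w n) < m + 1 / real (Suc n)" by metis
  have par: "(dist (w i) (w j))\<^sup>2 \<le> 2 * (1 / real (Suc i) + 1 / real (Suc j))" for i j
  proof -
    have "(dist (w i) (w j))\<^sup>2 = 2 * J (w i) + 2 * J (w j) - 4 * J ((1/2) *\<^sub>R (w i + w j))"
      by (simp add: dist_norm power2_norm_eq_inner J_def inner_simps l.add l.scaleR inner_commute
          field_simps)
    moreover have "m \<le> J ((1/2) *\<^sub>R (w i + w j))"
      using W(1) wW by (intro m_le) (auto intro!: subspace_scale subspace_add)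
    ultimately show ?thesis using wJ[of i] wJ[of j] unfolding distrib_left by linarith
  qed
  have "Cauchy w"
  proof (rule metric_CauchyI)
    fix e :: real assume e: "e > 0"
    then have "e\<^sup>2 / 4 > 0" by simp
    then obtain n where n: "1 / real (Suc n) < e\<^sup>2 / 4" using nat_approx_posE by blast
    show "\<exists>N. \<forall>i\<ge>N. \<forall>j\<ge>N. dist (w i) (w j) < e"
    proof (intro exI allI impI)
      fix i j assume ij: "i \<ge> n" "j \<ge> n"
      have "1 / real (Suc i) \<le> 1 / real (Suc n)" "1 / real (Suc j) \<le> 1 / real (Suc n)"
        using ij by (auto simp: field_simps)
      then have "(dist (w i) (w j))\<^sup>2 < e\<^sup>2" using par[of i j] n by argo
      then show "dist (w i) (w j) < e" using e by (metis less_imp_le power_less_imp_less_base)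
    qed
  qed
  then obtain u where u: "w \<longlonglongrightarrow> u" by (metis Cauchy_convergent_iff convergent_def)
  have uW: "u \<in> W" using closed_sequentially[OF W(2) wW u] .
  have lim1: "(\<lambda>n. J (w n)) \<longlonglongrightarrow> J u" unfolding J_def by (intro tendsto_intros u l.tendsto)
  have lim2: "(\<lambda>n. m + 1 / real (Suc n)) \<longlonglongrightarrow> m + 0"
    by (intro tendsto_intros LIMSEQ_Suc[OF lim_1_over_n])
  have "J u \<le> m + 0"
    by (rule LIMSEQ_le[OF lim1 lim2]) (use wJ less_imp_le in blast)
  then have Ju: "J u \<le> m" by simp
  have "inner u v = l v" if v: "v \<in> W" for v
  proof -
    have "0 \<le> 2 * t * (inner u v - l v) + t\<^sup>2 * inner v v" for t
    proof -
      have "J u \<le> J (u + t *\<^sub>R v)"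
        using Ju m_le[of "u + t *\<^sub>R v"] W(1) uW v by (force intro: subspace_add subspace_scale)
      then show ?thesis
        by (simp add: J_def inner_simps l.add l.scaleR inner_commute algebra_simps power2_eq_square)
    qed
    then show ?thesis using quadratic_nonneg_imp_zero by fastforce
  qed
  with uW show ?thesis by blast
qed

text \<open>With \<open>R u\<close> and \<open>w\<close> the Riesz representatives of \<open>a u\<close> and \<open>l\<close> in \<open>W\<close>, the solution
  is the fixed point of \<open>u - r (R u - w)\<close>. This map is a contraction of \<open>W\<close> for small \<open>r\<close>,
  because \<open>|u - r R u|\<^sup>2 \<le> (1 - 2 r \<gamma> + r\<^sup>2 B\<^sup>2) |u|\<^sup>2\<close>.\<close>

theorem lax_milgram:
  fixes W :: "'a::{real_inner,complete_space} set"
  assumes W: "subspace W" "closed W" and a: "bounded_bilinear a" and l: "bounded_linear l"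
    and "0 < \<gamma>" and coercive: "\<And>u. u \<in> W \<Longrightarrow> \<gamma> * (norm u)\<^sup>2 \<le> a u u"
  shows "\<exists>u\<in>W. \<forall>v\<in>W. a u v = l v"
proof -
  interpret a: bounded_bilinear a by fact
  obtain B where "B > 0" and B: "\<And>u v. \<bar>a u v\<bar> \<le> norm u * norm v * B"
    using a.pos_bounded by auto
  have "\<forall>u. \<exists>w\<in>W. \<forall>v\<in>W. inner w v = a u v"
    using riesz_closed_subspace[OF W a.bounded_linear_right] by blast
  then obtain R where RW: "\<And>u. R u \<in> W" and R: "\<And>u v. v \<in> W \<Longrightarrow> inner (R u) v = a u v" by metis
  obtain w where wW: "w \<in> W" and w: "\<And>v. v \<in> W \<Longrightarrow> inner w v = l v"
    using riesz_closed_subspace[OF W l] by metis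
  define r where "r = \<gamma> / (B\<^sup>2 + \<gamma>\<^sup>2)"
  define T where "T u = u - r *\<^sub>R (R u - w)" for u
  have den: "B\<^sup>2 + \<gamma>\<^sup>2 > 0" using \<open>B > 0\<close> by (simp add: add_pos_nonneg)
  have r: "r > 0" using \<open>0 < \<gamma>\<close> den by (simp add: r_def)
  define c where "c = sqrt (1 - r * \<gamma>)"
  have c: "c < 1" unfolding c_def using r \<open>0 < \<gamma>\<close> by simp
  have rB: "1 - 2 * r * \<gamma> + r\<^sup>2 * B\<^sup>2 \<le> 1 - r * \<gamma>"
  proof -
    have "r\<^sup>2 * B\<^sup>2 \<le> r\<^sup>2 * (B\<^sup>2 + \<gamma>\<^sup>2)" by (intro mult_left_mono) auto
    also have "\<dots> = r * \<gamma>" using den by (simp add: r_def power2_eq_square)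
    finally show ?thesis by linarith
  qed
  have "r * \<gamma> = \<gamma>\<^sup>2 / (B\<^sup>2 + \<gamma>\<^sup>2)" by (simp add: r_def power2_eq_square)
  also have "\<dots> \<le> 1" using den by (simp add: divide_le_eq_1)
  finally have c0: "0 \<le> 1 - r * \<gamma>" by simp
  have contr: "dist (T u) (T v) \<le> c * dist u v" if uv: "u \<in> W" "v \<in> W" for u v
  proof -
    define d where "d = u - v"
    define e where "e = R u - R v"
    have dW: "d \<in> W" "e \<in> W" using uv RW W(1) by (auto simp: d_def e_def subspace_diff)
    have e: "inner e x = a d x" if "x \<in> W" for x
      using R[OF that] by (simp add: e_def d_def inner_diff_left a.diff_left)
    have "(norm e)\<^sup>2 = a d e" using e[OF dW(2)] by (simp add: power2_norm_eq_inner)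
    also have "\<dots> \<le> norm d * norm e * B" using B[of d e] by simp
    finally have "norm e * norm e \<le> (norm d * B) * norm e" by (simp add: power2_eq_square mult_ac)
    then have ne: "norm e \<le> norm d * B" using \<open>B > 0\<close> by (cases "norm e = 0") auto
    have "T u - T v = d - r *\<^sub>R e" by (simp add: T_def d_def e_def algebra_simps)
    then have "(dist (T u) (T v))\<^sup>2 = (norm d)\<^sup>2 - 2 * r * inner e d + r\<^sup>2 * (norm e)\<^sup>2"
      unfolding dist_norm power2_norm_eq_inner
      by (simp add: inner_simps inner_commute power2_eq_square)
    also have "\<dots> \<le> (norm d)\<^sup>2 - 2 * r * (\<gamma> * (norm d)\<^sup>2) + r\<^sup>2 * (norm d * B)\<^sup>2"
      using r ne e[OF dW(1)] coercive[OF dW(1)]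
      by (intro add_mono diff_mono mult_left_mono power_mono) auto
    also have "\<dots> = (1 - 2 * r * \<gamma> + r\<^sup>2 * B\<^sup>2) * (norm d)\<^sup>2" by (simp add: algebra_simps power_mult_distrib)
    also have "\<dots> \<le> (1 - r * \<gamma>) * (norm d)\<^sup>2" using rB by (intro mult_right_mono) auto
    also have "\<dots> = (c * dist u v)\<^sup>2" using c0 by (simp add: c_def power_mult_distrib d_def dist_norm)
    finally show ?thesis using c0 by (intro power2_le_imp_le[of "dist (T u) (T v)"]) (auto simp: c_def)
  qed
  have "T ` W \<subseteq> W" using W(1) RW wW by (auto simp: T_def intro!: subspace_diff subspace_scale)
  then have "\<exists>!u\<in>W. T u = u"
    using W subspace_0[OF W(1)] c contr c0
    by (intro Banach_fix[where c = c]) (auto simp: complete_eq_closed c_def)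
  then obtain u where uW: "u \<in> W" and "T u = u" by blast
  then have "R u = w" using r by (simp add: T_def)
  then show ?thesis using R w uW by metis
qed

lemma bounded_bilinear_add:
  assumes "bounded_bilinear a" "bounded_bilinear b"
  shows "bounded_bilinear (\<lambda>x y. a x y + b x y)"
proof -
  interpret a: bounded_bilinear a by fact
  interpret b: bounded_bilinear b by fact
  obtain A where A: "\<And>x y. norm (a x y) \<le> norm x * norm y * A" using a.bounded by blast
  obtain B where B: "\<And>x y. norm (b x y) \<le> norm x * norm y * B" using b.bounded by blast
  have "norm (a x y + b x y) \<le> norm x * norm y * (A + B)" for x y
    using norm_triangle_ineq[of "a x y" "b x y"] A[of x y] B[of x y] by (simp add: distrib_left)
  then show ?thesis
    by (intro bounded_bilinear.intro)
      (auto simp: a.add_left a.add_right b.add_left b.add_right a.scaleR_left a.scaleR_right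
        b.scaleR_left b.scaleR_right scaleR_add_right)
qed

lemma bounded_bilinear_zero: "bounded_bilinear (\<lambda>x y. 0)"
  by (rule bounded_bilinear.intro) (auto intro: exI[of _ 0])

lemma bounded_bilinear_sum:
  "(\<And>i. i \<in> I \<Longrightarrow> bounded_bilinear (a i)) \<Longrightarrow> bounded_bilinear (\<lambda>x y. \<Sum>i\<in>I. a i x y)"
  by (induction I rule: infinite_finite_induct) (auto intro: bounded_bilinear_zero bounded_bilinear_add)

lemma bounded_bilinear_const_mult:
  fixes a :: "_ \<Rightarrow> _ \<Rightarrow> real"
  assumes "bounded_bilinear a"
  shows "bounded_bilinear (\<lambda>x y. c * a x y)"
proof -
  interpret a: bounded_bilinear a by fact
  obtain A where A: "\<And>x y. norm (a x y) \<le> norm x * norm y * A" using a.bounded by blast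
  have "norm (c * a x y) \<le> norm x * norm y * (\<bar>c\<bar> * A)" for x y
    using mult_left_mono[OF A[of x y], of "\<bar>c\<bar>"] by (simp add: abs_mult mult_ac)
  then show ?thesis
    by (intro bounded_bilinear.intro exI[of _ "\<bar>c\<bar> * A"] allI)
      (simp_all add: a.add_left a.add_right a.scaleR_left a.scaleR_right distrib_left)
qed

lemmas bounded_bilinear_inner_comp = bounded_bilinear.comp[OF bounded_bilinear_inner]

section \<open>Perturbed saddle point problems with an elliptic primal part\<close>

text \<open>The structure of one time step: \<open>X\<close> contains the displacements, \<open>Y\<close> the potentials and
  \<open>Z\<close> both the fluid content and the multipliers; \<open>D\<close> is the divergence and \<open>J\<close> the embedding of
  the potentials into \<open>Z\<close>. Coercivity is required of \<open>s\<close> and \<open>k\<close> only: on the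
  kernel of the constraint the fluid content equals the divergence of the displacement, which \<open>s\<close>
  controls. Hence \<open>M = 0\<close> is covered.\<close>

locale elliptic_saddle =
  fixes X :: "'x::{real_inner,complete_space} set" and Y :: "'y::{real_inner,complete_space} set"
    and Z :: "'z::{real_inner,complete_space} set"
    and s :: "'x \<Rightarrow> 'x \<Rightarrow> real" and k :: "'y \<Rightarrow> 'y \<Rightarrow> real"
    and D :: "'x \<Rightarrow> 'z" and J :: "'y \<Rightarrow> 'z" and \<beta> M \<gamma> :: real
  assumes X: "subspace X" "closed X" and Y: "subspace Y" "closed Y" and Z: "subspace Z"
    and s: "bounded_bilinear s" and k: "bounded_bilinear k"
    and D: "bounded_linear D" and J: "bounded_linear J"
    and DZ: "\<And>x. x \<in> X \<Longrightarrow> D x \<in> Z" and JZ: "\<And>y. y \<in> Y \<Longrightarrow> J y \<in> Z"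
    and \<gamma>: "0 < \<gamma>" and \<beta>: "0 \<le> \<beta>" and M: "0 \<le> M"
    and s_coercive: "\<And>x. x \<in> X \<Longrightarrow> \<gamma> * (norm x)\<^sup>2 \<le> s x x"
    and k_coercive: "\<And>y. y \<in> Y \<Longrightarrow> \<gamma> * (norm y)\<^sup>2 \<le> k y y"
begin

definition solves :: "('x \<Rightarrow> real) \<Rightarrow> ('y \<Rightarrow> real) \<Rightarrow> 'z \<Rightarrow> 'z \<Rightarrow> 'x \<Rightarrow> 'y \<Rightarrow> 'z \<Rightarrow> 'z \<Rightarrow> bool" where
  "solves F G p w x y z q \<longleftrightarrow> x \<in> X \<and> y \<in> Y \<and> z \<in> Z \<and> q \<in> Z \<and>
     (\<forall>x'\<in>X. s x x' + \<beta> * inner z (D x') + inner q (D x') = F x') \<and>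
     (\<forall>y'\<in>Y. k y y' + inner z (J y') = G y') \<and>
     (\<forall>z'\<in>Z. \<beta> * inner (D x) z' - inner (J y) z' + M * inner z z' - inner z' q = - inner p z') \<and>
     (\<forall>q'\<in>Z. inner q' (D x) - inner z q' = - inner w q')"

text \<open>Both defects lie in \<open>Z\<close>, so each may be used as the test element of its own equation, which
  then says that its norm is zero.\<close>

lemma solves_eliminated:
  assumes "solves F G p w x y z q" and "p \<in> Z" "w \<in> Z"
  shows "z = D x + w" and "q = (\<beta> + M) *\<^sub>R D x + M *\<^sub>R w - J y + p"
proof -
  have mem: "x \<in> X" "y \<in> Y" "z \<in> Z" "q \<in> Z"
    and e3: "\<And>z'. z' \<in> Z \<Longrightarrow> \<beta> * inner (D x) z' - inner (J y) z' + M * inner z z' - inner z' q = - inner p z'"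
    and e4: "\<And>q'. q' \<in> Z \<Longrightarrow> inner q' (D x) - inner z q' = - inner w q'"
    using assms(1) unfolding solves_def by blast+
  have Zin: "D x \<in> Z" "J y \<in> Z" using mem DZ JZ by auto
  let ?e = "D x - z + w"
  have "?e \<in> Z" using Z Zin mem assms by (simp add: subspace_add subspace_diff)
  from e4[OF this] have "inner ?e ?e = 0" by (simp add: inner_simps inner_commute algebra_simps)
  then have "?e = 0" by simp
  then show z: "z = D x + w" by (simp add: algebra_simps)
  let ?e = "\<beta> *\<^sub>R D x - J y + M *\<^sub>R z - q + p"
  have "?e \<in> Z" using Z Zin mem assms by (simp add: subspace_add subspace_diff subspace_scale)
  from e3[OF this] have "inner ?e ?e = 0" by (simp add: inner_simps inner_commute algebra_simps)
  then have "?e = 0" by simp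
  then show "q = (\<beta> + M) *\<^sub>R D x + M *\<^sub>R w - J y + p" by (simp add: z algebra_simps)
qed

text \<open>The reduced form \<open>a\<close> on \<open>X \<times> Y\<close> arises by inserting the formulas of
  \<open>solves_eliminated\<close> into the first two equations.\<close>

lemma solves_exists:
  assumes F: "bounded_linear F" and G: "bounded_linear G" and pw: "p \<in> Z" "w \<in> Z"
  shows "\<exists>x y z q. solves F G p w x y z q"
proof -
  interpret s: bounded_bilinear s by (rule s)
  interpret k: bounded_bilinear k by (rule k)
  interpret D: bounded_linear D by (rule D)
  interpret J: bounded_linear J by (rule J)
  interpret F: bounded_linear F by (rule F)
  interpret G: bounded_linear G by (rule G)
  define a where "a u v = s (fst u) (fst v) + (2 * \<beta> + M) * inner (D (fst u)) (D (fst v))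
      + - 1 * inner (J (snd u)) (D (fst v)) + k (snd u) (snd v) + inner (D (fst u)) (J (snd v))" for u v
  define l where "l v = F (fst v) - inner ((\<beta> + M) *\<^sub>R w + p) (D (fst v))
      + G (snd v) - inner w (J (snd v))" for v
  let ?W = "X \<times> Y"
  have W: "subspace ?W" "closed ?W" using X Y by (auto intro: subspace_Times closed_Times)
  have l: "bounded_linear l" unfolding l_def
    by (intro bounded_linear_add bounded_linear_sub bounded_linear_compose[OF F bounded_linear_fst]
        bounded_linear_compose[OF G bounded_linear_snd]
        bounded_linear_compose[OF bounded_linear_inner_right]
        bounded_linear_compose[OF D bounded_linear_fst] bounded_linear_compose[OF J bounded_linear_snd])
  have a: "bounded_bilinear a"
    unfolding a_def[abs_def]
    by (intro bounded_bilinear_add bounded_bilinear_const_mult bounded_bilinear_inner_comp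
        bounded_bilinear.comp[OF s] bounded_bilinear.comp[OF k] bounded_linear_fst bounded_linear_snd
        bounded_linear_compose[OF D] bounded_linear_compose[OF J])
  have coer: "\<gamma> * (norm u)\<^sup>2 \<le> a u u" if uW: "u \<in> ?W" for u
  proof -
    obtain x y where u: "u = (x, y)" "x \<in> X" "y \<in> Y" using uW by auto
    have "0 \<le> (2 * \<beta> + M) * inner (D x) (D x)" using \<beta> M by (simp add: inner_ge_zero)
    moreover have "(norm u)\<^sup>2 = (norm x)\<^sup>2 + (norm y)\<^sup>2" by (simp add: u norm_Pair)
    ultimately show ?thesis using s_coercive[OF u(2)] k_coercive[OF u(3)]
      by (simp add: a_def u(1) inner_commute[of "J y"] algebra_simps)
  qed
  obtain u where uW: "u \<in> ?W" and u: "\<And>v. v \<in> ?W \<Longrightarrow> a u v = l v"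
    using lax_milgram[OF W a l \<gamma> coer] by blast
  obtain x y where xy: "u = (x, y)" "x \<in> X" "y \<in> Y" by (metis SigmaE uW)
  define z where "z = D x + w"
  define q where "q = \<beta> *\<^sub>R D x - J y + M *\<^sub>R z + p"
  have Zin: "D x \<in> Z" "J y \<in> Z" using xy DZ JZ by auto
  then have zq: "z \<in> Z" "q \<in> Z" using Z pw
      by (auto simp: z_def q_def intro!: subspace_add subspace_diff subspace_scale)
  have "s x x' + \<beta> * inner z (D x') + inner q (D x') = F x'" if "x' \<in> X" for x'
    using u[of "(x', 0)"] that subspace_0[OF Y(1)]
    by (simp add: a_def l_def xy k.zero_right G.zero J.zero z_def q_def inner_simps algebra_simps)
  moreover have "k y y' + inner z (J y') = G y'" if "y' \<in> Y" for y'
    using u[of "(0, y')"] that subspace_0[OF X(1)]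
    by (simp add: a_def l_def xy s.zero_right F.zero D.zero z_def inner_simps algebra_simps)
  moreover have "\<beta> * inner (D x) z' - inner (J y) z' + M * inner z z' - inner z' q = - inner p z'" for z'
    by (simp add: q_def inner_simps inner_commute algebra_simps)
  moreover have "inner q' (D x) - inner z q' = - inner w q'" for q'
    by (simp add: z_def inner_simps inner_commute algebra_simps)
  ultimately have "solves F G p w x y z q" unfolding solves_def using xy zq by simp
  then show ?thesis by blast
qed

text \<open>Testing with the solution itself, the two coupling terms \<open>inner (J y) (D x)\<close> cancel.\<close>

lemma solves_energy:
  assumes "solves F G p w x y z q" and "p \<in> Z" "w \<in> Z"
  shows "s x x + (2 * \<beta> + M) * (norm (D x))\<^sup>2 + k y y
    = F x - inner p (D x) - (\<beta> + M) * inner w (D x) + G y - inner w (J y)"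
proof -
  note zq = solves_eliminated[OF assms]
  have "s x x + \<beta> * inner z (D x) + inner q (D x) = F x" "k y y + inner z (J y) = G y"
    using assms(1) by (auto simp: solves_def)
  then show ?thesis
    by (simp add: zq inner_simps inner_commute power2_norm_eq_inner algebra_simps)
qed

lemma solves_unique:
  assumes u: "solves F G p w x y z q" "solves F G p w x' y' z' q'" and pw: "p \<in> Z" "w \<in> Z"
  shows "x' = x \<and> y' = y \<and> z' = z \<and> q' = q"
proof -
  interpret s: bounded_bilinear s by (rule s)
  interpret k: bounded_bilinear k by (rule k)
  interpret D: bounded_linear D by (rule D)
  interpret J: bounded_linear J by (rule J)
  have u': "solves (\<lambda>_. 0) (\<lambda>_. 0) 0 0 (x' - x) (y' - y) (z' - z) (q' - q)"
    unfolding solves_def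
  proof (intro conjI ballI)
    note sol = u[unfolded solves_def]
    show "x' - x \<in> X" "y' - y \<in> Y" "z' - z \<in> Z" "q' - q \<in> Z"
      using sol X(1) Y(1) Z by (simp_all add: subspace_diff)
    show "s (x' - x) v + \<beta> * inner (z' - z) (D v) + inner (q' - q) (D v) = 0" if "v \<in> X" for v
      using conjunct1[OF conjunct2[OF conjunct2[OF conjunct2[OF conjunct2[OF sol(1)]]]],
          rule_format, OF that]
        conjunct1[OF conjunct2[OF conjunct2[OF conjunct2[OF conjunct2[OF sol(2)]]]], rule_format, OF that]
      by (simp add: s.diff_left inner_diff_left right_diff_distrib)
    have e2: "k y v + inner z (J v) = G v" "k y' v + inner z' (J v) = G v" if "v \<in> Y" for v
      using sol that by blast+
    show "k (y' - y) v + inner (z' - z) (J v) = 0" if "v \<in> Y" for v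
      using e2[OF that] by (simp add: k.diff_left inner_diff_left right_diff_distrib)
    have e3: "\<beta> * inner (D x) v - inner (J y) v + M * inner z v - inner v q = - inner p v"
      "\<beta> * inner (D x') v - inner (J y') v + M * inner z' v - inner v q' = - inner p v" if "v \<in> Z" for v
      using sol that by blast+
    show "\<beta> * inner (D (x' - x)) v - inner (J (y' - y)) v + M * inner (z' - z) v - inner v (q' - q)
        = - inner 0 v" if "v \<in> Z" for v
      using e3[OF that] by (simp add: D.diff J.diff inner_diff_left inner_diff_right right_diff_distrib)
    have e4: "inner v (D x) - inner z v = - inner w v" "inner v (D x') - inner z' v = - inner w v"
      if "v \<in> Z" for v using sol that by blast+
    show "inner v (D (x' - x)) - inner (z' - z) v = - inner 0 v" if "v \<in> Z" for v
      using e4[OF that] by (simp add: D.diff inner_diff_left inner_diff_right)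
  qed
  have Z0: "0 \<in> Z" using Z subspace_0 by blast
  have xy: "x' - x \<in> X" "y' - y \<in> Y" using u' by (auto simp: solves_def)
  have "s (x' - x) (x' - x) + (2 * \<beta> + M) * (norm (D (x' - x)))\<^sup>2 + k (y' - y) (y' - y) = 0"
    using solves_energy[OF u' Z0 Z0] by simp
  moreover have "0 \<le> (2 * \<beta> + M) * (norm (D (x' - x)))\<^sup>2" using \<beta> M by simp
  moreover have "0 \<le> \<gamma> * (norm (x' - x))\<^sup>2" "0 \<le> \<gamma> * (norm (y' - y))\<^sup>2" using \<gamma> by auto
  ultimately have "\<gamma> * (norm (x' - x))\<^sup>2 = 0" "\<gamma> * (norm (y' - y))\<^sup>2 = 0"
    using s_coercive[OF xy(1)] k_coercive[OF xy(2)] by linarith+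
  then have "x' = x" "y' = y" using \<gamma> by auto
  then show ?thesis using solves_eliminated[OF u(1) pw] solves_eliminated[OF u(2) pw] by simp
qed

text \<open>Here \<open>a\<close> and \<open>A\<close> stand for \<open>\<alpha>\<^sub>0\<close> and \<open>\<alpha>\<^sub>1\<close>, \<open>c\<close> for the constant of the Korn and Poincare
  inequalities, and \<open>\<kappa>\<close> for the norm of the divergence. The constant on the right depends on \<open>c\<close> and
  \<open>\<kappa>\<close> alone, which is the independence of the physical parameters.\<close>

lemma solves_bound:
  assumes sol: "solves F G p w x y z q" and pw: "p \<in> Z" "w \<in> Z"
    and F: "\<And>x. \<bar>F x\<bar> \<le> f * norm x" and G: "\<And>y. \<bar>G y\<bar> \<le> g * norm y"
    and Dn: "\<And>x. norm (D x) \<le> \<kappa> * norm x" and Jn: "\<And>y. norm (J y) \<le> norm y"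
    and fg: "0 \<le> f" "0 \<le> g" and \<kappa>: "0 \<le> \<kappa>" and c: "0 < c" "c \<le> 1" and a: "0 < a" "a \<le> A"
    and \<gamma>a: "c * a \<le> \<gamma>" and A: "2 * \<beta> \<le> A" "M \<le> A"
    and m: "1 / a \<le> m" "2 * sqrt A / sqrt a \<le> m" "A \<le> m"
  shows "norm x + norm y + norm z + norm q
    \<le> ((4 + \<kappa>) * ((2 + \<kappa>) / c) + 7) * m * (f + g + norm p + norm w)"
proof -
  define N where "N = f + g + norm p + norm w"
  define E where "E = sqrt (s x x + (2 * \<beta> + M) * (norm (D x))\<^sup>2 + k y y)"
  define n where "n = sqrt ((norm x)\<^sup>2 + (norm y)\<^sup>2)"
  note zq = solves_eliminated[OF sol pw]
  have xy: "x \<in> X" "y \<in> Y" using sol by (auto simp: solves_def)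
  have N: "f \<le> N" "g \<le> N" "norm p \<le> N" "norm w \<le> N" "0 \<le> N" using fg by (auto simp: N_def)
  have xn: "norm x \<le> n" "norm y \<le> n" by (auto simp: n_def real_le_rsqrt)
  have n0: "0 \<le> n" by (simp add: n_def)
  have s0: "0 \<le> s x x" "0 \<le> k y y"
    using s_coercive[OF xy(1)] k_coercive[OF xy(2)] \<gamma>
    by (meson order_trans zero_le_mult_iff less_imp_le zero_le_power2)+
  have bm0: "0 \<le> (2 * \<beta> + M) * (norm (D x))\<^sup>2" using \<beta> M by simp
  have E2: "E\<^sup>2 = s x x + (2 * \<beta> + M) * (norm (D x))\<^sup>2 + k y y" and E0: "0 \<le> E"
    unfolding E_def using s0 bm0 by auto
  have A0: "0 < A" using a by linarith
  have ca: "0 < c * a" using c a by simp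
  have "c * a * n\<^sup>2 \<le> E\<^sup>2"
  proof -
    have "c * a * n\<^sup>2 \<le> \<gamma> * n\<^sup>2" using \<gamma>a by (rule mult_right_mono) simp
    also have "\<dots> \<le> E\<^sup>2"
      using s_coercive[OF xy(1)] k_coercive[OF xy(2)] bm0 by (simp add: E2 n_def algebra_simps)
    finally show ?thesis .
  qed
  then have "(sqrt (c * a) * n)\<^sup>2 \<le> E\<^sup>2" using ca by (simp add: power_mult_distrib)
  then have nE: "sqrt (c * a) * n \<le> E" using E0 by (rule power2_le_imp_le)
  \<comment> \<open>Below, \<open>(\<beta> + M) |D x|\<close> is always split as \<open>\<surd>(\<beta> + M)\<close> times a part of the energy.\<close>
  have DE: "sqrt (\<beta> + M) * norm (D x) \<le> E"
  proof (rule power2_le_imp_le[OF _ E0])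
    have "(\<beta> + M) * (norm (D x))\<^sup>2 \<le> (2 * \<beta> + M) * (norm (D x))\<^sup>2"
      using \<beta> by (intro mult_right_mono) auto
    then show "(sqrt (\<beta> + M) * norm (D x))\<^sup>2 \<le> E\<^sup>2"
      using \<beta> M s0 by (simp add: power_mult_distrib E2)
  qed
  have bA: "sqrt (\<beta> + M) \<le> 2 * sqrt A"
  proof -
    have "\<beta> + M \<le> 4 * A" using A \<beta> M by linarith
    then have "sqrt (\<beta> + M) \<le> sqrt (4 * A)" by simp
    then show ?thesis by (simp add: real_sqrt_mult)
  qed
  have bDx: "(\<beta> + M) * norm (D x) \<le> 2 * sqrt A * E"
  proof -
    have "(\<beta> + M) * norm (D x) = sqrt (\<beta> + M) * (sqrt (\<beta> + M) * norm (D x))" using \<beta> M by simp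
    also have "\<dots> \<le> 2 * sqrt A * E" using DE bA A0 \<beta> M by (intro mult_mono) auto
    finally show ?thesis .
  qed
  have "E\<^sup>2 = F x - inner p (D x) - (\<beta> + M) * inner w (D x) + G y - inner w (J y)"
    unfolding E2 by (rule solves_energy[OF sol pw])
  also have "\<dots> \<le> \<bar>F x\<bar> + \<bar>inner p (D x)\<bar> + (\<beta> + M) * \<bar>inner w (D x)\<bar> + \<bar>G y\<bar> + \<bar>inner w (J y)\<bar>"
  proof -
    have "- ((\<beta> + M) * inner w (D x)) \<le> (\<beta> + M) * \<bar>inner w (D x)\<bar>"
      using mult_left_mono[OF abs_ge_minus_self[of "inner w (D x)"], of "\<beta> + M"] \<beta> M by simp
    then show ?thesis by linarith
  qed
  also have "\<dots> \<le> f * n + norm p * (\<kappa> * n) + norm w * (2 * sqrt A * E) + g * n + norm w * n"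
  proof (intro add_mono)
    show "\<bar>F x\<bar> \<le> f * n" "\<bar>G y\<bar> \<le> g * n"
      using F[of x] G[of y] fg xn by (meson mult_left_mono order_trans)+
    have "norm (D x) \<le> \<kappa> * n" using Dn[of x] \<kappa> xn by (meson mult_left_mono order_trans)
    then show "\<bar>inner p (D x)\<bar> \<le> norm p * (\<kappa> * n)"
      by (meson Cauchy_Schwarz_ineq2 mult_left_mono norm_ge_zero order_trans)
    have "norm (J y) \<le> n" using Jn[of y] xn by linarith
    then show "\<bar>inner w (J y)\<bar> \<le> norm w * n"
      by (meson Cauchy_Schwarz_ineq2 mult_left_mono norm_ge_zero order_trans)
    have "(\<beta> + M) * \<bar>inner w (D x)\<bar> \<le> (\<beta> + M) * (norm w * norm (D x))"
      using \<beta> M by (intro mult_left_mono Cauchy_Schwarz_ineq2) auto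
    also have "\<dots> = norm w * ((\<beta> + M) * norm (D x))" by simp
    also have "\<dots> \<le> norm w * (2 * sqrt A * E)" by (intro mult_left_mono bDx) auto
    finally show "(\<beta> + M) * \<bar>inner w (D x)\<bar> \<le> norm w * (2 * sqrt A * E)" .
  qed
  also have "\<dots> \<le> (1 + \<kappa>) * N * n + 2 * sqrt A * N * E"
  proof -
    have "norm p * (\<kappa> * n) \<le> N * (\<kappa> * n)" using N \<kappa> n0 by (intro mult_right_mono) auto
    moreover have "norm w * (2 * sqrt A * E) \<le> N * (2 * sqrt A * E)"
      using N A0 E0 by (intro mult_right_mono) auto
    moreover have "(f + g + norm w) * n \<le> N * n" using n0 by (intro mult_right_mono) (auto simp: N_def)
    ultimately show ?thesis by (simp add: algebra_simps)
  qed
  finally have en: "E\<^sup>2 \<le> (1 + \<kappa>) * N * n + 2 * sqrt A * N * E" .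
  define r where "r = sqrt (c * a)"
  have r: "0 < r" "r\<^sup>2 = c * a" using ca by (auto simp: r_def)
  have EB: "r * E \<le> (1 + \<kappa>) * N + 2 * sqrt A * N * r"
  proof (cases "E = 0")
    case False
    have "(r * E) * E \<le> (1 + \<kappa>) * N * (r * n) + 2 * sqrt A * N * r * E"
      using mult_left_mono[OF en, of r] r by (simp add: algebra_simps power2_eq_square)
    also have "\<dots> \<le> (1 + \<kappa>) * N * E + 2 * sqrt A * N * r * E"
      using nE \<kappa> N by (intro add_right_mono mult_left_mono) (auto simp: r_def)
    finally have "(r * E) * E \<le> ((1 + \<kappa>) * N + 2 * sqrt A * N * r) * E" by (simp add: algebra_simps)
    then show ?thesis using False E0 mult_le_cancel_right_pos[of E] by simp
  qed (use \<kappa> N A0 r in simp)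
  \<comment> \<open>The energy bound \<open>EB\<close> is now compared with the maximum \<open>m\<close>: its two terms correspond to
    \<open>1 / a\<close> and to \<open>h\<close>.\<close>
  define h where "h = sqrt A / sqrt a"
  have h1: "1 \<le> h" using a by (simp add: h_def)
  have sr: "sqrt A * r \<le> h * a"
  proof -
    have "r \<le> sqrt a" unfolding r_def using c a by (simp add: mult_le_cancel_right1)
    then have "sqrt A * r \<le> sqrt A * sqrt a" using A0 by (intro mult_left_mono) auto
    also have "\<dots> = h * a" using a by (simp add: h_def field_simps)
    finally show ?thesis .
  qed
  have m0: "0 < m" using m(1) a by (meson divide_pos_pos less_le_trans zero_less_one)
  have am: "1 \<le> a * m" using m(1) a by (simp add: field_simps)
  have hm: "2 * h \<le> m" using m(2) by (simp add: h_def)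
  have nb: "n \<le> (2 + \<kappa>) / c * (m * N)"
  proof -
    have "c * a * n = r * (r * n)" using r(2) by (simp add: power2_eq_square)
    also have "\<dots> \<le> r * E" using nE r by (intro mult_left_mono) (auto simp: r_def)
    also have "\<dots> \<le> (1 + \<kappa>) * N + 2 * N * (sqrt A * r)" using EB by (simp add: mult_ac)
    also have "\<dots> \<le> (1 + \<kappa>) * N * (a * m) + N * (a * m)"
    proof (rule add_mono)
      show "(1 + \<kappa>) * N \<le> (1 + \<kappa>) * N * (a * m)"
        using \<kappa> N mult_left_mono[OF am, of "(1 + \<kappa>) * N"] by simp
      have "2 * (sqrt A * r) \<le> 2 * (h * a)" using sr by simp
      also have "\<dots> = a * (2 * h)" by simp
      also have "\<dots> \<le> a * m" using hm a by (intro mult_left_mono) auto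
      finally show "2 * N * (sqrt A * r) \<le> N * (a * m)"
        using N(5) by (metis mult.assoc mult.commute mult_left_mono)
    qed
    also have "\<dots> = a * ((2 + \<kappa>) * (m * N))" by (simp add: algebra_simps)
    finally have "a * (c * n) \<le> a * ((2 + \<kappa>) * (m * N))" by (simp add: mult_ac)
    then have "c * n \<le> (2 + \<kappa>) * (m * N)" using a by simp
    then show ?thesis using c by (simp add: field_simps)
  qed
  have Nm: "N \<le> m * N" using h1 hm N(5) by (simp add: mult_le_cancel_right1)
  have bm: "(\<beta> + M) * norm (D x) \<le> ((1 + \<kappa>) / c + 4) * (m * N)"
  proof -
    have cr: "c \<le> r / sqrt a"
    proof -
      have "c * sqrt a \<le> sqrt c * sqrt a"
        using c a by (intro mult_right_mono) (auto simp: real_le_rsqrt power2_eq_square mult_le_one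
            mult_left_le)
      then show ?thesis using a by (simp add: r_def real_sqrt_mult field_simps)
    qed
    have "r * (sqrt A * E) \<le> sqrt A * ((1 + \<kappa>) * N + 2 * sqrt A * N * r)"
      using mult_left_mono[OF EB, of "sqrt A"] A0 by (simp add: mult_ac)
    also have "\<dots> = (1 + \<kappa>) * N * sqrt A + 2 * A * N * r" using A0 by (simp add: algebra_simps)
    finally have "sqrt A * E \<le> (1 + \<kappa>) * N * (sqrt A / r) + 2 * A * N"
      using r by (simp add: field_simps)
    moreover have "sqrt A / r \<le> h / c"
    proof -
      have "sqrt A * (c * sqrt a) \<le> sqrt A * r" using cr a A0
          by (intro mult_left_mono) (auto simp: field_simps)
      then show ?thesis using r c a by (simp add: h_def field_simps)
    qed
    ultimately have "sqrt A * E \<le> (1 + \<kappa>) * N * (h / c) + 2 * A * N"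
      using \<kappa> N mult_left_mono[of "sqrt A / r" "h / c" "(1 + \<kappa>) * N"] by simp
    then have "2 * sqrt A * E \<le> 2 * ((1 + \<kappa>) * N * (h / c) + 2 * A * N)" by simp
    also have "\<dots> = (1 + \<kappa>) / c * (2 * h * N) + 4 * (A * N)" by simp
    also have "\<dots> \<le> (1 + \<kappa>) / c * (m * N) + 4 * (m * N)"
      using hm m(3) N \<kappa> c by (intro add_mono mult_left_mono mult_right_mono) auto
    finally show ?thesis using bDx by (simp add: algebra_simps)
  qed
  have "norm (D x) \<le> \<kappa> * n" using Dn[of x] \<kappa> xn by (meson mult_left_mono order_trans)
  then have zb: "norm z \<le> \<kappa> * n + m * N" using norm_triangle_ineq[of "D x" w] N Nm by (simp add: zq)
  have "norm q \<le> norm ((\<beta> + M) *\<^sub>R D x) + norm (M *\<^sub>R w) + norm (J y) + norm p"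
    unfolding zq(2)
    using norm_triangle_ineq[of "(\<beta> + M) *\<^sub>R D x + M *\<^sub>R w - J y" p]
      norm_triangle_ineq4[of "(\<beta> + M) *\<^sub>R D x + M *\<^sub>R w" "J y"]
      norm_triangle_ineq[of "(\<beta> + M) *\<^sub>R D x" "M *\<^sub>R w"] by linarith
  also have "\<dots> = (\<beta> + M) * norm (D x) + M * norm w + norm (J y) + norm p" using \<beta> M by simp
  also have "\<dots> \<le> ((1 + \<kappa>) / c + 4) * (m * N) + m * N + n + m * N"
  proof (intro add_mono)
    show "M * norm w \<le> m * N" using N M A m m0 by (intro mult_mono) auto
  qed (use bm N xn Jn[of y] Nm in auto)
  finally have qb: "norm q \<le> ((1 + \<kappa>) / c + 6) * (m * N) + n" by (simp add: algebra_simps)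
  have "norm x + norm y + norm z + norm q \<le> (3 + \<kappa>) * n + ((1 + \<kappa>) / c + 7) * (m * N)"
    using xn zb qb by (simp add: algebra_simps)
  also have "\<dots> \<le> (3 + \<kappa>) * ((2 + \<kappa>) / c * (m * N)) + ((2 + \<kappa>) / c + 7) * (m * N)"
    using nb \<kappa> c m0 N by (intro add_mono mult_left_mono mult_right_mono divide_right_mono) auto
  also have "\<dots> = ((4 + \<kappa>) * ((2 + \<kappa>) / c) + 7) * m * N" by algebra
  finally show ?thesis unfolding N_def .
qed

end

section \<open>The Hilbert space of square-integrable functions\<close>

definition square_integrable :: "('a::euclidean_space \<Rightarrow> real) \<Rightarrow> bool" where
  "square_integrable u \<longleftrightarrow> u \<in> borel_measurable lebesgue \<and> integrable lebesgue (\<lambda>x. (u x)\<^sup>2)"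

lemma square_integrable_measurable [dest]: "square_integrable u \<Longrightarrow> u \<in> borel_measurable lebesgue"
  by (simp add: square_integrable_def)

lemma square_integrable_mult:
  assumes "square_integrable u" "square_integrable v"
  shows "integrable lebesgue (\<lambda>x. u x * v x)"
proof (rule Bochner_Integration.integrable_bound)
  show "integrable lebesgue (\<lambda>x. (u x)\<^sup>2 + (v x)\<^sup>2)"
    using assms by (simp add: square_integrable_def)
  show "(\<lambda>x. u x * v x) \<in> borel_measurable lebesgue"
    using assms by (intro borel_measurable_times) auto
  show "AE x in lebesgue. norm (u x * v x) \<le> norm ((u x)\<^sup>2 + (v x)\<^sup>2)"
  proof (rule AE_I2)
    fix x
    have "2 * \<bar>u x\<bar> * \<bar>v x\<bar> \<le> (u x)\<^sup>2 + (v x)\<^sup>2" using sum_squares_bound[of "\<bar>u x\<bar>" "\<bar>v x\<bar>"] by simp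
    moreover have "0 \<le> \<bar>u x\<bar> * \<bar>v x\<bar>" by simp
    ultimately have "\<bar>u x\<bar> * \<bar>v x\<bar> \<le> (u x)\<^sup>2 + (v x)\<^sup>2" by linarith
    then show "norm (u x * v x) \<le> norm ((u x)\<^sup>2 + (v x)\<^sup>2)" by (simp add: abs_mult)
  qed
qed

lemma square_integrable_add:
  assumes "square_integrable u" "square_integrable v"
  shows "square_integrable (\<lambda>x. u x + v x)"
  using assms square_integrable_mult[OF assms]
  by (auto simp: square_integrable_def power2_sum mult.assoc)

lemma square_integrable_scale: "square_integrable u \<Longrightarrow> square_integrable (\<lambda>x. c * u x)"
  by (auto simp: square_integrable_def power_mult_distrib)

lemma square_integrable_zero: "square_integrable (\<lambda>x. 0)"
  by (simp add: square_integrable_def)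

lemma square_integrable_uminus: "square_integrable u \<Longrightarrow> square_integrable (\<lambda>x. - u x)"
  by (auto simp: square_integrable_def)

lemma square_integrable_diff:
  "square_integrable u \<Longrightarrow> square_integrable v \<Longrightarrow> square_integrable (\<lambda>x. u x - v x)"
  using square_integrable_add[of u "\<lambda>x. - v x"] square_integrable_uminus[of v] by simp

text \<open>Functions on the whole space, so that one type serves all domains: functions on a domain are
  extended by zero.\<close>

quotient_type (overloaded) 'a l2 = "'a::euclidean_space \<Rightarrow> real" / partial:
    "\<lambda>u v. square_integrable u \<and> square_integrable v \<and> (AE x in lebesgue. u x = v x)"
proof (rule part_equivpI)
  show "\<exists>u :: 'a \<Rightarrow> real. square_integrable u \<and> square_integrable u \<and> (AE x in lebesgue. u x = u x)"
    using square_integrable_zero by auto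
  show "symp (\<lambda>u v :: 'a \<Rightarrow> real. square_integrable u \<and> square_integrable v \<and> (AE x in lebesgue. u x = v x))"
    by (rule sympI) (auto simp: eq_commute)
  show "transp (\<lambda>u v :: 'a \<Rightarrow> real. square_integrable u \<and> square_integrable v \<and> (AE x in lebesgue. u
      x = v x))"
    by (rule transpI) (auto elim: AE_mp)
qed

lemma l2_exhaust:
  obtains u where "square_integrable u" "U = abs_l2 u"
  using that[of "rep_l2 U"] Quotient3_abs_rep[OF Quotient3_l2, of U] Quotient3_rep_reflp[OF
      Quotient3_l2, of U]
  by simp

lemma abs_l2_eq_iff:
  assumes "square_integrable u" "square_integrable v"
  shows "abs_l2 u = abs_l2 v \<longleftrightarrow> (AE x in lebesgue. u x = v x)"
  using assms Quotient3_rel[OF Quotient3_l2, of u v] by simp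

instantiation l2 :: (euclidean_space) real_inner
begin

lift_definition zero_l2 :: "'a l2" is "\<lambda>x. 0" by (simp add: square_integrable_zero)
lift_definition plus_l2 :: "'a l2 \<Rightarrow> 'a l2 \<Rightarrow> 'a l2" is "\<lambda>u v x. u x + v x"
  by (auto intro: square_integrable_add elim: AE_mp)
lift_definition uminus_l2 :: "'a l2 \<Rightarrow> 'a l2" is "\<lambda>u x. - u x"
  by (auto intro: square_integrable_uminus)
lift_definition minus_l2 :: "'a l2 \<Rightarrow> 'a l2 \<Rightarrow> 'a l2" is "\<lambda>u v x. u x - v x"
  by (auto intro: square_integrable_diff elim: AE_mp)
lift_definition scaleR_l2 :: "real \<Rightarrow> 'a l2 \<Rightarrow> 'a l2" is "\<lambda>c u x. c * u x"
  by (auto intro: square_integrable_scale)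
lift_definition inner_l2 :: "'a l2 \<Rightarrow> 'a l2 \<Rightarrow> real" is "\<lambda>u v. \<integral>x. u x * v x \<partial>lebesgue"
proof -
  fix u u' v v' :: "'a \<Rightarrow> real"
  assume u: "square_integrable u \<and> square_integrable u' \<and> (AE x in lebesgue. u x = u' x)"
    and v: "square_integrable v \<and> square_integrable v' \<and> (AE x in lebesgue. v x = v' x)"
  have "AE x in lebesgue. u x * v x = u' x * v' x" using u v by (auto elim: AE_mp)
  then show "(\<integral>x. u x * v x \<partial>lebesgue) = (\<integral>x. u' x * v' x \<partial>lebesgue)"
    using u v by (intro integral_cong_AE borel_measurable_times) auto
qed

definition norm_l2 :: "'a l2 \<Rightarrow> real" where "norm_l2 u = sqrt (inner u u)"
definition dist_l2 :: "'a l2 \<Rightarrow> 'a l2 \<Rightarrow> real" where "dist_l2 u v = norm (u - v)"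
definition sgn_l2 :: "'a l2 \<Rightarrow> 'a l2" where "sgn_l2 u = scaleR (inverse (norm u)) u"
definition uniformity_l2 :: "('a l2 \<times> 'a l2) filter" where
  "uniformity_l2 = (INF e\<in>{0<..}. principal {(u, v). dist u v < e})"
definition open_l2 :: "'a l2 set \<Rightarrow> bool" where
  "open_l2 S \<longleftrightarrow> (\<forall>u\<in>S. \<forall>\<^sub>F (u', v) in uniformity. u' = u \<longrightarrow> v \<in> S)"

instance
proof
  fix u v w :: "'a l2" and c d :: real
  show "u + v + w = u + (v + w)" by transfer (auto intro!: square_integrable_add simp: add.assoc)
  show "u + v = v + u" by transfer (auto intro!: square_integrable_add simp: add.commute)
  show "0 + u = u" by transfer auto
  show "- u + u = 0" by transfer (auto intro: square_integrable_zero)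
  show "u - v = u + - v"
    by transfer (auto intro!: square_integrable_diff square_integrable_add square_integrable_uminus)
  show "c *\<^sub>R (u + v) = c *\<^sub>R u + c *\<^sub>R v"
    by transfer (auto intro!: square_integrable_add square_integrable_scale simp: distrib_left)
  show "(c + d) *\<^sub>R u = c *\<^sub>R u + d *\<^sub>R u"
    by transfer (auto intro!: square_integrable_add square_integrable_scale
        square_integrable_scale[of _ "c + d", simplified distrib_right] simp: distrib_right)
  show "c *\<^sub>R d *\<^sub>R u = (c * d) *\<^sub>R u"
    by transfer (auto intro!: square_integrable_scale square_integrable_scale[of _ "c * d",
        simplified mult.assoc] simp: mult.assoc)
  show "1 *\<^sub>R u = u" by transfer auto
  show "dist u v = norm (u - v)" by (simp add: dist_l2_def)
  show "sgn u = scaleR (inverse (norm u)) u" by (simp add: sgn_l2_def)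
  show "norm u = sqrt (inner u u)" by (simp add: norm_l2_def)
  show "uniformity = (INF e\<in>{0<..}. principal {(u, v). dist u (v :: 'a l2) < e})"
    by (simp add: uniformity_l2_def)
  show "open U \<longleftrightarrow> (\<forall>u\<in>U. \<forall>\<^sub>F (u', v) in uniformity. u' = u \<longrightarrow> v \<in> U)" for U :: "'a l2 set"
    by (simp add: open_l2_def)
  show "inner u v = inner v u" by transfer (simp add: mult.commute)
  show "inner (u + v) w = inner u w + inner v w"
    by transfer (simp add: distrib_right square_integrable_mult)
  show "inner (c *\<^sub>R u) v = c * inner u v" by transfer (simp add: mult.assoc)
  show "0 \<le> inner u u" by transfer simp
  show "inner u u = 0 \<longleftrightarrow> u = 0"
  proof transfer
    fix u :: "'a \<Rightarrow> real"
    assume u: "square_integrable u \<and> square_integrable u \<and> (AE x in lebesgue. u x = u x)"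
    have "(\<integral>x. u x * u x \<partial>lebesgue) = 0 \<longleftrightarrow> (AE x in lebesgue. u x * u x = 0)"
      using square_integrable_mult[of u u] u by (intro integral_nonneg_eq_0_iff_AE) auto
    then show "((\<integral>x. u x * u x \<partial>lebesgue) = 0) \<longleftrightarrow>
        (square_integrable u \<and> square_integrable (\<lambda>x::'a. 0) \<and> (AE x in lebesgue. u x = 0))"
      using u square_integrable_zero[where 'a = 'a] by simp
  qed
qed

end

lemma inner_abs_l2:
  "square_integrable u \<Longrightarrow> square_integrable v \<Longrightarrow> inner (abs_l2 u) (abs_l2 v) = (\<integral>x. u x * v x \<partial>lebesgue)"
  by (simp add: inner_l2.abs_eq)

lemma norm_abs_l2: "square_integrable u \<Longrightarrow> (norm (abs_l2 u))\<^sup>2 = (\<integral>x. (u x)\<^sup>2 \<partial>lebesgue)"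
  unfolding power2_norm_eq_inner by (simp add: inner_abs_l2 power2_eq_square)

lemma nn_integral_dist_l2:
  assumes "square_integrable u" "square_integrable v"
  shows "(\<integral>\<^sup>+x. ennreal ((u x - v x)\<^sup>2) \<partial>lebesgue) = ennreal ((dist (abs_l2 u) (abs_l2 v))\<^sup>2)"
  using square_integrable_diff[OF assms] norm_abs_l2[OF square_integrable_diff[OF assms]] assms
  by (subst nn_integral_eq_integral) (auto simp: dist_norm minus_l2.abs_eq square_integrable_def)

text \<open>All later terms are close to the \<open>k\<close>-th one, so the estimate serves both for consecutive
  terms and, in Fatou's lemma, for the distance to the limit.\<close>

lemma fast_subsequence:
  fixes S :: "nat \<Rightarrow> 'a::metric_space"
  assumes "Cauchy S"
  shows "\<exists>r. strict_mono r \<and> (\<forall>i j k. k \<le> i \<longrightarrow> k \<le> j \<longrightarrow> dist (S (r i)) (S (r j)) < (1/2)^k)"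
proof -
  have "\<exists>n. \<forall>i\<ge>n. \<forall>j\<ge>n. dist (S i) (S j) < (1/2)^k" for k :: nat
    using assms by (simp add: Cauchy_def)
  then obtain N where N: "\<And>k i j. i \<ge> N k \<Longrightarrow> j \<ge> N k \<Longrightarrow> dist (S i) (S j) < (1/2)^k" by metis
  define r where "r k = (\<Sum>i\<le>k. Suc (N i))" for k
  have mono: "strict_mono r" by (rule strict_monoI_Suc) (simp add: r_def)
  have "N k \<le> r k" for k unfolding r_def
    by (rule order_trans[OF _ member_le_sum[of k]]) auto
  then have "N k \<le> r i" if "k \<le> i" for i k
    using that mono by (meson order_trans strict_mono_less_eq)
  with N mono show ?thesis by blast
qed

text \<open>The Riesz-Fischer theorem. Along a fast subsequence \<open>\<Sum> 2\<^sup>k |u\<^sub>k\<^sub>+\<^sub>1 - u\<^sub>k|\<^sup>2\<close> has a finite integral,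
  hence is finite almost everywhere. By the inequality of arithmetic and geometric means
  \<open>|u\<^sub>k\<^sub>+\<^sub>1 - u\<^sub>k| \<le> 2\<^sup>k |u\<^sub>k\<^sub>+\<^sub>1 - u\<^sub>k|\<^sup>2 + 2\<^sup>-\<^sup>k\<close>, so the subsequence converges pointwise; Fatou's lemma
  turns this into convergence in the norm.\<close>

instance l2 :: (euclidean_space) complete_space
proof
  fix S :: "nat \<Rightarrow> 'a l2" assume S: "Cauchy S"
  obtain r where r: "strict_mono r"
    and fast: "\<And>i j k. k \<le> i \<Longrightarrow> k \<le> j \<Longrightarrow> dist (S (r i)) (S (r j)) < (1/2)^k"
    using fast_subsequence[OF S] by blast
  have "\<forall>k. \<exists>u. square_integrable u \<and> S (r k) = abs_l2 u" by (metis l2_exhaust)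
  then obtain u where u: "\<And>k. square_integrable (u k)" and Su: "\<And>k. S (r k) = abs_l2 (u k)" by metis
  have [measurable]: "u k \<in> borel_measurable lebesgue" for k using u by auto
  define d where "d k x = u (Suc k) x - u k x" for k x
  have [measurable]: "d k \<in> borel_measurable lebesgue" for k unfolding d_def by measurable
  have "(\<integral>\<^sup>+x. (\<Sum>k. ennreal (2^k * (d k x)\<^sup>2)) \<partial>lebesgue) = (\<Sum>k. \<integral>\<^sup>+x. ennreal (2^k * (d k x)\<^sup>2) \<partial>lebesgue)"
    by (rule nn_integral_suminf) measurable
  also have "\<dots> \<le> (\<Sum>k. ennreal ((1/2)^k))"
  proof (rule suminf_le)
    fix k
    have "(\<integral>\<^sup>+x. ennreal (2^k * (d k x)\<^sup>2) \<partial>lebesgue)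
        = ennreal (2^k) * (\<integral>\<^sup>+x. ennreal ((d k x)\<^sup>2) \<partial>lebesgue)"
      by (subst nn_integral_cmult[symmetric]) (auto simp: ennreal_mult)
    also have "\<dots> = ennreal (2^k * (dist (S (r (Suc k))) (S (r k)))\<^sup>2)"
      unfolding d_def nn_integral_dist_l2[OF u u] Su by (simp add: ennreal_mult)
    also have "\<dots> \<le> ennreal (2^k * ((1/2)^k)\<^sup>2)"
      using fast[of k "Suc k" k] by (intro ennreal_leI mult_left_mono power_mono) auto
    also have "2^k * ((1/2)^k)\<^sup>2 = ((1/2)^k :: real)" by (simp add: power2_eq_square power_divide)
    finally show "(\<integral>\<^sup>+x. ennreal (2^k * (d k x)\<^sup>2) \<partial>lebesgue) \<le> ennreal ((1/2)^k)" .
  qed auto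
  also have "\<dots> < \<infinity>" by (subst suminf_ennreal_eq[OF _ power_half_series[THEN sums_mult, of 2,
      simplified]]) auto
  finally have "(\<integral>\<^sup>+x. (\<Sum>k. ennreal (2^k * (d k x)\<^sup>2)) \<partial>lebesgue) \<noteq> \<infinity>" by simp
  then have "AE x in lebesgue. (\<Sum>k. ennreal (2^k * (d k x)\<^sup>2)) \<noteq> \<infinity>"
    by (intro nn_integral_noteq_infinite) auto
  then have conv: "AE x in lebesgue. convergent (\<lambda>k. u k x)"
  proof (rule AE_mp[OF _ AE_I2], intro impI)
    fix x assume "(\<Sum>k. ennreal (2^k * (d k x)\<^sup>2)) \<noteq> \<infinity>"
    then have sm: "summable (\<lambda>k. 2^k * (d k x)\<^sup>2)" by (intro summable_suminf_not_top) auto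
    have "summable (\<lambda>k. d k x)"
    proof (rule summable_comparison_test'[where N = 0])
      show "summable (\<lambda>k. 2^k * (d k x)\<^sup>2 + (1/2)^k)" using sm by (intro summable_add) auto
      fix k
      have "2 * \<bar>d k x\<bar> = 2 * (sqrt (2^k) * \<bar>d k x\<bar>) * (sqrt ((1/2)^k))"
        by (simp add: real_sqrt_divide power_divide)
      also have "\<dots> \<le> (sqrt (2^k) * \<bar>d k x\<bar>)\<^sup>2 + (sqrt ((1/2)^k))\<^sup>2" by (rule sum_squares_bound)
      also have "\<dots> = 2^k * (d k x)\<^sup>2 + (1/2)^k" by (simp add: power_mult_distrib)
      finally show "norm (d k x) \<le> 2^k * (d k x)\<^sup>2 + (1/2)^k" by simp
    qed
    then have "convergent (\<lambda>n. \<Sum>k<n. u (Suc k) x - u k x)" unfolding d_def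
        by (simp add: summable_iff_convergent)
    then have "convergent (\<lambda>n. u n x - u 0 x)" by (simp add: sum_lessThan_telescope[of "\<lambda>k. u k x"])
    then show "convergent (\<lambda>n. u n x)" using convergent_diff_const_right_iff by blast
  qed
  define v where "v x = lim (\<lambda>k. u k x)" for x
  have [measurable]: "v \<in> borel_measurable lebesgue" unfolding v_def by measurable
  have lim: "AE x in lebesgue. (\<lambda>k. u k x) \<longlonglongrightarrow> v x"
    using conv by (auto simp: v_def convergent_LIMSEQ_iff)
  have fatou: "(\<integral>\<^sup>+x. ennreal ((v x - u k x)\<^sup>2) \<partial>lebesgue) \<le> ennreal (((1/2)^k)\<^sup>2)" for k
  proof -
    have "(\<integral>\<^sup>+x. ennreal ((v x - u k x)\<^sup>2) \<partial>lebesgue)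
        = (\<integral>\<^sup>+x. liminf (\<lambda>j. ennreal ((u j x - u k x)\<^sup>2)) \<partial>lebesgue)"
    proof (rule nn_integral_cong_AE, rule AE_mp[OF lim AE_I2], intro impI)
      fix x assume "(\<lambda>k. u k x) \<longlonglongrightarrow> v x"
      then have "(\<lambda>j. ennreal ((u j x - u k x)\<^sup>2)) \<longlonglongrightarrow> ennreal ((v x - u k x)\<^sup>2)" by (intro tendsto_intros)
      then show "ennreal ((v x - u k x)\<^sup>2) = liminf (\<lambda>j. ennreal ((u j x - u k x)\<^sup>2))"
        by (rule lim_imp_Liminf[OF sequentially_bot, symmetric])
    qed
    also have "\<dots> \<le> liminf (\<lambda>j. \<integral>\<^sup>+x. ennreal ((u j x - u k x)\<^sup>2) \<partial>lebesgue)"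
      by (rule nn_integral_liminf) measurable
    also have "\<dots> \<le> liminf (\<lambda>j. ennreal (((1/2)^k)\<^sup>2))"
    proof (rule Liminf_mono, rule eventually_sequentiallyI)
      fix j assume "k \<le> j"
      then show "(\<integral>\<^sup>+x. ennreal ((u j x - u k x)\<^sup>2) \<partial>lebesgue) \<le> ennreal (((1/2)^k)\<^sup>2)"
        using fast[of k j k] unfolding nn_integral_dist_l2[OF u u] Su
        by (intro ennreal_leI power_mono) auto
    qed
    finally show ?thesis by (simp add: Liminf_const)
  qed
  have vu: "square_integrable (\<lambda>x. v x - u k x)" for k
    unfolding square_integrable_def using fatou[of k]
    by (auto simp: integrable_iff_bounded top.not_eq_extremum intro: le_less_trans)
  have v: "square_integrable v" using square_integrable_add[OF vu[of 0] u[of 0]] by simp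
  have "(\<lambda>k. S (r k)) \<longlonglongrightarrow> abs_l2 v"
  proof (rule metric_LIMSEQ_I)
    fix e :: real assume "e > 0"
    then obtain n where n: "(1/2)^n < e" using real_arch_pow_inv[of e "1/2"] by auto
    have "dist (S (r k)) (abs_l2 v) < e" if "k \<ge> n" for k
    proof -
      have "ennreal ((dist (abs_l2 v) (abs_l2 (u k)))\<^sup>2) \<le> ennreal (((1/2)^k)\<^sup>2)"
        using fatou[of k] nn_integral_dist_l2[OF v u, of k] by simp
      then have "dist (abs_l2 v) (abs_l2 (u k)) \<le> (1/2)^k"
        by (subst (asm) ennreal_le_iff) (auto intro: power2_le_imp_le)
      also have "\<dots> \<le> (1/2)^n" using that by (intro power_decreasing) auto
      finally show ?thesis using n by (simp add: Su dist_commute)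
    qed
    then show "\<exists>n. \<forall>k\<ge>n. dist (S (r k)) (abs_l2 v) < e" by blast
  qed
  then have "S \<longlonglongrightarrow> abs_l2 v" using Cauchy_converges_subseq[OF S r] by (simp add: o_def)
  then show "convergent S" by (auto simp: convergent_def)
qed

section \<open>Smooth functions and test functions\<close>

lemma pderiv_cl_eq: "(f has_derivative f') (at x) \<Longrightarrow> pderiv_cl i f x = f' (axis i 1)"
  unfolding pderiv_cl_def by (metis frechet_derivative_at)

lemma has_frechet_derivative:
  "f differentiable at x \<Longrightarrow> (f has_derivative frechet_derivative f (at x)) (at x)"
  by (simp add: frechet_derivative_works)

lemma pderiv_cl_const: "pderiv_cl i (\<lambda>x. c) = (\<lambda>x. 0)"
  by (rule ext, subst pderiv_cl_eq[OF has_derivative_const]) simp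

lemma pderiv_cl_add:
  assumes "\<And>x. f differentiable at x" "\<And>x. g differentiable at x"
  shows "pderiv_cl i (\<lambda>x. f x + g x) = (\<lambda>x. pderiv_cl i f x + pderiv_cl i g x)"
proof
  fix x
  show "pderiv_cl i (\<lambda>x. f x + g x) x = pderiv_cl i f x + pderiv_cl i g x"
    using pderiv_cl_eq[OF has_derivative_add[OF assms[of x, THEN has_frechet_derivative]]]
    by (simp add: pderiv_cl_def)
qed

lemma pderiv_cl_mult:
  assumes "\<And>x. f differentiable at x" "\<And>x. g differentiable at x"
  shows "pderiv_cl i (\<lambda>x. f x * g x) = (\<lambda>x. f x * pderiv_cl i g x + pderiv_cl i f x * g x)"
proof
  fix x
  show "pderiv_cl i (\<lambda>x. f x * g x) x = f x * pderiv_cl i g x + pderiv_cl i f x * g x"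
    using pderiv_cl_eq[OF has_derivative_mult[OF assms[of x, THEN has_frechet_derivative]]]
    by (simp add: pderiv_cl_def)
qed

lemma differentiable_nth: "(\<lambda>x. x $ j) differentiable at x"
  by (rule bounded_linear_imp_differentiable) (rule bounded_linear_vec_nth)

lemma pderiv_cl_nth: "pderiv_cl i (\<lambda>x. x $ j) = (\<lambda>x. if i = j then 1 else 0)"
  by (rule ext, subst pderiv_cl_eq[OF bounded_linear_imp_has_derivative[OF bounded_linear_vec_nth]])
    (auto simp: axis_def)

lemma pderiv_cl_compose:
  assumes f: "\<And>x. f differentiable at x" and h: "\<And>t. (h has_real_derivative h' t) (at t)"
  shows "pderiv_cl i (\<lambda>x. h (f x)) = (\<lambda>x. h' (f x) * pderiv_cl i f x)"
    and "(\<lambda>x. h (f x)) differentiable at x"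
proof -
  have *: "((\<lambda>x. h (f x)) has_derivative (\<lambda>v. h' (f x) * frechet_derivative f (at x) v)) (at x)" for x
    using has_derivative_compose[OF has_frechet_derivative[OF f]
        has_field_derivative_imp_has_derivative[OF h]]
    by simp
  show "pderiv_cl i (\<lambda>x. h (f x)) = (\<lambda>x. h' (f x) * pderiv_cl i f x)"
    by (rule ext, subst pderiv_cl_eq[OF *]) (simp add: pderiv_cl_def)
  show "(\<lambda>x. h (f x)) differentiable at x" using * by (auto simp: differentiable_def)
qed

definition smooth :: "(real ^ 'd \<Rightarrow> real) \<Rightarrow> bool" where
  "smooth f \<longleftrightarrow> (\<forall>k. C_k k f)"

lemma smooth_differentiable: "smooth f \<Longrightarrow> f differentiable at x"
  unfolding smooth_def by (metis C_k.simps(2))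

lemma smooth_pderiv: "smooth f \<Longrightarrow> smooth (pderiv_cl i f)"
  unfolding smooth_def by (metis C_k.simps(2))

lemma differentiable_imp_continuous_UNIV:
  "(\<And>x. f differentiable at x) \<Longrightarrow> continuous_on UNIV f"
  by (simp add: continuous_at_imp_continuous_on differentiable_imp_continuous_within)

lemma smooth_continuous: "smooth f \<Longrightarrow> continuous_on UNIV f"
  by (metis C_k.simps(1) smooth_def)

text \<open>Smoothness of explicit functions is proved by exhibiting a class of differentiable functions that
  contains them and is closed under partial derivatives.\<close>

lemma smooth_coinduct:
  assumes "P f" and "\<And>f x. P f \<Longrightarrow> f differentiable at x" and "\<And>f i. P f \<Longrightarrow> P (pderiv_cl i f)"
  shows "smooth f"
proof -
  have "C_k k f" if "P f" for k f using that
  proof (induction k arbitrary: f)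
    case 0
    then show ?case using differentiable_imp_continuous_UNIV[OF assms(2)] by simp
  next
    case (Suc k)
    then show ?case using assms(2,3) by auto
  qed
  with assms(1) show ?thesis by (simp add: smooth_def)
qed

text \<open>The function \<open>exp (-1/t)\<close> on the positive axis, with a factor \<open>t\<^sup>-\<^sup>m\<close> so that the derivatives stay
  in the family.\<close>

definition cutoff :: "nat \<Rightarrow> real \<Rightarrow> real" where
  "cutoff m t = (if t > 0 then (1 / t) ^ m * exp (- (1 / t)) else 0)"

lemma cutoff_tendsto_0: "(cutoff m \<longlongrightarrow> 0) (at 0)"
proof (rule filterlim_split_at)
  have "((\<lambda>t::real. (inverse t) ^ m / exp (inverse t)) \<longlongrightarrow> 0) (at_right 0)"
    by (rule filterlim_compose[OF tendsto_power_div_exp_0 filterlim_inverse_at_top_right])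
  then show "(cutoff m \<longlongrightarrow> 0) (at_right 0)"
    by (rule Lim_transform_eventually)
      (auto simp: cutoff_def eventually_at_filter inverse_eq_divide exp_minus)
  show "(cutoff m \<longlongrightarrow> 0) (at_left 0)"
    by (rule Lim_transform_eventually[OF tendsto_const])
      (auto simp: cutoff_def eventually_at_filter)
qed

lemma cutoff_has_derivative:
  "(cutoff m has_real_derivative (cutoff (m + 2) t - real m * cutoff (m + 1) t)) (at t)"
proof -
  consider "t > 0" | "t < 0" | "t = 0" by linarith
  then show ?thesis
  proof cases
    case 1
    define s where "s = 1 / t"
    have s: "((\<lambda>t. 1 / t) has_real_derivative - (s * s)) (at t)"
      using 1 by (auto intro!: derivative_eq_intros simp: s_def)
    have "((\<lambda>t. (1 / t) ^ m * exp (- (1 / t))) has_real_derivative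
        real m * (- (s * s) * s ^ (m - Suc 0)) * exp (- s) + (exp (- s) * - (- (s * s))) * s ^ m) (at t)"
      using DERIV_mult[OF DERIV_power[OF s, where n = m] DERIV_fun_exp[OF DERIV_minus[OF s]]]
      by (simp add: s_def)
    also have "real m * (- (s * s) * s ^ (m - Suc 0)) * exp (- s) + (exp (- s) * - (- (s * s))) * s ^ m
        = cutoff (m + 2) t - real m * cutoff (m + 1) t"
      using 1 by (cases m) (auto simp: cutoff_def s_def[symmetric] algebra_simps)
    finally have "((\<lambda>t. (1 / t) ^ m * exp (- (1 / t))) has_real_derivative
        (cutoff (m + 2) t - real m * cutoff (m + 1) t)) (at t)" .
    then show ?thesis
      by (rule has_field_derivative_transform_within_open[OF _ open_greaterThan[of 0]])
        (use 1 in \<open>auto simp: cutoff_def\<close>)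
  next
    case 2
    have "((\<lambda>t. 0) has_real_derivative (cutoff (m + 2) t - real m * cutoff (m + 1) t)) (at t)"
      using 2 by (simp add: cutoff_def)
    then show ?thesis
      by (rule has_field_derivative_transform_within_open[OF _ open_lessThan[of 0]])
        (use 2 in \<open>auto simp: cutoff_def\<close>)
  next
    case 3
    have "((\<lambda>h. (cutoff m (0 + h) - cutoff m 0) / h) \<longlongrightarrow> 0) (at 0)"
      by (rule Lim_transform_eventually[OF cutoff_tendsto_0[of "Suc m"]])
        (auto simp: cutoff_def eventually_at_filter)
    then have "(cutoff m has_real_derivative 0) (at 0)" by (simp add: DERIV_def)
    then show ?thesis using 3 by (simp add: cutoff_def)
  qed
qed

text \<open>A class for \<open>smooth_coinduct\<close>: it contains the smooth functions themselves, so it also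
  yields the closure of smoothness under sums and products.\<close>

inductive smooth_alg :: "(real ^ 'd \<Rightarrow> real) \<Rightarrow> bool" where
  base: "smooth f \<Longrightarrow> smooth_alg f"
| const: "smooth_alg (\<lambda>x. c)"
| cutoff: "smooth_alg (\<lambda>x. cutoff m (r * x $ i + t))"
| add: "smooth_alg f \<Longrightarrow> smooth_alg g \<Longrightarrow> smooth_alg (\<lambda>x. f x + g x)"
| mult: "smooth_alg f \<Longrightarrow> smooth_alg g \<Longrightarrow> smooth_alg (\<lambda>x. f x * g x)"

lemma differentiable_affine_nth: "(\<lambda>x. r * x $ i + t :: real) differentiable at x"
  by (intro differentiable_add differentiable_mult differentiable_const differentiable_nth)

lemma smooth_alg_differentiable: "smooth_alg f \<Longrightarrow> f differentiable at x"
  by (induction rule: smooth_alg.induct)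
    (auto intro: smooth_differentiable differentiable_add differentiable_mult
      pderiv_cl_compose(2)[OF differentiable_affine_nth cutoff_has_derivative])

lemma smooth_alg_pderiv: "smooth_alg f \<Longrightarrow> smooth_alg (pderiv_cl i f)"
proof (induction rule: smooth_alg.induct)
  case (base f)
  then show ?case by (intro smooth_alg.base smooth_pderiv)
next
  case (const c)
  show ?case unfolding pderiv_cl_const by (rule smooth_alg.const)
next
  case (cutoff m r j t)
  have aff: "pderiv_cl i (\<lambda>x. r * x $ j + t) = (\<lambda>x. if i = j then r else 0)"
  proof
    fix x
    have "((\<lambda>x. r * x $ j + t) has_derivative (\<lambda>v. r * v $ j)) (at x)"
      by (auto intro!: derivative_eq_intros bounded_linear.has_derivative[OF bounded_linear_vec_nth])
    then show "pderiv_cl i (\<lambda>x. r * x $ j + t) x = (if i = j then r else 0)"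
      by (simp add: pderiv_cl_eq axis_def)
  qed
  have "smooth_alg (\<lambda>x. (cutoff (m + 2) (r * x $ j + t) + (- real m) * cutoff (m + 1) (r * x $ j + t))
      * (if i = j then r else 0))"
    by (intro smooth_alg.intros)
  then show ?case
    unfolding pderiv_cl_compose(1)[OF differentiable_affine_nth cutoff_has_derivative] aff by simp
next
  case (add f g)
  then show ?case
    by (subst pderiv_cl_add) (auto intro: smooth_alg_differentiable smooth_alg.add)
next
  case (mult f g)
  then show ?case
    by (subst pderiv_cl_mult) (auto intro: smooth_alg_differentiable smooth_alg.add smooth_alg.mult)
qed

lemma smooth_alg_imp_smooth: "smooth_alg f \<Longrightarrow> smooth f"
  by (rule smooth_coinduct[of smooth_alg]) (auto intro: smooth_alg_differentiable smooth_alg_pderiv)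

lemma smooth_add: "smooth f \<Longrightarrow> smooth g \<Longrightarrow> smooth (\<lambda>x. f x + g x)"
  by (rule smooth_alg_imp_smooth) (intro smooth_alg.add smooth_alg.base)

lemma smooth_scale: "smooth f \<Longrightarrow> smooth (\<lambda>x. c * f x)"
  by (rule smooth_alg_imp_smooth) (intro smooth_alg.mult smooth_alg.const smooth_alg.base)

text \<open>Vanishing outside some compact subset is easier to establish than a statement about the closure of
  the support.\<close>

lemma test_functions_iff:
  "\<psi> \<in> test_functions \<Omega> \<longleftrightarrow> smooth \<psi> \<and> (\<exists>S. compact S \<and> S \<subseteq> \<Omega> \<and> (\<forall>x. x \<notin> S \<longrightarrow> \<psi> x = 0))"
proof
  assume \<psi>: "\<psi> \<in> test_functions \<Omega>"
  show "smooth \<psi> \<and> (\<exists>S. compact S \<and> S \<subseteq> \<Omega> \<and> (\<forall>x. x \<notin> S \<longrightarrow> \<psi> x = 0))"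
  proof (intro conjI exI)
    show "\<forall>x. x \<notin> closure {x. \<psi> x \<noteq> 0} \<longrightarrow> \<psi> x = 0"
      using closure_subset[of "{x. \<psi> x \<noteq> 0}"] by blast
  qed (use \<psi> in \<open>simp_all add: test_functions_def smooth_def\<close>)
next
  assume "smooth \<psi> \<and> (\<exists>S. compact S \<and> S \<subseteq> \<Omega> \<and> (\<forall>x. x \<notin> S \<longrightarrow> \<psi> x = 0))"
  then obtain S where S: "smooth \<psi>" "compact S" "S \<subseteq> \<Omega>" "\<And>x. x \<notin> S \<Longrightarrow> \<psi> x = 0" by blast
  have "closure {x. \<psi> x \<noteq> 0} \<subseteq> S"
    using S by (intro closure_minimal compact_imp_closed) auto
  moreover have "compact (closure {x. \<psi> x \<noteq> 0})"
    using calculation S(2) closed_Int_compact[of "closure {x. \<psi> x \<noteq> 0}" S] by (simp add: Int_absorb2)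
  ultimately show "\<psi> \<in> test_functions \<Omega>" using S(1,3)
    unfolding test_functions_def smooth_def by simp
qed

lemma test_smooth: "\<psi> \<in> test_functions \<Omega> \<Longrightarrow> smooth \<psi>"
  by (simp add: test_functions_iff)

lemma test_zero_outside: "\<psi> \<in> test_functions \<Omega> \<Longrightarrow> x \<notin> \<Omega> \<Longrightarrow> \<psi> x = 0"
  by (auto simp: test_functions_iff)

lemma test_differentiable: "\<psi> \<in> test_functions \<Omega> \<Longrightarrow> \<psi> differentiable at x"
  by (simp add: smooth_differentiable test_smooth)

lemma test_zero: "(\<lambda>x. 0) \<in> test_functions \<Omega>"
  unfolding test_functions_iff by (auto intro!: smooth_alg_imp_smooth smooth_alg.const exI[of _ "{}"])

lemma test_add:
  assumes "\<psi> \<in> test_functions \<Omega>" "\<eta> \<in> test_functions \<Omega>"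
  shows "(\<lambda>x. \<psi> x + \<eta> x) \<in> test_functions \<Omega>"
proof -
  obtain S where S: "smooth \<psi>" "compact S" "S \<subseteq> \<Omega>" "\<And>x. x \<notin> S \<Longrightarrow> \<psi> x = 0"
    using assms(1) unfolding test_functions_iff by blast
  obtain T where T: "smooth \<eta>" "compact T" "T \<subseteq> \<Omega>" "\<And>x. x \<notin> T \<Longrightarrow> \<eta> x = 0"
    using assms(2) unfolding test_functions_iff by blast
  have "\<psi> x + \<eta> x = 0" if "x \<notin> S \<union> T" for x using that S(4) T(4) by simp
  then show ?thesis unfolding test_functions_iff using S T
    by (intro conjI smooth_add exI[of _ "S \<union> T"]) auto
qed

lemma test_scale: "\<psi> \<in> test_functions \<Omega> \<Longrightarrow> (\<lambda>x. c * \<psi> x) \<in> test_functions \<Omega>"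
  unfolding test_functions_iff by (auto intro: smooth_scale)

lemma test_pderiv:
  assumes "\<psi> \<in> test_functions \<Omega>"
  shows "pderiv_cl i \<psi> \<in> test_functions \<Omega>"
proof -
  obtain S where S: "smooth \<psi>" "compact S" "S \<subseteq> \<Omega>" "\<And>x. x \<notin> S \<Longrightarrow> \<psi> x = 0"
    using assms unfolding test_functions_iff by blast
  have "pderiv_cl i \<psi> x = 0" if "x \<notin> S" for x
  proof -
    have "(\<psi> has_derivative (\<lambda>_. 0)) (at x)"
      by (rule has_derivative_transform_within_open[OF has_derivative_const[of 0], of "- S"])
        (use S that in \<open>auto simp: compact_imp_closed open_Compl\<close>)
    then show ?thesis by (simp add: pderiv_cl_eq)
  qed
  then show ?thesis unfolding test_functions_iff using S smooth_pderiv by blast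
qed

lemma test_bounded_support:
  assumes "\<psi> \<in> test_functions \<Omega>"
  obtains R where "R > 0" "\<And>x. norm x > R \<Longrightarrow> \<psi> x = 0"
proof -
  obtain S where S: "compact S" "\<And>x. x \<notin> S \<Longrightarrow> \<psi> x = 0"
    using assms unfolding test_functions_iff by blast
  obtain R where "R > 0" "\<And>x. x \<in> S \<Longrightarrow> norm x \<le> R"
    using compact_imp_bounded[OF S(1)] bounded_pos by blast
  then show ?thesis using that S by force
qed

section \<open>Integration by parts for test functions\<close>

lemma integral_translation_UNIV:
  fixes f :: "'a::euclidean_space \<Rightarrow> real"
  assumes f: "f \<in> borel_measurable borel"
  shows "(\<integral>x. f (x + a) \<partial>lborel) = (\<integral>x. f x \<partial>lborel)"
proof -
  have "(\<integral>x. f x \<partial>lborel) = (\<integral>x. f x \<partial>distr lborel borel ((+) a))" by (simp add: lborel_distr_plus)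
  also have "\<dots> = (\<integral>x. f (a + x) \<partial>lborel)" using f by (subst integral_distr) auto
  finally show ?thesis by (simp add: add.commute)
qed

lemma integrable_continuous_bounded_support:
  fixes f :: "'a::euclidean_space \<Rightarrow> real"
  assumes "continuous_on UNIV f" "\<And>x. norm x > R \<Longrightarrow> f x = 0"
  shows "integrable lborel f"
proof -
  have "integrable lborel (\<lambda>x. indicator (cball 0 R) x *\<^sub>R f x)"
    using assms(1) by (intro borel_integrable_compact) (auto intro: continuous_on_subset)
  also have "(\<lambda>x. indicator (cball 0 R) x *\<^sub>R f x) = f"
    using assms(2) by (auto simp: indicator_def fun_eq_iff not_le)
  finally show ?thesis .
qed

definition diff_quot :: "'d \<Rightarrow> real \<Rightarrow> (real ^ 'd \<Rightarrow> real) \<Rightarrow> real ^ 'd \<Rightarrow> real" where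
  "diff_quot j h f x = (f (x + h *\<^sub>R axis j 1) - f x) / h"

lemma line_derivative:
  assumes "\<And>x. f differentiable at x"
  shows "((\<lambda>t. f (x + t *\<^sub>R axis j 1)) has_real_derivative pderiv_cl j f (x + t *\<^sub>R axis j 1)) (at t)"
proof -
  have "((\<lambda>t. f (x + t *\<^sub>R axis j 1)) has_derivative
      (\<lambda>s. frechet_derivative f (at (x + t *\<^sub>R axis j 1)) (s *\<^sub>R axis j 1))) (at t)"
    by (rule has_derivative_compose[OF _ has_frechet_derivative[OF assms]])
      (auto intro!: derivative_eq_intros)
  moreover have "linear (frechet_derivative f (at (x + t *\<^sub>R axis j 1)))"
    using has_frechet_derivative[OF assms] has_derivative_linear by blast
  ultimately show ?thesis
    by (simp add: has_field_derivative_def pderiv_cl_def linear_cmul mult_commute_abs)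
qed

text \<open>Dominated convergence: by the mean value theorem the difference quotients are bounded by the maximum
  of the partial derivative, and they vanish outside a fixed ball. With \<open>\<phi> = 1\<close> this shows that
  the integral of a partial derivative vanishes; with general \<open>\<phi>\<close> it yields the exchange of
  derivatives in \<open>integral_pderiv_swap\<close>.\<close>

lemma integral_diff_quot_tendsto:
  assumes f: "\<And>x. f differentiable at x" "continuous_on UNIV (pderiv_cl j f)"
    and R: "\<And>x. norm x > R \<Longrightarrow> f x = 0" "\<And>x. norm x > R \<Longrightarrow> pderiv_cl j f x = 0"
    and \<phi>: "continuous_on UNIV \<phi>"
  shows "(\<lambda>n. \<integral>x. \<phi> x * diff_quot j (1 / real (Suc n)) f x \<partial>lborel) \<longlonglongrightarrow> (\<integral>x. \<phi> x * pderiv_cl j f x \<partial>lborel)"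
proof -
  have fc: "continuous_on UNIV f" by (rule differentiable_imp_continuous_UNIV) (rule f)
  have "bounded (pderiv_cl j f ` cball 0 R)"
    using f(2) by (intro compact_imp_bounded compact_continuous_image) (auto intro: continuous_on_subset)
  then obtain B where "B > 0" and B: "\<And>x. norm x \<le> R \<Longrightarrow> \<bar>pderiv_cl j f x\<bar> \<le> B"
    unfolding bounded_pos by (auto simp: dist_norm)
  then have B: "\<bar>pderiv_cl j f x\<bar> \<le> B" for x using R(2)[of x] by (cases "norm x \<le> R") auto
  have dq: "\<bar>diff_quot j h f x\<bar> \<le> B * indicator (cball 0 (R + 1)) x" if h: "0 < h" "h \<le> 1" for h x
  proof (cases "norm x \<le> R + 1")
    case True
    obtain z where "f (x + h *\<^sub>R axis j 1) - f (x + 0 *\<^sub>R axis j 1)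
        = (h - 0) * pderiv_cl j f (x + z *\<^sub>R axis j 1)"
      using MVT2[OF h(1), of "\<lambda>t. f (x + t *\<^sub>R axis j 1)" "\<lambda>t. pderiv_cl j f (x + t *\<^sub>R axis j 1)"]
        line_derivative[OF f(1)] by blast
    then show ?thesis using B[of "x + z *\<^sub>R axis j 1"] h True by (simp add: diff_quot_def)
  next
    case False
    have "norm x \<le> norm (x + h *\<^sub>R axis j 1) + norm (h *\<^sub>R (axis j 1 :: real ^ 'a))"
      by (metis add_diff_cancel_right' norm_triangle_ineq4)
    then have "R < norm (x + h *\<^sub>R axis j 1)" using False h by (simp add: norm_axis_1)
    then show ?thesis using False R(1) by (simp add: diff_quot_def)
  qed
  show ?thesis
  proof (rule integral_dominated_convergence)
    show "(\<lambda>x. \<phi> x * pderiv_cl j f x) \<in> borel_measurable lborel"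
      using \<phi> f(2) by (intro borel_measurable_times) (auto intro: borel_measurable_continuous_onI)
    have "continuous_on UNIV (diff_quot j (1 / real (Suc n)) f)" for n
      unfolding diff_quot_def
      by (intro continuous_intros continuous_on_compose2[OF fc]) auto
    then show "(\<lambda>x. \<phi> x * diff_quot j (1 / real (Suc n)) f x) \<in> borel_measurable lborel" for n
      using \<phi> by (intro borel_measurable_times) (auto intro: borel_measurable_continuous_onI)
    have "integrable lborel (\<lambda>x. indicator (cball 0 (R + 1)) x *\<^sub>R (\<bar>\<phi> x\<bar> * B))"
      using \<phi> by (intro borel_integrable_compact continuous_intros) (auto intro: continuous_on_subset)
    then show "integrable lborel (\<lambda>x. \<bar>\<phi> x\<bar> * (B * indicator (cball 0 (R + 1)) x))"
      by (simp add: mult_ac)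
    show "AE x in lborel. norm (\<phi> x * diff_quot j (1 / real (Suc n)) f x)
        \<le> \<bar>\<phi> x\<bar> * (B * indicator (cball 0 (R + 1)) x)" for n
      by (rule AE_I2) (auto simp: abs_mult intro!: mult_left_mono dq)
    show "AE x in lborel. (\<lambda>n. \<phi> x * diff_quot j (1 / real (Suc n)) f x) \<longlonglongrightarrow> \<phi> x * pderiv_cl j f x"
    proof (intro AE_I2 tendsto_intros)
      fix x
      have "((\<lambda>h. diff_quot j h f x) \<longlongrightarrow> pderiv_cl j f x) (at 0)"
        using line_derivative[OF f(1), of x j 0] by (simp add: DERIV_def diff_quot_def)
      moreover have "filterlim (\<lambda>n. 1 / real (Suc n)) (at 0) sequentially"
        unfolding filterlim_at using LIMSEQ_Suc[OF lim_1_over_n] by auto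
      ultimately show "(\<lambda>n. diff_quot j (1 / real (Suc n)) f x) \<longlonglongrightarrow> pderiv_cl j f x"
        by (rule filterlim_compose)
    qed
  qed
qed

text \<open>The integral of each difference quotient is zero by translation invariance.\<close>

lemma integral_pderiv_eq_0:
  assumes f: "\<And>x. f differentiable at x" "continuous_on UNIV (pderiv_cl j f)"
    and R: "\<And>x. norm x > R \<Longrightarrow> f x = 0" "\<And>x. norm x > R \<Longrightarrow> pderiv_cl j f x = 0"
  shows "(\<integral>x. pderiv_cl j f x \<partial>lborel) = 0"
proof -
  have fc: "continuous_on UNIV f" by (rule differentiable_imp_continuous_UNIV) (rule f)
  have int: "integrable lborel f" by (rule integrable_continuous_bounded_support[OF fc R(1)])
  have "(\<integral>x. 1 * diff_quot j h f x \<partial>lborel) = 0" for h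
  proof -
    have "continuous_on UNIV (\<lambda>x. f (x + h *\<^sub>R axis j 1))"
      by (intro continuous_on_compose2[OF fc] continuous_intros) auto
    moreover have "f (x + h *\<^sub>R axis j 1) = 0" if "norm x > R + \<bar>h\<bar>" for x
    proof (rule R)
      have "norm x \<le> norm (x + h *\<^sub>R axis j 1) + norm (h *\<^sub>R (axis j 1 :: real ^ 'a))"
        by (metis add_diff_cancel_right' norm_triangle_ineq4)
      then show "norm (x + h *\<^sub>R axis j 1) > R" using that by (simp add: norm_axis_1)
    qed
    ultimately have "integrable lborel (\<lambda>x. f (x + h *\<^sub>R axis j 1))"
      by (rule integrable_continuous_bounded_support)
    then show ?thesis
      using int integral_translation_UNIV[OF borel_measurable_continuous_onI[OF fc], of "h *\<^sub>R axis j 1"]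
      by (simp add: diff_quot_def)
  qed
  then have "(\<lambda>n. 0) \<longlonglongrightarrow> (\<integral>x. 1 * pderiv_cl j f x \<partial>lborel)"
    using integral_diff_quot_tendsto[OF f R, where \<phi> = "\<lambda>_. 1"] by simp
  then show ?thesis by (simp add: LIMSEQ_const_iff)
qed

lemma integration_by_parts:
  assumes \<psi>: "\<psi> \<in> test_functions \<Omega>" and f: "\<And>x. f differentiable at x" "continuous_on UNIV (pderiv_cl i f)"
  shows "(\<integral>x. pderiv_cl i \<psi> x * f x \<partial>lborel) = - (\<integral>x. \<psi> x * pderiv_cl i f x \<partial>lborel)"
proof -
  note \<psi>' = test_pderiv[OF \<psi>, of i]
  obtain R where R: "\<And>x. norm x > R \<Longrightarrow> \<psi> x = 0" using test_bounded_support[OF \<psi>] by metis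
  obtain S where S: "\<And>x. norm x > S \<Longrightarrow> pderiv_cl i \<psi> x = 0" using test_bounded_support[OF \<psi>'] by metis
  have c: "continuous_on UNIV \<psi>" "continuous_on UNIV (pderiv_cl i \<psi>)" "continuous_on UNIV f"
    using \<psi> \<psi>' f(1) by (auto intro: smooth_continuous test_smooth differentiable_imp_continuous_UNIV)
  have m: "pderiv_cl i (\<lambda>x. \<psi> x * f x) = (\<lambda>x. \<psi> x * pderiv_cl i f x + pderiv_cl i \<psi> x * f x)"
    by (rule pderiv_cl_mult) (auto intro: f test_differentiable[OF \<psi>])
  have "(\<integral>x. pderiv_cl i (\<lambda>x. \<psi> x * f x) x \<partial>lborel) = 0"
  proof (rule integral_pderiv_eq_0[where R = "max R S"])
    show "(\<lambda>x. \<psi> x * f x) differentiable at x" for x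
      by (intro differentiable_mult f test_differentiable[OF \<psi>])
    show "continuous_on UNIV (pderiv_cl i (\<lambda>x. \<psi> x * f x))"
      unfolding m by (intro continuous_intros c f)
  qed (auto simp: m R S)
  moreover have "integrable lborel (\<lambda>x. \<psi> x * pderiv_cl i f x)"
      "integrable lborel (\<lambda>x. pderiv_cl i \<psi> x * f x)"
    by (rule integrable_continuous_bounded_support[where R
        = "max R S"]; auto intro!: continuous_intros c f simp: R S)+
  ultimately show ?thesis by (simp add: m)
qed

lemma continuous_pderiv_test: "\<psi> \<in> test_functions \<Omega> \<Longrightarrow> continuous_on UNIV (pderiv_cl i \<psi>)"
  by (intro smooth_continuous test_smooth test_pderiv)

text \<open>Move \<open>\<partial>\<^sub>i\<close> to \<open>\<eta>\<close>, exchange it with \<open>\<partial>\<^sub>j\<close>, and move \<open>\<partial>\<^sub>j\<close> back to \<open>\<psi>\<close>. For the exchange, \<open>\<partial>\<^sub>j\<close>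
  is approximated by difference quotients, which commute with \<open>\<partial>\<^sub>i\<close>.\<close>

lemma integral_pderiv_swap:
  assumes \<psi>: "\<psi> \<in> test_functions \<Omega>" and \<eta>: "\<eta> \<in> test_functions \<Omega>"
  shows "(\<integral>x. pderiv_cl i \<psi> x * pderiv_cl j \<eta> x \<partial>lborel) = (\<integral>x. pderiv_cl j \<psi> x * pderiv_cl i \<eta> x \<partial>lborel)"
proof -
  define D where "D n f = diff_quot j (1 / real (Suc n)) f" for n and f :: "real ^ 'a \<Rightarrow> real"
  have shift: "((\<lambda>x. \<eta> (x + h)) has_derivative frechet_derivative \<eta> (at (x + h))) (at x)" for x h
    by (rule has_derivative_eq_rhs[OF has_derivative_compose[OF _ has_frechet_derivative[OF
        test_differentiable[OF \<eta>]]]])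
      (auto intro!: derivative_eq_intros)
  have "(D n \<eta> has_derivative (\<lambda>v. (frechet_derivative \<eta> (at (x + (1 / real (Suc n)) *\<^sub>R axis j 1)) v
      - frechet_derivative \<eta> (at x) v) / (1 / real (Suc n)))) (at x)" for n x
    unfolding D_def diff_quot_def
    by (rule bounded_linear.has_derivative[OF bounded_linear_divide] has_derivative_diff shift
        has_frechet_derivative[OF test_differentiable[OF \<eta>]])+
  note D' = this
  have Dd: "D n \<eta> differentiable at x" for n x using D' by (auto simp: differentiable_def)
  have Dp: "pderiv_cl i (D n \<eta>) = D n (pderiv_cl i \<eta>)" for n
    by (rule ext, subst pderiv_cl_eq[OF D']) (simp add: D_def diff_quot_def pderiv_cl_def)
  have Dc: "continuous_on UNIV (D n (pderiv_cl i \<eta>))" for n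
    unfolding D_def diff_quot_def
    by (intro continuous_intros continuous_on_compose2[OF continuous_pderiv_test[OF \<eta>]]) auto
  have c: "continuous_on UNIV \<psi>" "continuous_on UNIV (pderiv_cl i \<psi>)"
    using \<psi> by (auto intro: smooth_continuous test_smooth test_pderiv)
  have lim: "(\<lambda>n. \<integral>x. \<phi> x * D n f x \<partial>lborel) \<longlonglongrightarrow> (\<integral>x. \<phi> x * pderiv_cl j f x \<partial>lborel)"
    if \<phi>: "continuous_on UNIV \<phi>" and f: "f \<in> test_functions \<Omega>" for \<phi> f
  proof -
    obtain R where R: "\<And>x. norm x > R \<Longrightarrow> f x = 0" using test_bounded_support[OF f] by metis
    obtain S where S: "\<And>x. norm x > S \<Longrightarrow> pderiv_cl j f x = 0"
      using test_bounded_support[OF test_pderiv[OF f]] by metis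
    show ?thesis unfolding D_def
      by (rule integral_diff_quot_tendsto[where R = "max R S"])
        (auto intro: \<phi> f test_differentiable continuous_pderiv_test simp: R S)
  qed
  have "(\<lambda>n. \<integral>x. pderiv_cl i \<psi> x * D n \<eta> x \<partial>lborel) \<longlonglongrightarrow> (\<integral>x. pderiv_cl i \<psi> x * pderiv_cl j \<eta> x \<partial>lborel)"
    by (rule lim[OF c(2) \<eta>])
  moreover have "(\<integral>x. pderiv_cl i \<psi> x * D n \<eta> x \<partial>lborel)
      = - (\<integral>x. \<psi> x * D n (pderiv_cl i \<eta>) x \<partial>lborel)" for n
    using integration_by_parts[OF \<psi> Dd, of i n] Dc by (simp add: Dp)
  ultimately have "(\<lambda>n. - (\<integral>x. \<psi> x * D n (pderiv_cl i \<eta>) x \<partial>lborel)) \<longlonglongrightarrow> (\<integral>x. pderiv_cl i \<psi> x *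
      pderiv_cl j \<eta> x \<partial>lborel)"
    by simp
  moreover have "(\<lambda>n. - (\<integral>x. \<psi> x * D n (pderiv_cl i \<eta>) x \<partial>lborel)) \<longlonglongrightarrow> - (\<integral>x. \<psi> x * pderiv_cl j
      (pderiv_cl i \<eta>) x \<partial>lborel)"
    by (intro tendsto_minus lim c test_pderiv \<eta>)
  ultimately have "(\<integral>x. pderiv_cl i \<psi> x * pderiv_cl j \<eta> x \<partial>lborel)
      = - (\<integral>x. \<psi> x * pderiv_cl j (pderiv_cl i \<eta>) x \<partial>lborel)"
    by (rule LIMSEQ_unique)
  also have "\<dots> = (\<integral>x. pderiv_cl j \<psi> x * pderiv_cl i \<eta> x \<partial>lborel)"
    by (rule integration_by_parts[OF \<psi> test_differentiable[OF test_pderiv[OF \<eta>]]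
        continuous_pderiv_test[OF test_pderiv[OF \<eta>]], symmetric])
  finally show ?thesis .
qed

text \<open>Integration by parts against \<open>x\<^sub>i \<psi>\<close> gives \<open>\<integral> \<psi>\<^sup>2 = - 2 \<integral> x\<^sub>i \<psi> \<partial>\<^sub>i \<psi>\<close>, and on the support
  of \<open>\<psi>\<close> the factor \<open>x\<^sub>i\<close> is bounded by \<open>R\<close>.\<close>

lemma poincare_test:
  assumes \<psi>: "\<psi> \<in> test_functions \<Omega>" and R: "\<forall>x\<in>\<Omega>. norm x \<le> R"
  shows "(\<integral>x. (\<psi> x)\<^sup>2 \<partial>lborel) \<le> 4 * R\<^sup>2 * (\<integral>x. (pderiv_cl i \<psi> x)\<^sup>2 \<partial>lborel)"
proof -
  note \<psi>' = test_pderiv[OF \<psi>, of i]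
  have z: "\<psi> x = 0" "pderiv_cl i \<psi> x = 0" if "norm x > R" for x
    using test_zero_outside[OF \<psi>] test_zero_outside[OF \<psi>'] R that by (meson not_le)+
  have c: "continuous_on UNIV \<psi>" "continuous_on UNIV (pderiv_cl i \<psi>)"
    using \<psi> \<psi>' by (auto intro: smooth_continuous test_smooth)
  have d: "(\<lambda>x. x $ i * \<psi> x) differentiable at x" for x :: "real ^ 'a"
    by (intro differentiable_mult differentiable_nth test_differentiable[OF \<psi>])
  have p: "pderiv_cl i (\<lambda>x. x $ i * \<psi> x) = (\<lambda>x. x $ i * pderiv_cl i \<psi> x + \<psi> x)"
    by (subst pderiv_cl_mult) (auto simp: differentiable_nth test_differentiable[OF \<psi>] pderiv_cl_nth)
  have cn: "continuous_on UNIV (\<lambda>x::real^'a. x $ i)"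
    by (intro continuous_intros)
  have "(\<integral>x. pderiv_cl i \<psi> x * (x $ i * \<psi> x) \<partial>lborel)
      = - (\<integral>x. \<psi> x * (x $ i * pderiv_cl i \<psi> x + \<psi> x) \<partial>lborel)"
    using integration_by_parts[OF \<psi> d, of i] by (simp add: p cn c continuous_on_add continuous_on_mult)
  moreover have int: "integrable lborel (\<lambda>x. x $ i * \<psi> x * pderiv_cl i \<psi> x)"
      "integrable lborel (\<lambda>x. (\<psi> x)\<^sup>2)"
      "integrable lborel (\<lambda>x. (pderiv_cl i \<psi> x)\<^sup>2)"
    by (rule integrable_continuous_bounded_support[where R = R]; auto intro!: continuous_intros c simp: z)+
  ultimately have "(\<integral>x. (\<psi> x)\<^sup>2 \<partial>lborel) = - 2 * (\<integral>x. x $ i * \<psi> x * pderiv_cl i \<psi> x \<partial>lborel)"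
    by (simp add: power2_eq_square algebra_simps)
  also have "\<dots> = (\<integral>x. - 2 * (x $ i * \<psi> x * pderiv_cl i \<psi> x) \<partial>lborel)" by simp
  also have "\<dots> \<le> (\<integral>x. (1/2) * (\<psi> x)\<^sup>2 + 2 * R\<^sup>2 * (pderiv_cl i \<psi> x)\<^sup>2 \<partial>lborel)"
  proof (rule integral_mono)
    show "- 2 * (x $ i * \<psi> x * pderiv_cl i \<psi> x) \<le> (1/2) * (\<psi> x)\<^sup>2 + 2 * R\<^sup>2 * (pderiv_cl i \<psi> x)\<^sup>2" for x
    proof (cases "norm x > R")
      case False
      then have "\<bar>x $ i\<bar> \<le> R" using component_le_norm_cart[of x i] by linarith
      then have "(x $ i)\<^sup>2 \<le> R\<^sup>2" by (metis abs_ge_zero power2_abs power_mono)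
      then have "(x $ i)\<^sup>2 * (pderiv_cl i \<psi> x)\<^sup>2 \<le> R\<^sup>2 * (pderiv_cl i \<psi> x)\<^sup>2"
          by (intro mult_right_mono) auto
      moreover have "0 \<le> (\<psi> x + 2 * (x $ i * pderiv_cl i \<psi> x))\<^sup>2" by simp
      then have "0 \<le> (\<psi> x)\<^sup>2 + 4 * (x $ i * \<psi> x * pderiv_cl i \<psi> x) + 4 * ((x $ i)\<^sup>2 * (pderiv_cl i \<psi> x)\<^sup>2)"
        by (simp add: power2_eq_square algebra_simps)
      ultimately show ?thesis by simp
    qed (simp add: z)
  qed (use int in auto)
  also have "\<dots> = (1/2) * (\<integral>x. (\<psi> x)\<^sup>2 \<partial>lborel) + 2 * R\<^sup>2 * (\<integral>x. (pderiv_cl i \<psi> x)\<^sup>2 \<partial>lborel)"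
    using int by simp
  finally show ?thesis by simp
qed

section \<open>The fundamental lemma of the calculus of variations\<close>

text \<open>Test functions that increase to the indicator function of an open box as \<open>n\<close> tends to infinity.\<close>

definition box_cutoff :: "real ^ 'd \<Rightarrow> real ^ 'd \<Rightarrow> real \<Rightarrow> real ^ 'd \<Rightarrow> real" where
  "box_cutoff a b n x = (\<Prod>i\<in>UNIV. cutoff 0 (n * (x $ i - a $ i)) * cutoff 0 (n * (b $ i - x $ i)))"

lemma cutoff_0_bounds: "0 \<le> cutoff 0 t" "cutoff 0 t \<le> 1"
  by (auto simp: cutoff_def)

lemma box_cutoff_bounds: "0 \<le> box_cutoff a b n x" "box_cutoff a b n x \<le> 1"
  unfolding box_cutoff_def
  by (auto intro!: prod_nonneg prod_le_1 mult_le_one mult_nonneg_nonneg cutoff_0_bounds)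

lemma smooth_prod:
  assumes "finite I" "\<And>i. i \<in> I \<Longrightarrow> smooth_alg (f i)"
  shows "smooth_alg (\<lambda>x. \<Prod>i\<in>I. f i x)"
  using assms by (induction I rule: finite_induct) (auto intro: smooth_alg.const smooth_alg.mult)

lemma box_cutoff_eq_0: "0 < n \<Longrightarrow> x \<notin> box a b \<Longrightarrow> box_cutoff a b n x = 0"
  unfolding box_cutoff_def prod_zero_iff[OF finite]
  by (auto simp: mem_box_cart cutoff_def zero_less_mult_iff)

lemma box_cutoff_test:
  assumes "cbox a b \<subseteq> \<Omega>" "0 < n"
  shows "box_cutoff a b n \<in> test_functions \<Omega>"
proof -
  have "smooth_alg (\<lambda>x. cutoff 0 (n * (x $ i - a $ i)) * cutoff 0 (n * (b $ i - x $ i)))" for i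
    using smooth_alg.mult[OF smooth_alg.cutoff[of 0 n i "- n * a $ i"] smooth_alg.cutoff[of 0 "- n"
        i "n * b $ i"]]
    by (simp add: algebra_simps)
  then have "smooth_alg (\<lambda>x. \<Prod>i\<in>UNIV. cutoff 0 (n * (x $ i - a $ i)) * cutoff 0 (n * (b $ i - x $ i)))"
    by (intro smooth_prod) auto
  then have "smooth (box_cutoff a b n)"
    unfolding box_cutoff_def[abs_def] by (rule smooth_alg_imp_smooth)
  then show ?thesis
    unfolding test_functions_iff using assms box_subset_cbox[of a b]
    by (intro conjI exI[of _ "cbox a b"]) (auto intro: box_cutoff_eq_0)
qed

lemma cutoff_0_tendsto_1:
  assumes "0 < t"
  shows "(\<lambda>n. cutoff 0 (real (Suc n) * t)) \<longlonglongrightarrow> 1"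
proof -
  have "(\<lambda>n. exp (- ((1 / real (Suc n)) * (1 / t)))) \<longlonglongrightarrow> exp (- (0 * (1 / t)))"
    by (intro tendsto_intros LIMSEQ_Suc[OF lim_1_over_n])
  moreover have "(\<lambda>n. exp (- ((1 / real (Suc n)) * (1 / t)))) = (\<lambda>n. cutoff 0 (real (Suc n) * t))"
    using assms by (auto simp: cutoff_def fun_eq_iff zero_less_mult_iff)
  ultimately show ?thesis by simp
qed

lemma box_cutoff_tendsto: "(\<lambda>n. box_cutoff a b (real (Suc n)) x) \<longlonglongrightarrow> indicator (box a b) x"
proof (cases "x \<in> box a b")
  case True
  then have "(\<lambda>n. box_cutoff a b (real (Suc n)) x) \<longlonglongrightarrow> (\<Prod>i\<in>(UNIV :: 'a set). 1 * 1)"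
    unfolding box_cutoff_def
    by (intro tendsto_prod tendsto_mult cutoff_0_tendsto_1) (auto simp: mem_box_cart)
  then show ?thesis using True by simp
next
  case False
  then show ?thesis using box_cutoff_eq_0[OF _ False, of "real (Suc _)"] by simp
qed

lemma continuous_measurable_lebesgue:
  fixes f :: "'a::euclidean_space \<Rightarrow> real"
  shows "continuous_on UNIV f \<Longrightarrow> f \<in> borel_measurable lebesgue"
  by (rule measurable_completion) (simp add: borel_measurable_continuous_onI)

lemma indicator_measurable_lebesgue:
  "A \<in> sets borel \<Longrightarrow> (indicator A :: _ \<Rightarrow> real) \<in> borel_measurable lebesgue"
  by (intro borel_measurable_indicator) simp

lemma square_integrable_indicator: "square_integrable (indicator (cbox a b))"
proof -
  have "integrable lebesgue (indicator (cbox a b) :: _ \<Rightarrow> real)"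
    using lmeasurable_cbox lmeasurable_iff_integrable by blast
  then show ?thesis
    unfolding square_integrable_def
    by (auto simp: power2_eq_square indicator_inter_arith[symmetric] intro: indicator_measurable_lebesgue)
qed

text \<open>Boxes form a generator of the Borel sets that is stable under intersections, and the sets over
    which \<open>h\<close>
  has integral zero are closed under complements and disjoint unions.\<close>

lemma AE_zero_if_box_integrals_zero:
  fixes h :: "'a::euclidean_space \<Rightarrow> real"
  assumes h: "integrable lebesgue h" and whole: "(\<integral>x. h x \<partial>lebesgue) = 0"
    and boxes: "\<And>a b. (\<integral>x. indicator (box a b) x * h x \<partial>lebesgue) = 0"
  shows "AE x in lebesgue. h x = 0"
proof -
  obtain h' where h'[measurable]: "h' \<in> borel_measurable lborel" and hh': "AE x in lborel. h x = h' x"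
    using completion_ex_borel_measurable_real[of h lborel] h by auto
  have hh'': "AE x in lebesgue. h x = h' x" using hh' by (rule AE_completion)
  have int_eq: "(\<integral>x. indicator A x * h x \<partial>lebesgue) = (\<integral>x\<in>A. h' x \<partial>lborel)" if A: "A \<in> sets borel" for A
  proof -
    have "(\<integral>x. indicator A x * h x \<partial>lebesgue) = (\<integral>x. indicator A x * h' x \<partial>lebesgue)"
      using A h hh'' by (intro integral_cong_AE borel_measurable_times) (auto intro: measurable_completion)
    also have "\<dots> = (\<integral>x\<in>A. h' x \<partial>lborel)"
      using A by (subst integral_completion) (auto simp: set_lebesgue_integral_def)
    finally show ?thesis .
  qed
  have ih': "integrable lborel h'"
  proof -
    have "integrable lebesgue h'"
      using h hh'' by (subst integrable_cong_AE[of _ _ h]) (auto intro: measurable_completion elim: AE_mp)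
    then show ?thesis by (simp add: integrable_completion)
  qed
  then have si: "set_integrable lborel A h'" if "A \<in> sets borel" for A
    unfolding set_integrable_def using that by (intro integrable_mult_indicator) auto
  let ?G = "range (\<lambda>(a, b). box a b :: 'a set)"
  have G: "Int_stable ?G" "?G \<subseteq> Pow UNIV" by (auto simp: Int_stable_def box_Int_box)
  have zero: "(\<integral>x\<in>A. h' x \<partial>lborel) = 0" if "A \<in> sigma_sets UNIV ?G" for A
    using G that
  proof (induction A rule: sigma_sets_induct_disjoint)
    case (basic A)
    then show ?case using boxes int_eq by auto
  next
    case empty
    show ?case by (simp add: set_lebesgue_integral_def)
  next
    case (compl A)
    then have A: "A \<in> sets borel" by (simp add: borel_eq_box)
    have "(\<integral>x\<in>UNIV - A. h' x \<partial>lborel) = (\<integral>x\<in>UNIV. h' x \<partial>lborel) - (\<integral>x\<in>A. h' x \<partial>lborel)"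
      using A si by (subst set_integral_Un[of "UNIV - A" A, symmetric, THEN eq_diff_eq[THEN iffD2]])
        (auto simp: Un_commute)
    then show ?case using compl int_eq[of UNIV] whole by simp
  next
    case (union A)
    then have A: "A i \<in> sets borel" for i by (auto simp: borel_eq_box)
    have "(\<integral>x\<in>(\<Union>i. A i). h' x \<partial>lborel) = (\<Sum>i. (\<integral>x\<in>A i. h' x \<partial>lborel))"
      using A union(1) by (intro lebesgue_integral_countable_add si) (auto simp: disjoint_family_on_def)
    then show ?case using union by simp
  qed
  have "AE x in lborel. h' x = 0"
    by (rule density_unique_real[OF ih' integrable_zero])
      (use zero in \<open>auto simp: borel_eq_box set_lebesgue_integral_def\<close>)
  then have "AE x in lborel. h x = 0" using hh' by (auto elim: AE_mp)
  then show ?thesis by (rule AE_completion)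
qed

text \<open>The fundamental lemma of the calculus of variations. The functions \<open>box_cutoff\<close> show that \<open>g\<close>
    has integral zero
  over every open box whose closure lies in \<open>\<Omega>\<close>. On one such box, all intersections with other
  boxes are boxes again, so \<open>g\<close> vanishes there almost everywhere; countably many of
  them, together with their null boundaries, cover \<open>\<Omega>\<close>.\<close>

lemma AE_zero_if_orthogonal_to_test_functions:
  fixes g :: "real ^ 'd \<Rightarrow> real"
  assumes \<Omega>: "open \<Omega>" and g: "square_integrable g"
    and orth: "\<And>\<psi>. \<psi> \<in> test_functions \<Omega> \<Longrightarrow> (\<integral>x. g x * \<psi> x \<partial>lebesgue) = 0"
  shows "AE x in lebesgue. x \<in> \<Omega> \<longrightarrow> g x = 0"
proof -
  have box_int: "(\<integral>x. indicator (box a b) x * g x \<partial>lebesgue) = 0" if ab: "cbox a b \<subseteq> \<Omega>" for a b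
  proof -
    have gi: "integrable lebesgue (\<lambda>x. indicator (cbox a b) x * g x)"
      by (rule square_integrable_mult[OF square_integrable_indicator g])
    have "(\<lambda>n. \<integral>x. box_cutoff a b (real (Suc n)) x * g x \<partial>lebesgue) \<longlonglongrightarrow> (\<integral>x. indicator (box a b) x * g
        x \<partial>lebesgue)"
    proof (rule integral_dominated_convergence[OF _ _ gi[THEN integrable_norm]])
      show "(\<lambda>x. indicator (box a b) x * g x) \<in> borel_measurable lebesgue"
        using g by (intro borel_measurable_times indicator_measurable_lebesgue) auto
      have "continuous_on UNIV (box_cutoff a b (real (Suc n)))" for n
        using box_cutoff_test[OF ab, of "real (Suc n)"] by (intro smooth_continuous test_smooth) auto
      then show "(\<lambda>x. box_cutoff a b (real (Suc n)) x * g x) \<in> borel_measurable lebesgue" for n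
        using g by (intro borel_measurable_times[OF continuous_measurable_lebesgue]) auto
      show "AE x in lebesgue. (\<lambda>n. box_cutoff a b (real (Suc n)) x * g x) \<longlonglongrightarrow> indicator (box a b) x * g x"
        by (intro AE_I2 tendsto_mult box_cutoff_tendsto tendsto_const)
      have "\<bar>box_cutoff a b (real (Suc n)) x\<bar> \<le> indicator (cbox a b) x" for n x
        using box_cutoff_bounds[of a b "real (Suc n)" x] box_cutoff_eq_0[of "real (Suc n)" x a b]
            box_subset_cbox[of a b]
        by (cases "x \<in> cbox a b") auto
      then show "AE x in lebesgue. norm (box_cutoff a b (real (Suc n)) x * g x)
          \<le> norm (indicator (cbox a b) x * g x)" for n
        by (intro AE_I2) (auto simp: abs_mult intro!: mult_right_mono)
    qed
    moreover have "(\<integral>x. box_cutoff a b (real (Suc n)) x * g x \<partial>lebesgue) = 0" for n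
      using orth[OF box_cutoff_test[OF ab, of "real (Suc n)"]] by (simp add: mult.commute)
    ultimately show ?thesis by (simp add: LIMSEQ_const_iff)
  qed
  have on_box: "AE x in lebesgue. x \<in> cbox c d \<longrightarrow> g x = 0" if cd: "cbox c d \<subseteq> \<Omega>" for c d
  proof -
    have "AE x in lebesgue. indicator (box c d) x * g x = 0"
    proof (rule AE_zero_if_box_integrals_zero)
      have "integrable lebesgue (\<lambda>x. indicator (box c d) x *\<^sub>R (indicator (cbox c d) x * g x))"
        by (intro integrable_mult_indicator square_integrable_mult square_integrable_indicator g) auto
      also have "(\<lambda>x. indicator (box c d) x *\<^sub>R (indicator (cbox c d) x * g x))
          = (\<lambda>x. indicator (box c d) x * g x)"
        using box_subset_cbox[of c d] by (auto simp: fun_eq_iff indicator_def)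
      finally show "integrable lebesgue (\<lambda>x. indicator (box c d) x * g x)" .
      show "(\<integral>x. indicator (box c d) x * g x \<partial>lebesgue) = 0" by (rule box_int[OF cd])
      fix a b
      obtain a' b' where ab: "box a b \<inter> box c d = box a' b'"
        using box_Int_box[of a b c d] by blast
      have "(\<integral>x. indicator (box a b) x * (indicator (box c d) x * g x) \<partial>lebesgue)
          = (\<integral>x. indicator (box a' b') x * g x \<partial>lebesgue)"
        unfolding ab[symmetric] by (intro Bochner_Integration.integral_cong) (auto simp: indicator_def)
      also have "\<dots> = 0"
      proof (cases "box a' b' = {}")
        case False
        have "box a' b' \<subseteq> cbox c d" using ab box_subset_cbox[of c d] by blast
        then have "cbox a' b' \<subseteq> cbox c d"
          using closure_box[OF False] closure_minimal[of "box a' b'" "cbox c d"] closed_cbox by metis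
        then show ?thesis using cd by (intro box_int) auto
      qed simp
      finally show "(\<integral>x. indicator (box a b) x * (indicator (box c d) x * g x) \<partial>lebesgue) = 0" .
    qed
    moreover have "AE x in lebesgue. x \<notin> cbox c d - box c d"
    proof -
      have "negligible (cbox c d - box c d)" by (rule negligible_frontier_interval)
      then have "cbox c d - box c d \<in> null_sets lebesgue" by (simp add: negligible_iff_null_sets)
      then show ?thesis by (rule AE_not_in)
    qed
    ultimately show ?thesis by eventually_elim (auto simp: indicator_def split: if_splits)
  qed
  obtain \<D> where ctbl: "countable \<D>" and boxes: "\<And>X. X \<in> \<D> \<Longrightarrow> \<exists>a b. X = cbox a b" and D: "\<D> \<subseteq> Pow \<Omega>" "\<Union>\<D> = \<Omega>"
    using open_countable_Union_open_cbox[OF \<Omega>] by metis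
  have "AE x in lebesgue. x \<in> X \<longrightarrow> g x = 0" if X: "X \<in> \<D>" for X
  proof -
    obtain c d where "X = cbox c d" using boxes[OF X] by blast
    then show ?thesis using on_box[of c d] X D(1) by blast
  qed
  then have "AE x in lebesgue. \<forall>X\<in>\<D>. x \<in> X \<longrightarrow> g x = 0"
    unfolding AE_ball_countable[OF ctbl] by blast
  then show ?thesis by (rule AE_mp) (use D(2) in \<open>auto intro!: AE_I2\<close>)
qed

section \<open>Square-integrable functions on a domain\<close>

lemma bounded_multiplier_square_integrable:
  assumes "k \<in> borel_measurable lebesgue" "\<And>x. \<bar>k x\<bar> \<le> B" "square_integrable u"
  shows "square_integrable (\<lambda>x. k x * u x)"
  unfolding square_integrable_def
proof
  show m: "(\<lambda>x. k x * u x) \<in> borel_measurable lebesgue"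
    using assms by (intro borel_measurable_times) auto
  show "integrable lebesgue (\<lambda>x. (k x * u x)\<^sup>2)"
  proof (rule Bochner_Integration.integrable_bound)
    show "integrable lebesgue (\<lambda>x. B\<^sup>2 * (u x)\<^sup>2)" using assms(3) by (simp add: square_integrable_def)
    show "(\<lambda>x. (k x * u x)\<^sup>2) \<in> borel_measurable lebesgue" using m by (intro borel_measurable_power)
    have "(k x)\<^sup>2 \<le> B\<^sup>2" for x using power_mono[OF assms(2)[of x] abs_ge_zero, of 2] by simp
    then show "AE x in lebesgue. norm ((k x * u x)\<^sup>2) \<le> norm (B\<^sup>2 * (u x)\<^sup>2)"
      by (intro AE_I2) (auto simp: power_mult_distrib intro: mult_right_mono)
  qed
qed

text \<open>Used with the indicator function of the domain, as restriction, and with the entries of the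
  permeability tensor.\<close>

definition mul_l2 :: "('a::euclidean_space \<Rightarrow> real) \<Rightarrow> 'a l2 \<Rightarrow> 'a l2" where
  "mul_l2 k U = abs_l2 (\<lambda>x. k x * rep_l2 U x)"

lemma rep_l2: "square_integrable (rep_l2 U)" "abs_l2 (rep_l2 U) = U"
  using Quotient3_abs_rep[OF Quotient3_l2, of U] Quotient3_rep_reflp[OF Quotient3_l2, of U] by simp_all

lemma rep_abs_l2: "square_integrable u \<Longrightarrow> AE x in lebesgue. rep_l2 (abs_l2 u) x = u x"
  using abs_l2_eq_iff[OF rep_l2(1)] rep_l2(2) by blast

lemma mul_abs_l2:
  assumes "k \<in> borel_measurable lebesgue" "\<And>x. \<bar>k x\<bar> \<le> B" "square_integrable u"
  shows "mul_l2 k (abs_l2 u) = abs_l2 (\<lambda>x. k x * u x)"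
  unfolding mul_l2_def
  using bounded_multiplier_square_integrable[OF assms(1,2)] assms(3) rep_l2(1) rep_abs_l2[OF assms(3)]
  by (subst abs_l2_eq_iff) (auto elim: AE_mp)

lemma bounded_linear_mul_l2:
  assumes k: "k \<in> borel_measurable lebesgue" "\<And>x. \<bar>k x\<bar> \<le> B"
  shows "bounded_linear (mul_l2 k)"
proof
  note si = bounded_multiplier_square_integrable[OF k] and mul = mul_abs_l2[OF k]
  fix U V :: "'a l2" and c :: real
  obtain u v where u: "square_integrable u" "U = abs_l2 u" and v: "square_integrable v" "V = abs_l2 v"
    by (metis l2_exhaust)
  show "mul_l2 k (U + V) = mul_l2 k U + mul_l2 k V"
    using u v by (simp add: plus_l2.abs_eq square_integrable_add mul si distrib_left)
  show "mul_l2 k (c *\<^sub>R U) = c *\<^sub>R mul_l2 k U"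
    using u by (simp add: scaleR_l2.abs_eq square_integrable_scale mul si mult.left_commute)
next
  note si = bounded_multiplier_square_integrable[OF k] and mul = mul_abs_l2[OF k]
  have "norm (mul_l2 k U) \<le> norm U * \<bar>B\<bar>" for U
  proof -
    obtain u where u: "square_integrable u" "U = abs_l2 u" by (metis l2_exhaust)
    have "(norm (mul_l2 k U))\<^sup>2 = (\<integral>x. (k x * u x)\<^sup>2 \<partial>lebesgue)"
      using u by (simp add: mul norm_abs_l2 si)
    also have "\<dots> \<le> (\<integral>x. B\<^sup>2 * (u x)\<^sup>2 \<partial>lebesgue)"
    proof (rule integral_mono)
      show "integrable lebesgue (\<lambda>x. (k x * u x)\<^sup>2)" using si[OF u(1)] by (simp add: square_integrable_def)
      show "integrable lebesgue (\<lambda>x. B\<^sup>2 * (u x)\<^sup>2)" using u(1) by (simp add: square_integrable_def)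
      fix x
      have "(k x)\<^sup>2 \<le> B\<^sup>2" using power_mono[OF k(2)[of x] abs_ge_zero, of 2] by simp
      then show "(k x * u x)\<^sup>2 \<le> B\<^sup>2 * (u x)\<^sup>2" by (simp add: power_mult_distrib mult_right_mono)
    qed
    also have "\<dots> = (norm U * \<bar>B\<bar>)\<^sup>2" using u by (simp add: norm_abs_l2 power_mult_distrib)
    finally show ?thesis by (rule power2_le_imp_le) simp
  qed
  then show "\<exists>K. \<forall>U. norm (mul_l2 k U) \<le> norm U * K" by blast
qed

lemma L2_real_iff:
  fixes u :: "real ^ 'd \<Rightarrow> real"
  assumes "\<Omega> \<in> sets lebesgue"
  shows "u \<in> L2 \<Omega> \<longleftrightarrow> square_integrable (\<lambda>x. indicator \<Omega> x * u x)"
proof -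
  have "(\<lambda>x. indicator \<Omega> x * u x) = (\<lambda>x. if x \<in> \<Omega> then u x else 0)" by (auto simp: indicator_def)
  moreover have "(\<lambda>x. (indicator \<Omega> x * u x)\<^sup>2) = (\<lambda>x. indicator \<Omega> x *\<^sub>R (norm (u x))\<^sup>2)"
    by (auto simp: indicator_def)
  ultimately show ?thesis unfolding L2_def square_integrable_def
    using borel_measurable_if[OF assms, of u] integrable_restrict_space[of \<Omega> lebesgue "\<lambda>x. (norm (u
        x))\<^sup>2"] assms
    by simp
qed

lemma L2_norm_integrable: "u \<in> L2 \<Omega> \<Longrightarrow> integrable (lebesgue_on \<Omega>) (\<lambda>x. (norm (u x))\<^sup>2)"
  by (simp add: L2_def)

lemma L2_measurable: "u \<in> L2 \<Omega> \<Longrightarrow> u \<in> borel_measurable (lebesgue_on \<Omega>)"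
  by (simp add: L2_def)

lemma L2_inner_integrable:
  assumes "u \<in> L2 \<Omega>" "v \<in> L2 \<Omega>"
  shows "integrable (lebesgue_on \<Omega>) (\<lambda>x. inner (u x) (v x))"
proof (rule Bochner_Integration.integrable_bound)
  show "integrable (lebesgue_on \<Omega>) (\<lambda>x. (norm (u x))\<^sup>2 + (norm (v x))\<^sup>2)"
    using assms by (simp add: L2_norm_integrable)
  show "(\<lambda>x. inner (u x) (v x)) \<in> borel_measurable (lebesgue_on \<Omega>)"
    using assms by (intro borel_measurable_inner L2_measurable)
  show "AE x in lebesgue_on \<Omega>. norm (inner (u x) (v x)) \<le> norm ((norm (u x))\<^sup>2 + (norm (v x))\<^sup>2)"
  proof (rule AE_I2)
    fix x
    have "2 * norm (u x) * norm (v x) \<le> (norm (u x))\<^sup>2 + (norm (v x))\<^sup>2" by (rule sum_squares_bound)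
    moreover have "0 \<le> norm (u x) * norm (v x)" by simp
    ultimately have "norm (u x) * norm (v x) \<le> (norm (u x))\<^sup>2 + (norm (v x))\<^sup>2" by linarith
    then show "norm (inner (u x) (v x)) \<le> norm ((norm (u x))\<^sup>2 + (norm (v x))\<^sup>2)"
      using Cauchy_Schwarz_ineq2[of "u x" "v x"] by simp
  qed
qed

lemma norm_vec_power2: "(norm (x :: 'b::real_inner ^ 'n))\<^sup>2 = (\<Sum>i\<in>UNIV. (norm (x $ i))\<^sup>2)"
  by (simp add: power2_norm_eq_inner inner_vec_def)

lemma borel_measurable_vec_iff:
  fixes g :: "'a \<Rightarrow> 'b::euclidean_space ^ 'n"
  shows "g \<in> borel_measurable M \<longleftrightarrow> (\<forall>i. (\<lambda>x. g x $ i) \<in> borel_measurable M)"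
proof
  assume "g \<in> borel_measurable M"
  then show "\<forall>i. (\<lambda>x. g x $ i) \<in> borel_measurable M"
    by (intro allI measurable_compose[OF _ borel_measurable_continuous_onI[OF
        continuous_on_component[OF continuous_on_id]]])
next
  assume *: "\<forall>i. (\<lambda>x. g x $ i) \<in> borel_measurable M"
  show "g \<in> borel_measurable M"
    by (rule borel_measurable_euclidean_space[THEN iffD2])
      (use * in \<open>auto simp: Basis_vec_def inner_axis intro: borel_measurable_inner\<close>)
qed

lemma L2_vec_iff:
  fixes g :: "real ^ 'd \<Rightarrow> 'b::euclidean_space ^ 'n"
  shows "g \<in> L2 \<Omega> \<longleftrightarrow> (\<forall>i. (\<lambda>x. g x $ i) \<in> L2 \<Omega>)"
proof (cases "g \<in> borel_measurable (lebesgue_on \<Omega>)")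
  case True
  have "integrable (lebesgue_on \<Omega>) (\<lambda>x. (norm (g x $ i))\<^sup>2)"
      if "integrable (lebesgue_on \<Omega>) (\<lambda>x. (norm (g x))\<^sup>2)" for i
  proof (rule Bochner_Integration.integrable_bound[OF that])
    have "(\<lambda>x. g x $ i) \<in> borel_measurable (lebesgue_on \<Omega>)" using True borel_measurable_vec_iff by blast
    then show "(\<lambda>x. (norm (g x $ i))\<^sup>2) \<in> borel_measurable (lebesgue_on \<Omega>)"
      by measurable
    show "AE x in lebesgue_on \<Omega>. norm ((norm (g x $ i))\<^sup>2) \<le> norm ((norm (g x))\<^sup>2)"
      by (auto intro!: AE_I2 power_mono Finite_Cartesian_Product.norm_nth_le)
  qed
  moreover have "integrable (lebesgue_on \<Omega>) (\<lambda>x. (norm (g x))\<^sup>2)"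
    if "\<And>i. integrable (lebesgue_on \<Omega>) (\<lambda>x. (norm (g x $ i))\<^sup>2)"
    unfolding norm_vec_power2 using that by (intro Bochner_Integration.integrable_sum) auto
  ultimately show ?thesis using True borel_measurable_vec_iff[of g] by (auto simp: L2_def)
next
  case False
  then show ?thesis using borel_measurable_vec_iff[of g] by (auto simp: L2_def)
qed

lemma inner_L2_vec:
  fixes u v :: "real ^ 'd \<Rightarrow> 'b::euclidean_space ^ 'n"
  assumes "u \<in> L2 \<Omega>" "v \<in> L2 \<Omega>"
  shows "inner_L2 \<Omega> u v = (\<Sum>i\<in>UNIV. inner_L2 \<Omega> (\<lambda>x. u x $ i) (\<lambda>x. v x $ i))"
  unfolding inner_L2_def inner_vec_def
  using assms by (intro Bochner_Integration.integral_sum L2_inner_integrable) (auto simp: L2_vec_iff)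

lemma norm_L2_power2: "(norm_L2 \<Omega> u)\<^sup>2 = inner_L2 \<Omega> u u"
  unfolding norm_L2_def inner_L2_def
  by (simp add: power2_norm_eq_inner)

lemma norm_L2_nonneg: "0 \<le> norm_L2 \<Omega> u"
  by (simp add: norm_L2_def)

definition to_l2 :: "(real ^ 'd) set \<Rightarrow> (real ^ 'd \<Rightarrow> real) \<Rightarrow> (real ^ 'd) l2" where
  "to_l2 \<Omega> u = abs_l2 (\<lambda>x. indicator \<Omega> x * u x)"

lemma integral_lebesgue_on:
  fixes f :: "real ^ 'd \<Rightarrow> real"
  shows "\<Omega> \<in> sets lebesgue \<Longrightarrow> integral\<^sup>L (lebesgue_on \<Omega>) f = (\<integral>x. indicator \<Omega> x * f x \<partial>lebesgue)"
  by (subst integral_restrict_space) auto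

context
  fixes \<Omega> :: "(real ^ 'd) set"
  assumes \<Omega>: "\<Omega> \<in> sets lebesgue"
begin

lemmas L2_iff = L2_real_iff[OF \<Omega>]

lemma to_l2_add: "u \<in> L2 \<Omega> \<Longrightarrow> v \<in> L2 \<Omega> \<Longrightarrow> to_l2 \<Omega> (\<lambda>x. u x + v x) = to_l2 \<Omega> u + to_l2 \<Omega> v"
  unfolding to_l2_def L2_iff by (simp add: plus_l2.abs_eq distrib_left)

lemma to_l2_diff: "u \<in> L2 \<Omega> \<Longrightarrow> v \<in> L2 \<Omega> \<Longrightarrow> to_l2 \<Omega> (\<lambda>x. u x - v x) = to_l2 \<Omega> u - to_l2 \<Omega> v"
  unfolding to_l2_def L2_iff by (simp add: minus_l2.abs_eq right_diff_distrib)

lemma to_l2_scale: "u \<in> L2 \<Omega> \<Longrightarrow> to_l2 \<Omega> (\<lambda>x. c * u x) = c *\<^sub>R to_l2 \<Omega> u"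
  unfolding to_l2_def L2_iff by (simp add: scaleR_l2.abs_eq mult.left_commute)

lemma L2_add: "u \<in> L2 \<Omega> \<Longrightarrow> v \<in> L2 \<Omega> \<Longrightarrow> (\<lambda>x. u x + v x) \<in> L2 \<Omega>"
  for u v :: "real ^ 'd \<Rightarrow> real"
  unfolding L2_iff using square_integrable_add by (fastforce simp: distrib_left)

lemma L2_diff: "u \<in> L2 \<Omega> \<Longrightarrow> v \<in> L2 \<Omega> \<Longrightarrow> (\<lambda>x. u x - v x) \<in> L2 \<Omega>"
  for u v :: "real ^ 'd \<Rightarrow> real"
  unfolding L2_iff using square_integrable_diff by (fastforce simp: right_diff_distrib)

lemma L2_scale: "u \<in> L2 \<Omega> \<Longrightarrow> (\<lambda>x. c * u x) \<in> L2 \<Omega>"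
  for u :: "real ^ 'd \<Rightarrow> real"
  unfolding L2_iff using square_integrable_scale by (fastforce simp: mult.left_commute)

lemma L2_zero: "(\<lambda>x. 0 :: real) \<in> L2 \<Omega>"
  unfolding L2_iff by (simp add: square_integrable_zero)

lemma L2_sum:
  fixes u :: "'i \<Rightarrow> real ^ 'd \<Rightarrow> real"
  shows "(\<And>i. i \<in> I \<Longrightarrow> u i \<in> L2 \<Omega>) \<Longrightarrow> (\<lambda>x. \<Sum>i\<in>I. u i x) \<in> L2 \<Omega>"
  by (induction I rule: infinite_finite_induct) (auto intro: L2_zero L2_add)

lemma to_l2_zero: "to_l2 \<Omega> (\<lambda>x. 0) = 0"
  by (simp add: to_l2_def zero_l2_def)

lemma to_l2_sum:
  fixes u :: "'i \<Rightarrow> real ^ 'd \<Rightarrow> real"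
  shows "(\<And>i. i \<in> I \<Longrightarrow> u i \<in> L2 \<Omega>) \<Longrightarrow> to_l2 \<Omega> (\<lambda>x. \<Sum>i\<in>I. u i x) = (\<Sum>i\<in>I. to_l2 \<Omega> (u i))"
  by (induction I rule: infinite_finite_induct) (auto simp: to_l2_zero to_l2_add L2_sum)

lemma to_l2_eq_iff:
  assumes "u \<in> L2 \<Omega>" "v \<in> L2 \<Omega>"
  shows "to_l2 \<Omega> u = to_l2 \<Omega> v \<longleftrightarrow> eq_ae \<Omega> u v"
  using assms unfolding L2_iff to_l2_def eq_ae_def
  by (subst abs_l2_eq_iff) (auto simp: AE_restrict_space_iff[of \<Omega> lebesgue] \<Omega> indicator_def elim!: AE_mp)

lemma inner_to_l2:
  assumes "u \<in> L2 \<Omega>" "v \<in> L2 \<Omega>"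
  shows "inner (to_l2 \<Omega> u) (to_l2 \<Omega> v) = inner_L2 \<Omega> u v"
  using assms unfolding L2_iff to_l2_def inner_L2_def integral_lebesgue_on[OF \<Omega>]
  by (auto simp: inner_abs_l2 indicator_def intro!: Bochner_Integration.integral_cong)

lemma norm_to_l2: "u \<in> L2 \<Omega> \<Longrightarrow> norm (to_l2 \<Omega> u) = norm_L2 \<Omega> u"
  using norm_L2_power2[of \<Omega> u] inner_to_l2[of u u] norm_L2_nonneg[of \<Omega> u]
  by (simp add: power2_norm_eq_inner[symmetric]) (metis norm_ge_zero power2_eq_imp_eq)

lemma indicator_multiplier: "(indicator \<Omega> :: _ \<Rightarrow> real) \<in> borel_measurable lebesgue"
    "\<bar>indicator \<Omega> x :: real\<bar> \<le> 1"
  using \<Omega> by (auto simp: indicator_def)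

lemma mul_indicator_to_l2: "u \<in> L2 \<Omega> \<Longrightarrow> mul_l2 (indicator \<Omega>) (to_l2 \<Omega> u) = to_l2 \<Omega> u"
  unfolding to_l2_def L2_iff
  by (subst mul_abs_l2[OF indicator_multiplier]) (auto simp: mult.assoc[symmetric]
      indicator_inter_arith[symmetric])

lemma to_l2_surj:
  assumes "mul_l2 (indicator \<Omega>) U = U"
  shows "rep_l2 U \<in> L2 \<Omega>" "to_l2 \<Omega> (rep_l2 U) = U"
proof -
  show "rep_l2 U \<in> L2 \<Omega>"
    unfolding L2_iff by (rule bounded_multiplier_square_integrable[OF indicator_multiplier rep_l2(1)])
  show "to_l2 \<Omega> (rep_l2 U) = U" using assms by (simp add: to_l2_def mul_l2_def)
qed

end

section \<open>The space of zero-trace Sobolev functions as a space of jets\<close>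

type_synonym ('a, 'd) jets = "'a \<times> ('a, 'd) vec"

text \<open>The graph norm of the product type turns \<open>jet\<close> into an isometry of \<open>H\<^sup>1(\<Omega>)\<close>.\<close>

definition jet :: "(real ^ 'd) set \<Rightarrow> (real ^ 'd \<Rightarrow> real) \<Rightarrow> ((real ^ 'd) l2, 'd) jets" where
  "jet \<Omega> u = (to_l2 \<Omega> u, \<chi> i. to_l2 \<Omega> (\<lambda>x. grad \<Omega> u x $ i))"

definition H10_jets :: "(real ^ 'd) set \<Rightarrow> (((real ^ 'd) l2, 'd) jets) set" where
  "H10_jets \<Omega> = closure (jet \<Omega> ` test_functions \<Omega>)"

lemma continuous_square_integrable:
  fixes f :: "real ^ 'd \<Rightarrow> real"
  assumes "continuous_on UNIV f" "\<And>x. norm x > R \<Longrightarrow> f x = 0"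
  shows "square_integrable f"
proof -
  have "integrable lborel (\<lambda>x. (f x)\<^sup>2)"
    using assms by (intro integrable_continuous_bounded_support[where R = R] continuous_intros) auto
  then have "integrable lebesgue (\<lambda>x. (f x)\<^sup>2)"
    using integrable_completion borel_measurable_integrable by blast
  then show ?thesis using continuous_measurable_lebesgue[OF assms(1)] by (simp add: square_integrable_def)
qed

lemma subspace_closure:
  fixes S :: "'a::real_normed_vector set"
  assumes S: "subspace S"
  shows "subspace (closure S)"
proof (rule subspaceI)
  show "0 \<in> closure S" using subspace_0[OF S] closure_subset by blast
next
  fix x y assume "x \<in> closure S" "y \<in> closure S"
  then obtain f g where "\<And>n. f n \<in> S" "f \<longlonglongrightarrow> x" "\<And>n. g n \<in> S" "g \<longlonglongrightarrow> y"
    unfolding closure_sequential by blast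
  then show "x + y \<in> closure S"
    unfolding closure_sequential using subspace_add[OF S]
        by (intro exI[of _ "\<lambda>n. f n + g n"]) (auto intro: tendsto_add)
next
  fix c :: real and x assume "x \<in> closure S"
  then obtain f where "\<And>n. f n \<in> S" "f \<longlonglongrightarrow> x" unfolding closure_sequential by blast
  then show "c *\<^sub>R x \<in> closure S"
    unfolding closure_sequential using subspace_scale[OF S]
        by (intro exI[of _ "\<lambda>n. c *\<^sub>R f n"]) (auto intro: tendsto_intros)
qed

context
  fixes \<Omega> :: "(real ^ 'd) set"
  assumes open_\<Omega>: "open \<Omega>"
begin

lemma open_lebesgue: "\<Omega> \<in> sets lebesgue"
  using open_\<Omega> by simp

lemma test_square_integrable: "\<psi> \<in> test_functions \<Omega> \<Longrightarrow> square_integrable \<psi>"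
  by (metis continuous_square_integrable smooth_continuous test_bounded_support test_smooth)

lemma test_indicator: "\<psi> \<in> test_functions \<Omega> \<Longrightarrow> (\<lambda>x. indicator \<Omega> x * \<psi> x) = \<psi>"
  using test_zero_outside by (fastforce simp: indicator_def)

lemma test_L2: "\<psi> \<in> test_functions \<Omega> \<Longrightarrow> \<psi> \<in> L2 \<Omega>"
  by (simp add: L2_iff[OF open_lebesgue] test_indicator test_square_integrable)

lemma to_l2_test: "\<psi> \<in> test_functions \<Omega> \<Longrightarrow> to_l2 \<Omega> \<psi> = abs_l2 \<psi>"
  by (simp add: to_l2_def test_indicator)

lemma inner_test:
  assumes "\<psi> \<in> test_functions \<Omega>" "\<eta> \<in> test_functions \<Omega>"
  shows "inner (to_l2 \<Omega> \<psi>) (to_l2 \<Omega> \<eta>) = (\<integral>x. \<psi> x * \<eta> x \<partial>lborel)"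
proof -
  have "continuous_on UNIV (\<lambda>x. \<psi> x * \<eta> x)"
    using assms by (intro continuous_intros smooth_continuous test_smooth)
  then show ?thesis
    using assms by (simp add: to_l2_test inner_abs_l2 test_square_integrable integral_completion
        borel_measurable_continuous_onI)
qed

text \<open>In this form the relation is preserved by limits and linear combinations.\<close>

lemma is_weak_grad_iff:
  assumes u: "u \<in> L2 \<Omega>" and g: "g \<in> L2 \<Omega>"
  shows "is_weak_grad \<Omega> u g \<longleftrightarrow> (\<forall>\<psi>\<in>test_functions \<Omega>. \<forall>i.
    inner (to_l2 \<Omega> u) (to_l2 \<Omega> (pderiv_cl i \<psi>)) = - inner (to_l2 \<Omega> (\<lambda>x. g x $ i)) (to_l2 \<Omega> \<psi>))"
proof -
  have "inner (to_l2 \<Omega> u) (to_l2 \<Omega> (pderiv_cl i \<psi>))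
      = integral\<^sup>L (lebesgue_on \<Omega>) (\<lambda>x. u x * pderiv_cl i \<psi> x)"
    "inner (to_l2 \<Omega> (\<lambda>x. g x $ i)) (to_l2 \<Omega> \<psi>) = integral\<^sup>L (lebesgue_on \<Omega>) (\<lambda>x. g x $ i * \<psi> x)"
    if "\<psi> \<in> test_functions \<Omega>" for \<psi> i
    using u g that test_pderiv[OF that]
    by (simp_all add: inner_to_l2[OF open_lebesgue] inner_L2_def L2_vec_iff test_L2)
  then show ?thesis unfolding is_weak_grad_def by auto
qed

lemma weak_grad_unique:
  assumes "is_weak_grad \<Omega> u g" "is_weak_grad \<Omega> u h" "u \<in> L2 \<Omega>" "g \<in> L2 \<Omega>" "h \<in> L2 \<Omega>"
  shows "to_l2 \<Omega> (\<lambda>x. g x $ i) = to_l2 \<Omega> (\<lambda>x. h x $ i)"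
proof -
  have gh: "(\<lambda>x. g x $ i) \<in> L2 \<Omega>" "(\<lambda>x. h x $ i) \<in> L2 \<Omega>" using assms by (auto simp: L2_vec_iff)
  let ?d = "\<lambda>x. indicator \<Omega> x * (g x $ i - h x $ i)"
  have d: "square_integrable ?d"
    using L2_diff[OF open_lebesgue gh] by (simp add: L2_iff[OF open_lebesgue])
  have "AE x in lebesgue. x \<in> \<Omega> \<longrightarrow> ?d x = 0"
  proof (rule AE_zero_if_orthogonal_to_test_functions[OF open_\<Omega> d])
    fix \<psi> assume \<psi>: "\<psi> \<in> test_functions \<Omega>"
    have "(\<integral>x. ?d x * \<psi> x \<partial>lebesgue) = inner (to_l2 \<Omega> (\<lambda>x. g x $ i - h x $ i)) (to_l2 \<Omega> \<psi>)"
      unfolding to_l2_test[OF \<psi>] using d test_square_integrable[OF \<psi>] by (simp add: to_l2_def inner_abs_l2)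
    also have "\<dots> = 0"
      using assms \<psi> by (simp add: to_l2_diff[OF open_lebesgue gh] inner_diff_left is_weak_grad_iff)
    finally show "(\<integral>x. ?d x * \<psi> x \<partial>lebesgue) = 0" .
  qed
  then have "eq_ae \<Omega> (\<lambda>x. g x $ i) (\<lambda>x. h x $ i)"
    unfolding eq_ae_def by (subst AE_restrict_space_iff) (auto simp: open_lebesgue elim!: AE_mp)
  then show ?thesis by (simp add: to_l2_eq_iff[OF open_lebesgue gh])
qed

lemma H1_grad:
  assumes "u \<in> H1 \<Omega>"
  shows "u \<in> L2 \<Omega>" "grad \<Omega> u \<in> L2 \<Omega>" "is_weak_grad \<Omega> u (grad \<Omega> u)"
proof -
  show "u \<in> L2 \<Omega>" using assms by (simp add: H1_def)
  have "\<exists>g. g \<in> L2 \<Omega> \<and> is_weak_grad \<Omega> u g" using assms by (auto simp: H1_def)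
  then have "grad \<Omega> u \<in> L2 \<Omega> \<and> is_weak_grad \<Omega> u (grad \<Omega> u)" unfolding grad_def by (rule someI_ex)
  then show "grad \<Omega> u \<in> L2 \<Omega>" "is_weak_grad \<Omega> u (grad \<Omega> u)" by auto
qed

lemma jet_eqI:
  assumes "u \<in> L2 \<Omega>" "g \<in> L2 \<Omega>" "is_weak_grad \<Omega> u g"
  shows "u \<in> H1 \<Omega>" "jet \<Omega> u = (to_l2 \<Omega> u, \<chi> i. to_l2 \<Omega> (\<lambda>x. g x $ i))"
proof -
  show u: "u \<in> H1 \<Omega>" using assms by (auto simp: H1_def)
  show "jet \<Omega> u = (to_l2 \<Omega> u, \<chi> i. to_l2 \<Omega> (\<lambda>x. g x $ i))"
    using weak_grad_unique[OF H1_grad(3)[OF u] assms(3,1) H1_grad(2)[OF u] assms(2)]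
    by (simp add: jet_def)
qed

lemma jet_linear:
  assumes u: "u \<in> H1 \<Omega>" and v: "v \<in> H1 \<Omega>"
  shows "(\<lambda>x. a * u x + b * v x) \<in> H1 \<Omega>" "jet \<Omega> (\<lambda>x. a * u x + b * v x) = a *\<^sub>R jet \<Omega> u + b *\<^sub>R jet \<Omega> v"
proof -
  note U = H1_grad[OF u] and V = H1_grad[OF v] and o = open_lebesgue
  let ?w = "\<lambda>x. a * u x + b * v x" and ?g = "\<lambda>x. a *\<^sub>R grad \<Omega> u x + b *\<^sub>R grad \<Omega> v x"
  have gi: "(\<lambda>x. grad \<Omega> u x $ i) \<in> L2 \<Omega>" "(\<lambda>x. grad \<Omega> v x $ i) \<in> L2 \<Omega>" for i
    using U V by (auto simp: L2_vec_iff)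
  have w: "?w \<in> L2 \<Omega>" "?g \<in> L2 \<Omega>"
    using U V gi by (auto simp: L2_vec_iff intro!: L2_add[OF o] L2_scale[OF o])
  have tw: "to_l2 \<Omega> ?w = a *\<^sub>R to_l2 \<Omega> u + b *\<^sub>R to_l2 \<Omega> v"
    using U V by (simp add: to_l2_add[OF o] to_l2_scale[OF o] L2_scale[OF o])
  have tg: "to_l2 \<Omega> (\<lambda>x. ?g x $ i) = a *\<^sub>R to_l2 \<Omega> (\<lambda>x. grad \<Omega> u x $ i)
      + b *\<^sub>R to_l2 \<Omega> (\<lambda>x. grad \<Omega> v x $ i)" for i
    using gi by (simp add: to_l2_add[OF o] to_l2_scale[OF o] L2_scale[OF o])
  have wg: "is_weak_grad \<Omega> ?w ?g"
    unfolding is_weak_grad_iff[OF w] using U V tw tg by (simp add: is_weak_grad_iff inner_add_left)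
  show "?w \<in> H1 \<Omega>" by (rule jet_eqI[OF w wg])
  show "jet \<Omega> ?w = a *\<^sub>R jet \<Omega> u + b *\<^sub>R jet \<Omega> v"
    unfolding jet_eqI(2)[OF w wg] unfolding tw tg by (simp add: jet_def vec_eq_iff)
qed

lemma norm_jet: "u \<in> H1 \<Omega> \<Longrightarrow> norm (jet \<Omega> u) = norm_H1 \<Omega> u"
  using H1_grad[of u] inner_L2_vec[of "grad \<Omega> u" \<Omega> "grad \<Omega> u"]
  by (simp add: jet_def norm_Pair norm_H1_def norm_vec_power2 norm_to_l2[OF open_lebesgue]
      norm_L2_power2 L2_vec_iff)

lemma jet_test:
  assumes \<psi>: "\<psi> \<in> test_functions \<Omega>"
  shows "\<psi> \<in> H1 \<Omega>" "jet \<Omega> \<psi> = (to_l2 \<Omega> \<psi>, \<chi> i. to_l2 \<Omega> (pderiv_cl i \<psi>))"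
proof -
  have g: "(\<lambda>x. \<chi> i. pderiv_cl i \<psi> x) \<in> L2 \<Omega>" using test_L2[OF test_pderiv[OF \<psi>]] by (simp add: L2_vec_iff)
  have w: "is_weak_grad \<Omega> \<psi> (\<lambda>x. \<chi> i. pderiv_cl i \<psi> x)"
    unfolding is_weak_grad_iff[OF test_L2[OF \<psi>] g]
    using integration_by_parts[OF \<psi>] \<psi>
    by (simp add: inner_test test_pderiv test_differentiable continuous_pderiv_test)
  show "\<psi> \<in> H1 \<Omega>" by (rule jet_eqI[OF test_L2[OF \<psi>] g w])
  show "jet \<Omega> \<psi> = (to_l2 \<Omega> \<psi>, \<chi> i. to_l2 \<Omega> (pderiv_cl i \<psi>))"
    using jet_eqI(2)[OF test_L2[OF \<psi>] g w] by simp
qed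

lemma subspace_H10_jets: "subspace (H10_jets \<Omega>)"
  unfolding H10_jets_def
proof (rule subspace_closure, rule subspaceI)
  have "jet \<Omega> (\<lambda>x. 0 * 0 + 0 * 0) = 0 *\<^sub>R jet \<Omega> (\<lambda>x. 0) + 0 *\<^sub>R jet \<Omega> (\<lambda>x. 0)"
    by (rule jet_linear(2)) (rule jet_test[OF test_zero])+
  then show "0 \<in> jet \<Omega> ` test_functions \<Omega>" using test_zero by (force simp: image_iff)
next
  fix U V assume "U \<in> jet \<Omega> ` test_functions \<Omega>" "V \<in> jet \<Omega> ` test_functions \<Omega>"
  then obtain \<psi> \<eta> where "\<psi> \<in> test_functions \<Omega>" "U = jet \<Omega> \<psi>" "\<eta> \<in> test_functions \<Omega>" "V = jet \<Omega> \<eta>" by blast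
  then show "U + V \<in> jet \<Omega> ` test_functions \<Omega>"
    using jet_linear(2)[of \<psi> \<eta> 1 1] test_add[of \<psi> \<Omega> \<eta>]
        by (auto simp: jet_test image_iff intro!: bexI[of _ "\<lambda>x. \<psi> x + \<eta> x"])
next
  fix c U assume "U \<in> jet \<Omega> ` test_functions \<Omega>"
  then obtain \<psi> where "\<psi> \<in> test_functions \<Omega>" "U = jet \<Omega> \<psi>" by blast
  then show "c *\<^sub>R U \<in> jet \<Omega> ` test_functions \<Omega>"
    using jet_linear(2)[of \<psi> \<psi> c 0] test_scale[of \<psi> \<Omega> c] jet_test(1)[of \<psi>]
    by (auto simp: image_iff intro!: bexI[of _ "\<lambda>x. c * \<psi> x"])
qed

lemma closed_H10_jets: "closed (H10_jets \<Omega>)"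
  by (simp add: H10_jets_def)

lemma H10_iff: "u \<in> H10 \<Omega> \<longleftrightarrow> u \<in> H1 \<Omega> \<and> jet \<Omega> u \<in> H10_jets \<Omega>"
proof (cases "u \<in> H1 \<Omega>")
  case u: True
  have dist: "norm_H1 \<Omega> (\<lambda>x. u x - \<psi> x) = dist (jet \<Omega> u) (jet \<Omega> \<psi>)" if "\<psi> \<in> test_functions \<Omega>" for \<psi>
    using jet_linear[OF u jet_test(1)[OF that], of 1 "-1"] by (simp add: norm_jet[symmetric] dist_norm)
  have "u \<in> H10 \<Omega> \<longleftrightarrow> (\<exists>\<psi>. (\<forall>k. \<psi> k \<in> test_functions \<Omega>) \<and> (\<lambda>k. jet \<Omega> (\<psi> k)) \<longlonglongrightarrow> jet \<Omega> u)"
    using u dist by (auto simp: H10_def tendsto_dist_iff[of _ "jet \<Omega> u"] dist_commute)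
  also have "\<dots> \<longleftrightarrow> jet \<Omega> u \<in> H10_jets \<Omega>"
  proof
    assume "jet \<Omega> u \<in> H10_jets \<Omega>"
    then obtain f where f: "\<And>k. f k \<in> jet \<Omega> ` test_functions \<Omega>" "f \<longlonglongrightarrow> jet \<Omega> u"
      unfolding H10_jets_def closure_sequential by blast
    then have "\<forall>k. \<exists>\<psi>. \<psi> \<in> test_functions \<Omega> \<and> f k = jet \<Omega> \<psi>" by blast
    then obtain \<psi> where \<psi>: "\<And>k. \<psi> k \<in> test_functions \<Omega>" "\<And>k. f k = jet \<Omega> (\<psi> k)" by metis
    have "f = (\<lambda>k. jet \<Omega> (\<psi> k))" using \<psi>(2) by blast
    then show "\<exists>\<psi>. (\<forall>k. \<psi> k \<in> test_functions \<Omega>) \<and> (\<lambda>k. jet \<Omega> (\<psi> k)) \<longlonglongrightarrow> jet \<Omega> u"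
      using f(2) \<psi>(1) by blast
  next
    assume "\<exists>\<psi>. (\<forall>k. \<psi> k \<in> test_functions \<Omega>) \<and> (\<lambda>k. jet \<Omega> (\<psi> k)) \<longlonglongrightarrow> jet \<Omega> u"
    then obtain \<psi> where "\<And>k. \<psi> k \<in> test_functions \<Omega>" "(\<lambda>k. jet \<Omega> (\<psi> k)) \<longlonglongrightarrow> jet \<Omega> u" by blast
    then show "jet \<Omega> u \<in> H10_jets \<Omega>"
      unfolding H10_jets_def closure_sequential by (intro exI[of _ "\<lambda>k. jet \<Omega> (\<psi> k)"]) auto
  qed
  finally show ?thesis using u by simp
qed (simp add: H10_def)

text \<open>The density argument, as an induction principle.\<close>

lemma H10_jets_induct:
  assumes "w \<in> H10_jets \<Omega>" and "closed {w. P w}" and "\<And>\<psi>. \<psi> \<in> test_functions \<Omega> \<Longrightarrow> P (jet \<Omega> \<psi>)"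
  shows "P w"
proof -
  have "H10_jets \<Omega> \<subseteq> {w. P w}" unfolding H10_jets_def using assms by (intro closure_minimal) auto
  then show ?thesis using assms by blast
qed

lemma continuous_mul_indicator: "continuous_on A (mul_l2 (indicator \<Omega>))"
  by (intro linear_continuous_on bounded_linear_mul_l2[where B = 1] indicator_multiplier[OF open_lebesgue])

lemma H10_jets_restricted:
  assumes "w \<in> H10_jets \<Omega>"
  shows "mul_l2 (indicator \<Omega>) (fst w) = fst w" "mul_l2 (indicator \<Omega>) (snd w $ i) = snd w $ i"
proof -
  have c: "continuous_on UNIV (\<lambda>w. mul_l2 (indicator \<Omega>) (f w))" if "continuous_on UNIV f"
    for f :: "((real ^ 'd) l2, 'd) jets \<Rightarrow> (real ^ 'd) l2"
    using continuous_on_compose2[OF continuous_mul_indicator[of UNIV] that] by simp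
  show "mul_l2 (indicator \<Omega>) (fst w) = fst w"
    using assms
  proof (rule H10_jets_induct)
    show "closed {w :: ((real ^ 'd) l2, 'd) jets. mul_l2 (indicator \<Omega>) (fst w) = fst w}"
      by (intro closed_Collect_eq c continuous_intros)
  qed (simp add: jet_test mul_indicator_to_l2[OF open_lebesgue] test_L2)
  show "mul_l2 (indicator \<Omega>) (snd w $ i) = snd w $ i"
    using assms
  proof (rule H10_jets_induct)
    show "closed {w :: ((real ^ 'd) l2, 'd) jets. mul_l2 (indicator \<Omega>) (snd w $ i) = snd w $ i}"
      by (intro closed_Collect_eq c continuous_intros)
  qed (simp add: jet_test mul_indicator_to_l2[OF open_lebesgue] test_L2 test_pderiv)
qed

lemma H10_jets_weak_grad:
  assumes "w \<in> H10_jets \<Omega>" and \<psi>: "\<psi> \<in> test_functions \<Omega>"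
  shows "inner (fst w) (to_l2 \<Omega> (pderiv_cl i \<psi>)) = - inner (snd w $ i) (to_l2 \<Omega> \<psi>)"
  using assms(1)
proof (rule H10_jets_induct)
  show "closed {w. inner (fst w) (to_l2 \<Omega> (pderiv_cl i \<psi>)) = - inner (snd w $ i) (to_l2 \<Omega> \<psi>)}"
    by (intro closed_Collect_eq continuous_intros)
  fix \<eta> assume \<eta>: "\<eta> \<in> test_functions \<Omega>"
  then show "inner (fst (jet \<Omega> \<eta>)) (to_l2 \<Omega> (pderiv_cl i \<psi>)) = - inner (snd (jet \<Omega> \<eta>) $ i) (to_l2 \<Omega> \<psi>)"
    using integration_by_parts[OF \<eta> test_differentiable[OF \<psi>] continuous_pderiv_test[OF \<psi>], of i] \<psi>
    by (simp add: jet_test inner_test test_pderiv)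
qed

text \<open>Completeness of \<open>H\<^sup>1\<^sub>0(\<Omega>)\<close>: a limit of jets of test functions satisfies the tested relation
  between a function and its weak gradient, so it is itself the jet of a function.\<close>

lemma H10_jets_surj:
  assumes w: "w \<in> H10_jets \<Omega>"
  shows "\<exists>u\<in>H10 \<Omega>. jet \<Omega> u = w"
proof -
  note o = open_lebesgue and r = H10_jets_restricted[OF w]
  define u where "u = rep_l2 (fst w)"
  define g where "g x = (\<chi> i. rep_l2 (snd w $ i) x)" for x
  have u: "u \<in> L2 \<Omega>" "to_l2 \<Omega> u = fst w" unfolding u_def by (rule to_l2_surj[OF o r(1)])+
  have gi: "(\<lambda>x. g x $ i) \<in> L2 \<Omega>" "to_l2 \<Omega> (\<lambda>x. g x $ i) = snd w $ i" for i
    unfolding g_def using to_l2_surj[OF o r(2)] by auto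
  then have g: "g \<in> L2 \<Omega>" by (simp add: L2_vec_iff)
  have wg: "is_weak_grad \<Omega> u g"
    unfolding is_weak_grad_iff[OF u(1) g] using H10_jets_weak_grad[OF w] by (simp add: u gi)
  have "jet \<Omega> u = w" using jet_eqI(2)[OF u(1) g wg] by (simp add: u gi prod_eq_iff vec_eq_iff)
  then show ?thesis using jet_eqI(1)[OF u(1) g wg] w by (auto simp: H10_iff)
qed

lemma H10_jets_swap:
  assumes "v \<in> H10_jets \<Omega>" "w \<in> H10_jets \<Omega>"
  shows "inner (snd v $ i) (snd w $ j) = inner (snd v $ j) (snd w $ i)"
proof -
  have test: "inner (snd (jet \<Omega> \<psi>) $ i) (snd w $ j) = inner (snd (jet \<Omega> \<psi>) $ j) (snd w $ i)"
    if \<psi>: "\<psi> \<in> test_functions \<Omega>" for \<psi>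
    using assms(2)
  proof (rule H10_jets_induct)
    show "closed {w. inner (snd (jet \<Omega> \<psi>) $ i) (snd w $ j) = inner (snd (jet \<Omega> \<psi>) $ j) (snd w $ i)}"
      by (intro closed_Collect_eq continuous_intros)
    fix \<eta> assume "\<eta> \<in> test_functions \<Omega>"
    then show "inner (snd (jet \<Omega> \<psi>) $ i) (snd (jet \<Omega> \<eta>) $ j)
        = inner (snd (jet \<Omega> \<psi>) $ j) (snd (jet \<Omega> \<eta>) $ i)"
      using \<psi> integral_pderiv_swap[of \<psi> \<Omega> \<eta> i j] by (simp add: jet_test inner_test test_pderiv)
  qed
  show ?thesis
    using assms(1)
  proof (rule H10_jets_induct)
    show "closed {v. inner (snd v $ i) (snd w $ j) = inner (snd v $ j) (snd w $ i)}"
      by (intro closed_Collect_eq continuous_intros)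
  qed (rule test)
qed

lemma H10_jets_poincare:
  assumes R: "\<forall>x\<in>\<Omega>. norm x \<le> R" and w: "w \<in> H10_jets \<Omega>"
  shows "(norm (fst w))\<^sup>2 \<le> 4 * R\<^sup>2 * (norm (snd w))\<^sup>2"
proof -
  fix i :: 'd
  have "(norm (fst w))\<^sup>2 \<le> 4 * R\<^sup>2 * (norm (snd w $ i))\<^sup>2"
    using w
  proof (rule H10_jets_induct)
    show "closed {w :: ((real ^ 'd) l2, 'd) jets. (norm (fst w))\<^sup>2 \<le> 4 * R\<^sup>2 * (norm (snd w $ i))\<^sup>2}"
      by (intro closed_Collect_le continuous_intros)
    fix \<psi> assume \<psi>: "\<psi> \<in> test_functions \<Omega>"
    show "(norm (fst (jet \<Omega> \<psi>)))\<^sup>2 \<le> 4 * R\<^sup>2 * (norm (snd (jet \<Omega> \<psi>) $ i))\<^sup>2"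
      using poincare_test[OF \<psi> R, of i] inner_test[OF \<psi> \<psi>] inner_test[OF test_pderiv[OF \<psi>]
          test_pderiv[OF \<psi>], of i i]
      unfolding power2_norm_eq_inner by (simp add: jet_test[OF \<psi>] power2_eq_square)
  qed
  also have "\<dots> \<le> 4 * R\<^sup>2 * (norm (snd w))\<^sup>2"
    by (intro mult_left_mono power_mono Finite_Cartesian_Product.norm_nth_le) auto
  finally show ?thesis .
qed

end

section \<open>The bilinear forms on jets\<close>

definition vec_jet :: "(real ^ 'd) set \<Rightarrow> (real ^ 'd \<Rightarrow> real ^ 'd) \<Rightarrow> ((real ^ 'd) l2, 'd) jets ^ 'd" where
  "vec_jet \<Omega> d = (\<chi> i. jet \<Omega> (\<lambda>x. d x $ i))"

definition div_jet :: "((real ^ 'd) l2, 'd) jets ^ 'd \<Rightarrow> (real ^ 'd) l2" where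
  "div_jet x = (\<Sum>i\<in>UNIV. snd (x $ i) $ i)"

definition strain_jet :: "((real ^ 'd) l2, 'd) jets ^ 'd \<Rightarrow> 'd \<Rightarrow> 'd \<Rightarrow> (real ^ 'd) l2" where
  "strain_jet x i j = (1/2) *\<^sub>R (snd (x $ i) $ j + snd (x $ j) $ i)"

definition elastic_form :: "real \<Rightarrow> real ^ 'd ^ 'd ^ 'd ^ 'd \<Rightarrow> ((real ^ 'd) l2, 'd) jets ^ 'd \<Rightarrow>
    ((real ^ 'd) l2, 'd) jets ^ 'd \<Rightarrow> real" where
  "elastic_form r H x y = r * (\<Sum>i\<in>UNIV. inner (fst (x $ i)) (fst (y $ i)))
    + (\<Sum>i\<in>UNIV. \<Sum>j\<in>UNIV. inner (\<Sum>k\<in>UNIV. \<Sum>l\<in>UNIV. (H $ i $ j $ k $ l) *\<^sub>R strain_jet x k l)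
        (strain_jet y i j))"

text \<open>The entries of the permeability tensor, truncated to make them bounded multipliers everywhere;
    the tensor is
  bounded only almost everywhere in the domain.\<close>

definition cut_entry :: "(real ^ 'd) set \<Rightarrow> (real ^ 'd \<Rightarrow> real ^ 'd ^ 'd) \<Rightarrow> real \<Rightarrow> 'd \<Rightarrow> 'd \<Rightarrow> real ^ 'd
    \<Rightarrow> real" where
  "cut_entry \<Omega> K B i j x = (if x \<in> \<Omega> \<and> \<bar>K x $ i $ j\<bar> \<le> B then K x $ i $ j else 0)"

definition diffusion_form :: "(real ^ 'd) set \<Rightarrow> real \<Rightarrow> (real ^ 'd \<Rightarrow> real ^ 'd ^ 'd) \<Rightarrow> real \<Rightarrow> ((real
    ^ 'd) l2, 'd) jets \<Rightarrow> ((real ^ 'd) l2, 'd) jets \<Rightarrow> real" where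
  "diffusion_form \<Omega> t K B v w = t * (\<Sum>i\<in>UNIV. inner (\<Sum>j\<in>UNIV. mul_l2 (cut_entry \<Omega> K B i j) (snd v $
      j)) (snd w $ i))"

lemma bounded_linear_jet_component:
  "bounded_linear (\<lambda>x :: ((real ^ 'd) l2, 'd) jets ^ 'd. fst (x $ i))"
      "bounded_linear (\<lambda>x :: ((real ^ 'd) l2, 'd) jets ^ 'd. snd (x $ i) $ j)"
  by (intro bounded_linear_compose[OF bounded_linear_fst bounded_linear_vec_nth]
      bounded_linear_compose[OF bounded_linear_vec_nth]
      bounded_linear_compose[OF bounded_linear_snd bounded_linear_vec_nth])+

lemma bounded_linear_div_jet: "bounded_linear div_jet"
  unfolding div_jet_def[abs_def] by (intro bounded_linear_sum bounded_linear_jet_component)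

lemma bounded_linear_strain_jet: "bounded_linear (\<lambda>x. strain_jet x i j)"
  unfolding strain_jet_def
  by (intro bounded_linear_compose[OF bounded_linear_scaleR_right] bounded_linear_add
      bounded_linear_jet_component)

lemma bounded_bilinear_elastic_form: "bounded_bilinear (elastic_form r H)"
  unfolding elastic_form_def[abs_def]
  by (intro bounded_bilinear_add bounded_bilinear_const_mult bounded_bilinear_sum
      bounded_bilinear_inner_comp
      bounded_linear_jet_component bounded_linear_strain_jet bounded_linear_sum
      bounded_linear_compose[OF bounded_linear_scaleR_right])

lemma norm_div_jet: "norm (div_jet x) \<le> real CARD('d) * norm (x :: ((real ^ 'd) l2, 'd) jets ^ 'd)"
proof -
  have "norm (snd (x $ i) $ i) \<le> norm x" for i
    using Finite_Cartesian_Product.norm_nth_le[of "snd (x $ i)" i] norm_snd_le[of "snd (x $ i)"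
        "fst (x $ i)"]
      Finite_Cartesian_Product.norm_nth_le[of x i] by simp
  then have "(\<Sum>i\<in>(UNIV :: 'd set). norm (snd (x $ i) $ i)) \<le> real CARD('d) * norm x"
    by (rule order_trans[OF sum_mono]) auto
  then show ?thesis unfolding div_jet_def by (rule order_trans[OF norm_sum])
qed

lemma norm_jet1_power2: "(norm (w :: ((real ^ 'd) l2, 'd) jets))\<^sup>2 = (norm (fst w))\<^sup>2 + (norm (snd w))\<^sup>2"
  by (cases w) (simp add: norm_Pair)

context
  fixes \<Omega> :: "(real ^ 'd) set"
  assumes open_\<Omega>: "open \<Omega>"
begin

text \<open>Korn's first inequality. The norm of the strain contains the products
  \<open>(\<partial>\<^sub>j d\<^sub>i, \<partial>\<^sub>i d\<^sub>j)\<close>. By \<open>H10_jets_swap\<close> they equal \<open>(\<partial>\<^sub>i d\<^sub>i, \<partial>\<^sub>j d\<^sub>j)\<close>, and these add up to the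
  squared norm of the divergence, which is nonnegative.\<close>

lemma korn:
  assumes x: "\<And>i. x $ i \<in> H10_jets \<Omega>"
  shows "(\<Sum>i\<in>UNIV. (norm (snd (x $ i)))\<^sup>2) \<le> 2 * (\<Sum>i\<in>UNIV. \<Sum>j\<in>UNIV. (norm (strain_jet x i j))\<^sup>2)"
proof -
  define a where "a i j = snd (x $ i) $ j" for i j
  have swap: "inner (a i j) (a j i) = inner (a i i) (a j j)" for i j
    unfolding a_def using H10_jets_swap[OF open_\<Omega> x x, of i j j i] by simp
  have cross: "(\<Sum>i\<in>UNIV. \<Sum>j\<in>UNIV. inner (a i j) (a j i)) = inner (div_jet x) (div_jet x)"
    unfolding swap by (simp add: div_jet_def a_def inner_sum_left inner_sum_right) (rule sum.swap)
  have "4 * (norm (strain_jet x i j))\<^sup>2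
      = (norm (a i j))\<^sup>2 + (norm (a j i))\<^sup>2 + 2 * inner (a i j) (a j i)" for i j
    unfolding power2_norm_eq_inner strain_jet_def a_def
    by (simp add: inner_simps inner_commute)
  then have "4 * (\<Sum>i\<in>UNIV. \<Sum>j\<in>UNIV. (norm (strain_jet x i j))\<^sup>2)
      = (\<Sum>i\<in>UNIV. \<Sum>j\<in>UNIV. (norm (a i j))\<^sup>2) + (\<Sum>i\<in>UNIV. \<Sum>j\<in>UNIV. (norm (a j i))\<^sup>2)
        + 2 * (\<Sum>i\<in>UNIV. \<Sum>j\<in>UNIV. inner (a i j) (a j i))"
    by (simp add: sum_distrib_left sum.distrib)
  also have "(\<Sum>i\<in>UNIV. \<Sum>j\<in>UNIV. (norm (a j i))\<^sup>2) = (\<Sum>i\<in>UNIV. \<Sum>j\<in>UNIV. (norm (a i j))\<^sup>2)"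
    by (rule sum.swap)
  finally have "4 * (\<Sum>i\<in>UNIV. \<Sum>j\<in>UNIV. (norm (strain_jet x i j))\<^sup>2)
      = 2 * (\<Sum>i\<in>UNIV. \<Sum>j\<in>UNIV. (norm (a i j))\<^sup>2) + 2 * inner (div_jet x) (div_jet x)"
    by (simp add: cross)
  moreover have "0 \<le> inner (div_jet x) (div_jet x)" by simp
  moreover have "(\<Sum>i\<in>UNIV. (norm (snd (x $ i)))\<^sup>2) = (\<Sum>i\<in>UNIV. \<Sum>j\<in>UNIV. (norm (a i j))\<^sup>2)"
    by (simp add: norm_vec_power2 a_def)
  ultimately show ?thesis by linarith
qed

lemma H10_L2: "u \<in> H10 \<Omega> \<Longrightarrow> u \<in> L2 \<Omega>" "u \<in> H10 \<Omega> \<Longrightarrow> grad \<Omega> u \<in> L2 \<Omega>"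
  using H1_grad[OF open_\<Omega>] by (auto simp: H10_def)

lemma H10_grad_component: "u \<in> H10 \<Omega> \<Longrightarrow> (\<lambda>x. grad \<Omega> u x $ i) \<in> L2 \<Omega>"
  using H10_L2(2) by (auto simp: L2_vec_iff)

lemma jet_simps: "fst (jet \<Omega> u) = to_l2 \<Omega> u" "snd (jet \<Omega> u) $ i = to_l2 \<Omega> (\<lambda>x. grad \<Omega> u x $ i)"
  by (simp_all add: jet_def)

lemma H10_vec_L2: "d \<in> H10_vec \<Omega> \<Longrightarrow> d \<in> L2 \<Omega>"
  by (auto simp: L2_vec_iff H10_vec_def H10_L2)

lemma inner_L2_vec_field:
  assumes "d \<in> L2 \<Omega>" "d' \<in> L2 \<Omega>"
  shows "inner_L2 \<Omega> d d' = (\<Sum>i\<in>(UNIV :: 'd set). inner (to_l2 \<Omega> (\<lambda>x. d x $ i)) (to_l2 \<Omega> (\<lambda>x. d' x $ i)))"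
  using assms inner_L2_vec[OF assms] by (simp add: inner_to_l2[OF open_lebesgue[OF open_\<Omega>]] L2_vec_iff)

lemma inner_L2_mat_field:
  fixes S T :: "real ^ 'd \<Rightarrow> real ^ 'd ^ 'd"
  assumes "S \<in> L2 \<Omega>" "T \<in> L2 \<Omega>"
  shows "inner_L2 \<Omega> S T = (\<Sum>i\<in>UNIV. \<Sum>j\<in>UNIV. inner (to_l2 \<Omega> (\<lambda>x. S x $ i $ j)) (to_l2 \<Omega> (\<lambda>x. T x $ i $ j)))"
  using assms inner_L2_vec[OF assms] by (simp add: inner_L2_vec_field L2_vec_iff[of S] L2_vec_iff[of T])

lemma strain_component: "strain \<Omega> d x $ i $ j
    = (1/2) * (grad \<Omega> (\<lambda>y. d y $ i) x $ j + grad \<Omega> (\<lambda>y. d y $ j) x $ i)"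
  by (simp add: strain_def grad_vec_def transpose_def)

lemma strain_L2:
  assumes "d \<in> H10_vec \<Omega>"
  shows "(\<lambda>x. strain \<Omega> d x $ i $ j) \<in> L2 \<Omega>"
      "to_l2 \<Omega> (\<lambda>x. strain \<Omega> d x $ i $ j) = strain_jet (vec_jet \<Omega> d) i j"
    "strain \<Omega> d \<in> L2 \<Omega>"
proof -
  have g: "(\<lambda>x. grad \<Omega> (\<lambda>y. d y $ i) x $ j) \<in> L2 \<Omega>" for i j
    using assms by (intro H10_grad_component) (simp add: H10_vec_def)
  show *: "(\<lambda>x. strain \<Omega> d x $ i $ j) \<in> L2 \<Omega>" for i j
    unfolding strain_component by (intro L2_scale[OF open_lebesgue[OF open_\<Omega>]] L2_add[OF
        open_lebesgue[OF open_\<Omega>]] g)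
  show "to_l2 \<Omega> (\<lambda>x. strain \<Omega> d x $ i $ j) = strain_jet (vec_jet \<Omega> d) i j"
    unfolding strain_component strain_jet_def vec_jet_def
    by (simp only: to_l2_scale[OF open_lebesgue[OF open_\<Omega>] L2_add[OF open_lebesgue[OF open_\<Omega>] g g]]
        to_l2_add[OF open_lebesgue[OF open_\<Omega>] g g] jet_simps vec_lambda_beta)
  show "strain \<Omega> d \<in> L2 \<Omega>" unfolding L2_vec_iff using * by blast
qed

lemma tensor_L2:
  assumes "d \<in> H10_vec \<Omega>"
  shows "(\<lambda>x. tensor_apply H (strain \<Omega> d x)) \<in> L2 \<Omega>"
    "to_l2 \<Omega> (\<lambda>x. tensor_apply H (strain \<Omega> d x) $ i $ j)
      = (\<Sum>k\<in>UNIV. \<Sum>l\<in>UNIV. (H $ i $ j $ k $ l) *\<^sub>R strain_jet (vec_jet \<Omega> d) k l)"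
proof -
  note s = strain_L2(1)[OF assms]
  show "(\<lambda>x. tensor_apply H (strain \<Omega> d x)) \<in> L2 \<Omega>"
    unfolding L2_vec_iff tensor_apply_def
    by (auto intro!: L2_sum[OF open_lebesgue[OF open_\<Omega>]] L2_scale[OF open_lebesgue[OF open_\<Omega>]] s)
  show "to_l2 \<Omega> (\<lambda>x. tensor_apply H (strain \<Omega> d x) $ i $ j)
      = (\<Sum>k\<in>UNIV. \<Sum>l\<in>UNIV. (H $ i $ j $ k $ l) *\<^sub>R strain_jet (vec_jet \<Omega> d) k l)"
    by (simp add: tensor_apply_def to_l2_sum[OF open_lebesgue[OF open_\<Omega>]] L2_sum[OF open_lebesgue[OF
        open_\<Omega>]] L2_scale[OF open_lebesgue[OF open_\<Omega>]] s to_l2_scale[OF open_lebesgue[OF open_\<Omega>]]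
        strain_L2(2)[OF assms])
qed

lemma elastic_form_vec_jet:
  assumes d: "d \<in> H10_vec \<Omega>" and d': "d' \<in> H10_vec \<Omega>"
  shows "elastic_form r H (vec_jet \<Omega> d) (vec_jet \<Omega> d')
    = r * inner_L2 \<Omega> d d' + inner_L2 \<Omega> (\<lambda>x. tensor_apply H (strain \<Omega> d x)) (strain \<Omega> d')"
  unfolding elastic_form_def inner_L2_vec_field[OF H10_vec_L2[OF d] H10_vec_L2[OF d']]
    inner_L2_mat_field[OF tensor_L2(1)[OF d] strain_L2(3)[OF d']] tensor_L2(2)[OF d] strain_L2(2)[OF d']
  by (simp add: vec_jet_def jet_simps)

lemma dvg_L2:
  assumes "d \<in> H10_vec \<Omega>"
  shows "dvg \<Omega> d \<in> L2 \<Omega>" "to_l2 \<Omega> (dvg \<Omega> d) = div_jet (vec_jet \<Omega> d)"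
proof -
  have g: "(\<lambda>x. grad \<Omega> (\<lambda>y. d y $ i) x $ j) \<in> L2 \<Omega>" for i j
    using assms by (intro H10_grad_component) (simp add: H10_vec_def)
  have e: "dvg \<Omega> d = (\<lambda>x. \<Sum>i\<in>UNIV. grad \<Omega> (\<lambda>y. d y $ i) x $ i)"
    by (simp add: fun_eq_iff dvg_def trace_def grad_vec_def)
  show "dvg \<Omega> d \<in> L2 \<Omega>" unfolding e by (intro L2_sum[OF open_lebesgue[OF open_\<Omega>]] g)
  show "to_l2 \<Omega> (dvg \<Omega> d) = div_jet (vec_jet \<Omega> d)"
    unfolding e by (simp add: to_l2_sum[OF open_lebesgue[OF open_\<Omega>]] g div_jet_def vec_jet_def jet_simps)
qed

lemma vec_jet_surj:
  assumes "\<And>i. x $ i \<in> H10_jets \<Omega>"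
  shows "\<exists>d\<in>H10_vec \<Omega>. vec_jet \<Omega> d = x"
proof -
  have "\<forall>i. \<exists>u. u \<in> H10 \<Omega> \<and> jet \<Omega> u = x $ i" using H10_jets_surj[OF open_\<Omega> assms] by blast
  then obtain u where u: "\<And>i. u i \<in> H10 \<Omega>" "\<And>i. jet \<Omega> (u i) = x $ i" by metis
  show ?thesis
    by (rule bexI[of _ "\<lambda>y. \<chi> i. u i y"]) (auto simp: vec_jet_def vec_eq_iff u H10_vec_def)
qed

lemma vec_jet_H10: "d \<in> H10_vec \<Omega> \<Longrightarrow> vec_jet \<Omega> d $ i \<in> H10_jets \<Omega>"
  by (simp add: vec_jet_def H10_vec_def H10_iff[OF open_\<Omega>])

lemma div_jet_restricted:
  assumes "\<And>i. x $ i \<in> H10_jets \<Omega>"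
  shows "mul_l2 (indicator \<Omega>) (div_jet x) = div_jet x"
proof -
  obtain d where "d \<in> H10_vec \<Omega>" "vec_jet \<Omega> d = x" using vec_jet_surj[OF assms] by blast
  then show ?thesis using mul_indicator_to_l2[OF open_lebesgue[OF open_\<Omega>] dvg_L2(1)] dvg_L2(2) by metis
qed

lemma norm_vec_jet: "d \<in> H10_vec \<Omega> \<Longrightarrow> norm (vec_jet \<Omega> d) = norm_H1_vec \<Omega> d"
proof -
  assume d: "d \<in> H10_vec \<Omega>"
  have g: "(\<lambda>x. grad \<Omega> (\<lambda>y. d y $ i) x $ j) \<in> L2 \<Omega>" for i j
    using d by (intro H10_grad_component) (simp add: H10_vec_def)
  have gv: "grad_vec \<Omega> d \<in> L2 \<Omega>" unfolding L2_vec_iff grad_vec_def using g by simp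
  have "(norm (vec_jet \<Omega> d))\<^sup>2 = (norm_L2 \<Omega> d)\<^sup>2 + (norm_L2 \<Omega> (grad_vec \<Omega> d))\<^sup>2"
    unfolding norm_L2_power2 inner_L2_vec_field[OF H10_vec_L2[OF d] H10_vec_L2[OF d]]
        inner_L2_mat_field[OF gv gv]
    by (simp add: norm_vec_power2[of "vec_jet \<Omega> d"] vec_jet_def norm_jet1_power2 jet_simps norm_vec_power2
        power2_norm_eq_inner sum.distrib grad_vec_def inner_vec_def)
  then show ?thesis unfolding norm_H1_vec_def by (metis norm_ge_zero real_sqrt_unique)
qed

end

section \<open>Coercivity\<close>

lemma square_integrable_cong_AE:
  assumes "square_integrable u" "AE x in lebesgue. u x = v x"
  shows "square_integrable v"
proof -
  have v: "v \<in> borel_measurable lebesgue"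
    using borel_measurable_AE[OF square_integrable_measurable[OF assms(1)] assms(2)] .
  have "integrable lebesgue (\<lambda>x. (v x)\<^sup>2)"
    by (rule integrable_cong_AE_imp[of _ "\<lambda>x. (u x)\<^sup>2"])
      (use assms v in \<open>auto simp: square_integrable_def intro!: borel_measurable_power\<close>)
  then show ?thesis using v by (simp add: square_integrable_def)
qed

text \<open>Polarization with the basis vectors \<open>e\<^sub>i\<close> and \<open>e\<^sub>j\<close>.\<close>

lemma symmetric_entry_bound:
  fixes A :: "real ^ 'd ^ 'd"
  assumes sym: "transpose A = A"
    and bnd: "\<And>\<xi>. 0 \<le> \<xi> \<bullet> (A *v \<xi>)" "\<And>\<xi>. \<xi> \<bullet> (A *v \<xi>) \<le> c * (norm \<xi>)\<^sup>2"
  shows "\<bar>A $ i $ j\<bar> \<le> 2 * c"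
proof -
  let ?e = "\<lambda>i. axis i (1 :: real) :: real ^ 'd"
  have ent: "?e i \<bullet> (A *v ?e j) = A $ i $ j" for i j
    by (simp add: inner_axis' matrix_vector_mult_basis column_def)
  have s: "A $ j $ i = A $ i $ j" using arg_cong[OF sym, of "\<lambda>M. M $ i $ j"] by (simp add: transpose_def)
  have "(norm (?e i + ?e j))\<^sup>2 \<le> 2\<^sup>2"
    using norm_triangle_ineq[of "?e i" "?e j"] by (intro power_mono) (auto simp: norm_axis_1)
  moreover have c: "0 \<le> c" using bnd[of "?e i"] by (simp add: norm_axis_1)
  ultimately have "c * (norm (?e i + ?e j))\<^sup>2 \<le> c * 2\<^sup>2" by (intro mult_left_mono)
  moreover have "(?e i + ?e j) \<bullet> (A *v (?e i + ?e j)) = A $ i $ i + 2 * A $ i $ j + A $ j $ j"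
    by (simp add: matrix_vector_right_distrib inner_simps ent s)
  moreover have "0 \<le> A $ i $ i" "A $ i $ i \<le> c" "0 \<le> A $ j $ j" "A $ j $ j \<le> c"
    using bnd[of "?e i"] bnd[of "?e j"] by (auto simp: ent norm_axis_1)
  ultimately show ?thesis using bnd[of "?e i + ?e j"] by (simp add: abs_le_iff)
qed

context
  fixes \<Omega> :: "(real ^ 'd) set" and K :: "real ^ 'd \<Rightarrow> real ^ 'd ^ 'd" and kmin kmax :: real
  assumes open_\<Omega>: "open \<Omega>" and K: "permeability_tensor \<Omega> K kmin kmax"
begin

lemma K_AE: "AE x in lebesgue. x \<in> \<Omega> \<longrightarrow> \<bar>K x $ i $ j\<bar> \<le> 2 * kmax"
proof -
  have "AE x in lebesgue_on \<Omega>. transpose (K x) = K x \<and>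
      (\<forall>\<xi>. kmin * (norm \<xi>)\<^sup>2 \<le> \<xi> \<bullet> (K x *v \<xi>) \<and> \<xi> \<bullet> (K x *v \<xi>) \<le> kmax * (norm \<xi>)\<^sup>2)"
    using K by (simp add: permeability_tensor_def)
  then have "AE x in lebesgue_on \<Omega>. \<bar>K x $ i $ j\<bar> \<le> 2 * kmax"
  proof (rule AE_mp[OF _ AE_I2], intro impI)
    fix x assume *: "transpose (K x) = K x \<and>
      (\<forall>\<xi>. kmin * (norm \<xi>)\<^sup>2 \<le> \<xi> \<bullet> (K x *v \<xi>) \<and> \<xi> \<bullet> (K x *v \<xi>) \<le> kmax * (norm \<xi>)\<^sup>2)"
    have "0 \<le> kmin * (norm \<xi>)\<^sup>2" for \<xi> :: "real ^ 'd" using K by (simp add: permeability_tensor_def)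
    then show "\<bar>K x $ i $ j\<bar> \<le> 2 * kmax" using * by (intro symmetric_entry_bound) (auto intro: order_trans)
  qed
  then show ?thesis using open_lebesgue[OF open_\<Omega>] by (simp add: AE_restrict_space_iff)
qed

lemma entry_multiplier: "cut_entry \<Omega> K (2 * kmax) i j \<in> borel_measurable lebesgue"
    "\<bar>cut_entry \<Omega> K (2 * kmax) i j x\<bar> \<le> 2 * kmax"
proof -
  have "K \<in> borel_measurable (lebesgue_on \<Omega>)" using K by (simp add: permeability_tensor_def)
  then have "(\<lambda>x. K x $ i) \<in> borel_measurable (lebesgue_on \<Omega>)"
    by (rule borel_measurable_vec_iff[THEN iffD1, rule_format])
  then have "(\<lambda>x. K x $ i $ j) \<in> borel_measurable (lebesgue_on \<Omega>)"
    by (rule borel_measurable_vec_iff[THEN iffD1, rule_format])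
  then have m: "(\<lambda>x. if x \<in> \<Omega> then K x $ i $ j else 0) \<in> borel_measurable lebesgue"
    by (rule borel_measurable_if[OF open_lebesgue[OF open_\<Omega>], THEN iffD2])
  have "cut_entry \<Omega> K (2 * kmax) i j = (\<lambda>x. (if x \<in> \<Omega> then K x $ i $ j else 0) * indicator {- (2 *
      kmax)..2 * kmax} (if x \<in> \<Omega> then K x $ i $ j else 0))"
    by (auto simp: cut_entry_def fun_eq_iff indicator_def abs_le_iff)
  also have "\<dots> \<in> borel_measurable lebesgue"
    by (intro borel_measurable_times m measurable_compose[OF m]) auto
  finally show "cut_entry \<Omega> K (2 * kmax) i j \<in> borel_measurable lebesgue" .
  show "\<bar>cut_entry \<Omega> K (2 * kmax) i j x\<bar> \<le> 2 * kmax"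
    using K by (simp add: cut_entry_def permeability_tensor_def)
qed

lemma mul_entry:
  assumes u: "u \<in> L2 \<Omega>"
  shows "(\<lambda>x. K x $ i $ j * u x) \<in> L2 \<Omega>"
    "to_l2 \<Omega> (\<lambda>x. K x $ i $ j * u x) = mul_l2 (cut_entry \<Omega> K (2 * kmax) i j) (to_l2 \<Omega> u)"
proof -
  have iu: "square_integrable (\<lambda>x. indicator \<Omega> x * u x)" using u
      by (simp add: L2_real_iff[OF open_lebesgue[OF open_\<Omega>]])
  note s = bounded_multiplier_square_integrable[OF entry_multiplier iu, of i j]
  have ae: "AE x in lebesgue. cut_entry \<Omega> K (2 * kmax) i j x * (indicator \<Omega> x * u x)
      = indicator \<Omega> x * (K x $ i $ j * u x)"
    using K_AE[of i j] by eventually_elim (auto simp: cut_entry_def indicator_def)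
  have s': "square_integrable (\<lambda>x. indicator \<Omega> x * (K x $ i $ j * u x))"
    by (rule square_integrable_cong_AE[OF s ae])
  then show "(\<lambda>x. K x $ i $ j * u x) \<in> L2 \<Omega>" by (simp add: L2_real_iff[OF open_lebesgue[OF open_\<Omega>]])
  show "to_l2 \<Omega> (\<lambda>x. K x $ i $ j * u x) = mul_l2 (cut_entry \<Omega> K (2 * kmax) i j) (to_l2 \<Omega> u)"
    unfolding to_l2_def mul_abs_l2[OF entry_multiplier iu] using ae
    by (subst abs_l2_eq_iff[OF s' s]) (auto elim: AE_mp)
qed

lemma bounded_bilinear_diffusion_form: "bounded_bilinear (diffusion_form \<Omega> t K (2 * kmax))"
proof -
  have "bounded_linear (\<lambda>v :: ((real ^ 'd) l2, 'd) jets. snd v $ i)" for i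
    by (intro bounded_linear_compose[OF bounded_linear_vec_nth bounded_linear_snd])
  then show ?thesis
    unfolding diffusion_form_def[abs_def]
    by (intro bounded_bilinear_const_mult bounded_bilinear_sum bounded_bilinear_inner_comp
        bounded_linear_sum
        bounded_linear_compose[OF bounded_linear_mul_l2[OF entry_multiplier]])
qed

lemma K_grad_L2:
  assumes "u \<in> H10 \<Omega>"
  shows "(\<lambda>x. K x *v grad \<Omega> u x) \<in> L2 \<Omega>"
    "to_l2 \<Omega> (\<lambda>x. (K x *v grad \<Omega> u x) $ i)
        = (\<Sum>j\<in>UNIV. mul_l2 (cut_entry \<Omega> K (2 * kmax) i j) (snd (jet \<Omega> u) $ j))"
proof -
  note g = H10_grad_component[OF open_\<Omega> assms]
  have e: "(K x *v grad \<Omega> u x) $ i = (\<Sum>j\<in>UNIV. K x $ i $ j * grad \<Omega> u x $ j)" for x i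
    by (simp add: matrix_vector_mult_def)
  show "(\<lambda>x. K x *v grad \<Omega> u x) \<in> L2 \<Omega>"
    unfolding L2_vec_iff e by (intro allI L2_sum[OF open_lebesgue[OF open_\<Omega>]] mul_entry g)
  show "to_l2 \<Omega> (\<lambda>x. (K x *v grad \<Omega> u x) $ i)
      = (\<Sum>j\<in>UNIV. mul_l2 (cut_entry \<Omega> K (2 * kmax) i j) (snd (jet \<Omega> u) $ j))"
    unfolding e by (simp add: to_l2_sum[OF open_lebesgue[OF open_\<Omega>]] mul_entry g jet_simps[OF open_\<Omega>])
qed

lemma diffusion_form_jet:
  assumes "u \<in> H10 \<Omega>" "v \<in> H10 \<Omega>"
  shows "diffusion_form \<Omega> t K (2 * kmax) (jet \<Omega> u) (jet \<Omega> v)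
      = t * inner_L2 \<Omega> (\<lambda>x. K x *v grad \<Omega> u x) (grad \<Omega> v)"
  unfolding diffusion_form_def
    inner_L2_vec_field[OF open_\<Omega> K_grad_L2(1)[OF assms(1)] H10_L2(2)[OF open_\<Omega> assms(2)]]
        K_grad_L2(2)[OF assms(1)]
  by (simp add: jet_simps[OF open_\<Omega>])

lemma norm_grad_jet:
  assumes "u \<in> H10 \<Omega>"
  shows "(norm (snd (jet \<Omega> u)))\<^sup>2 = inner_L2 \<Omega> (grad \<Omega> u) (grad \<Omega> u)"
  unfolding inner_L2_vec_field[OF open_\<Omega> H10_L2(2)[OF open_\<Omega> assms] H10_L2(2)[OF open_\<Omega> assms]]
  by (simp add: norm_vec_power2 power2_norm_eq_inner jet_simps[OF open_\<Omega>])

lemma diffusion_form_coercive: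
  assumes v: "v \<in> H10_jets \<Omega>" and t: "0 \<le> t"
  shows "t * kmin * (norm (snd v))\<^sup>2 \<le> diffusion_form \<Omega> t K (2 * kmax) v v"
proof -
  obtain u where u: "u \<in> H10 \<Omega>" "jet \<Omega> u = v" using H10_jets_surj[OF open_\<Omega> v] by blast
  note g = H10_L2(2)[OF open_\<Omega> u(1)]
  have "AE x in lebesgue_on \<Omega>. transpose (K x) = K x \<and>
      (\<forall>\<xi>. kmin * (norm \<xi>)\<^sup>2 \<le> \<xi> \<bullet> (K x *v \<xi>) \<and> \<xi> \<bullet> (K x *v \<xi>) \<le> kmax * (norm \<xi>)\<^sup>2)"
    using K by (simp add: permeability_tensor_def)
  then have "AE x in lebesgue_on \<Omega>. kmin * (grad \<Omega> u x \<bullet> grad \<Omega> u x) \<le> (K x *v grad \<Omega> u x) \<bullet> grad \<Omega> u x"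
    by (rule AE_mp) (auto intro!: AE_I2 simp: power2_norm_eq_inner inner_commute)
  then have "(\<integral>x. kmin * (grad \<Omega> u x \<bullet> grad \<Omega> u x) \<partial>lebesgue_on \<Omega>)
      \<le> (\<integral>x. (K x *v grad \<Omega> u x) \<bullet> grad \<Omega> u x \<partial>lebesgue_on \<Omega>)"
    by (intro integral_mono_AE L2_inner_integrable integrable_mult_right K_grad_L2 u g)
  then have "kmin * inner_L2 \<Omega> (grad \<Omega> u) (grad \<Omega> u) \<le> inner_L2 \<Omega> (\<lambda>x. K x *v grad \<Omega> u x) (grad \<Omega> u)"
    by (simp add: inner_L2_def)
  then have "t * (kmin * (norm (snd v))\<^sup>2) \<le> t * inner_L2 \<Omega> (\<lambda>x. K x *v grad \<Omega> u x) (grad \<Omega> u)"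
    using t unfolding u(2)[symmetric] norm_grad_jet[OF u(1)] by (rule mult_left_mono)
  then show ?thesis using diffusion_form_jet[OF u(1) u(1)] by (simp add: u(2) mult.assoc)
qed

end

text \<open>The strain is symmetric at every point, so the bound on the Hooke tensor may be integrated;
  Korn's inequality replaces the strain by the gradient at the cost of the factor \<open>1/2\<close>.\<close>

lemma elastic_form_coercive:
  fixes \<Omega> :: "(real ^ 'd) set"
  assumes open_\<Omega>: "open \<Omega>" and H: "hooke_tensor H cmin cmax" and x: "\<And>i. x $ i \<in> H10_jets \<Omega>"
    and a: "0 \<le> a" "a \<le> r" "a \<le> cmin"
  shows "a / 2 * (norm x)\<^sup>2 \<le> elastic_form r H x x"
proof -
  obtain d where d: "d \<in> H10_vec \<Omega>" "vec_jet \<Omega> d = x" using vec_jet_surj[OF open_\<Omega> x] by blast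
  note S = strain_L2(3)[OF open_\<Omega> d(1)]
  have "(\<integral>x. cmin * (strain \<Omega> d x \<bullet> strain \<Omega> d x) \<partial>lebesgue_on \<Omega>)
      \<le> (\<integral>x. tensor_apply H (strain \<Omega> d x) \<bullet> strain \<Omega> d x \<partial>lebesgue_on \<Omega>)"
  proof (intro integral_mono L2_inner_integrable integrable_mult_right tensor_L2[OF open_\<Omega>] d S)
    fix x
    have "transpose (strain \<Omega> d x) = strain \<Omega> d x"
      by (simp add: vec_eq_iff transpose_def strain_component[OF open_\<Omega>])
    then show "cmin * (strain \<Omega> d x \<bullet> strain \<Omega> d x) \<le> tensor_apply H (strain \<Omega> d x) \<bullet> strain \<Omega> d x"
      using H by (simp add: hooke_tensor_def power2_norm_eq_inner inner_commute)
  qed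
  then have "cmin * inner_L2 \<Omega> (strain \<Omega> d) (strain \<Omega> d)
      \<le> inner_L2 \<Omega> (\<lambda>x. tensor_apply H (strain \<Omega> d x)) (strain \<Omega> d)"
    by (simp add: inner_L2_def)
  moreover have "inner_L2 \<Omega> (strain \<Omega> d) (strain \<Omega> d) = (\<Sum>i\<in>UNIV. \<Sum>j\<in>UNIV. (norm (strain_jet x i j))\<^sup>2)"
    unfolding inner_L2_mat_field[OF open_\<Omega> S S] strain_L2(2)[OF open_\<Omega> d(1)] d(2)
    by (simp add: power2_norm_eq_inner)
  moreover have "inner_L2 \<Omega> d d = (\<Sum>i\<in>UNIV. (norm (fst (x $ i)))\<^sup>2)"
    unfolding inner_L2_vec_field[OF open_\<Omega> H10_vec_L2[OF open_\<Omega> d(1)] H10_vec_L2[OF open_\<Omega> d(1)]]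
        d(2)[symmetric]
    by (simp add: power2_norm_eq_inner vec_jet_def jet_simps[OF open_\<Omega>])
  ultimately have lower: "r * (\<Sum>i\<in>UNIV. (norm (fst (x $ i)))\<^sup>2)
      + cmin * (\<Sum>i\<in>UNIV. \<Sum>j\<in>UNIV. (norm (strain_jet x i j))\<^sup>2)
      \<le> elastic_form r H x x"
    using elastic_form_vec_jet[OF open_\<Omega> d(1) d(1), of r H] by (simp add: d(2))
  let ?F = "\<Sum>i\<in>UNIV. (norm (fst (x $ i)))\<^sup>2" and ?E = "\<Sum>i\<in>UNIV. \<Sum>j\<in>UNIV. (norm (strain_jet x i j))\<^sup>2"
  have FE: "0 \<le> ?F" "0 \<le> ?E" by (simp_all add: sum_nonneg)
  have "(norm x)\<^sup>2 = ?F + (\<Sum>i\<in>UNIV. (norm (snd (x $ i)))\<^sup>2)"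
    by (simp add: norm_vec_power2[of x] norm_jet1_power2 sum.distrib)
  also have "\<dots> \<le> 2 * ?F + 2 * ?E" using korn[OF open_\<Omega> x] FE by linarith
  finally have "a / 2 * (norm x)\<^sup>2 \<le> a / 2 * (2 * ?F + 2 * ?E)" using a by (intro mult_left_mono) auto
  also have "\<dots> = a * ?F + a * ?E" by (simp add: algebra_simps)
  also have "\<dots> \<le> r * ?F + cmin * ?E" using a FE by (intro add_mono mult_right_mono) auto
  finally show ?thesis using lower by linarith
qed

section \<open>The time step as an abstract saddle point problem\<close>

definition vec_l2 :: "(real ^ 'd) set \<Rightarrow> (real ^ 'd \<Rightarrow> real ^ 'd) \<Rightarrow> (real ^ 'd) l2 ^ 'd" where
  "vec_l2 \<Omega> f = (\<chi> i. to_l2 \<Omega> (\<lambda>x. f x $ i))"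

definition load :: "(real ^ 'd) set \<Rightarrow> (real ^ 'd \<Rightarrow> real ^ 'd) \<Rightarrow> ((real ^ 'd) l2, 'd) jets ^ 'd \<Rightarrow> real" where
  "load \<Omega> f x = inner (vec_l2 \<Omega> f) (\<chi> i. fst (x $ i))"

definition source :: "(real ^ 'd) set \<Rightarrow> real \<Rightarrow> (real ^ 'd \<Rightarrow> real) \<Rightarrow> ((real ^ 'd) l2, 'd) jets \<Rightarrow> real" where
  "source \<Omega> t g y = t * inner (to_l2 \<Omega> g) (fst y)"

text \<open>The image of \<open>L\<^sup>2(\<Omega>)\<close>, as the fixed points of the restriction to \<open>\<Omega>\<close>.\<close>

definition scalar_space :: "(real ^ 'd) set \<Rightarrow> (real ^ 'd) l2 set" where
  "scalar_space \<Omega> = {U. mul_l2 (indicator \<Omega>) U = U}"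

definition displacement_space :: "(real ^ 'd) set \<Rightarrow> (((real ^ 'd) l2, 'd) jets ^ 'd) set" where
  "displacement_space \<Omega> = {x. \<forall>i. x $ i \<in> H10_jets \<Omega>}"

text \<open>The factor \<open>1 / (2 + 4 R\<^sup>2)\<close> accounts for both Korn's inequality, which costs \<open>1/2\<close>, and
  Poincare's inequality on a domain within distance \<open>R\<close> of the origin, which costs \<open>1 / (1 + 4 R\<^sup>2)\<close>.\<close>

definition coercivity_constant :: "real \<Rightarrow> real \<Rightarrow> real \<Rightarrow> real \<Rightarrow> real \<Rightarrow> real" where
  "coercivity_constant R \<rho> \<tau> cmin kmin = 1 / (2 + 4 * R\<^sup>2) * Min {\<rho> / \<tau>\<^sup>2, cmin, \<tau> * kmin}"

lemma bounded_linear_load: "bounded_linear (load \<Omega> f)"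
  unfolding load_def[abs_def] inner_vec_def
  by (simp) (intro bounded_linear_sum bounded_linear_compose[OF bounded_linear_inner_right]
      bounded_linear_jet_component)

lemma bounded_linear_source: "bounded_linear (source \<Omega> t g)"
  unfolding source_def[abs_def]
  by (intro bounded_linear_const_mult bounded_linear_compose[OF bounded_linear_inner_right
      bounded_linear_fst])

context
  fixes \<Omega> :: "(real ^ 'd) set"
  assumes open_\<Omega>: "open \<Omega>"
begin

lemma subspace_scalar_space: "subspace (scalar_space \<Omega>)"
proof -
  interpret m: bounded_linear "mul_l2 (indicator \<Omega>)"
    by (rule bounded_linear_mul_l2[OF indicator_multiplier[OF open_lebesgue[OF open_\<Omega>]]])
  show ?thesis unfolding scalar_space_def by (rule subspaceI) (simp_all add: m.add m.scaleR m.zero)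
qed

lemma subspace_displacement_space: "subspace (displacement_space \<Omega>)"
  unfolding displacement_space_def using subspace_H10_jets[OF open_\<Omega>]
  by (intro subspaceI) (auto simp: subspace_0 subspace_add subspace_scale)

lemma closed_displacement_space: "closed (displacement_space \<Omega>)"
proof -
  have "closed ((\<lambda>x :: ((real ^ 'd) l2, 'd) jets ^ 'd. x $ i) -` H10_jets \<Omega>)" for i
    by (intro closed_vimage closed_H10_jets[OF open_\<Omega>] continuous_intros)
  then have "closed (\<Inter>i. (\<lambda>x :: ((real ^ 'd) l2, 'd) jets ^ 'd. x $ i) -` H10_jets \<Omega>)"
    by (intro closed_INT) auto
  moreover have "displacement_space \<Omega> = (\<Inter>i. (\<lambda>x. x $ i) -` H10_jets \<Omega>)"
      by (auto simp: displacement_space_def)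
  ultimately show ?thesis by simp
qed

lemma norm_load:
  assumes f: "f \<in> L2 \<Omega>"
  shows "\<bar>load \<Omega> f x\<bar> \<le> norm_L2 \<Omega> f * norm x"
proof -
  have "(norm (vec_l2 \<Omega> f))\<^sup>2 = (norm_L2 \<Omega> f)\<^sup>2"
    unfolding norm_L2_power2 inner_L2_vec_field[OF open_\<Omega> f f]
    by (simp add: norm_vec_power2 vec_l2_def power2_norm_eq_inner)
  then have "norm (vec_l2 \<Omega> f) = norm_L2 \<Omega> f" using norm_L2_nonneg by (metis norm_ge_zero power2_eq_imp_eq)
  moreover have "norm (\<chi> i. fst (x $ i)) \<le> norm x"
    by (rule norm_le_componentwise_cart) (metis norm_fst_le prod.collapse vec_lambda_beta)
  then have "norm (vec_l2 \<Omega> f) * norm (\<chi> i. fst (x $ i)) \<le> norm (vec_l2 \<Omega> f) * norm x"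
    by (rule mult_left_mono) simp
  ultimately show ?thesis
    unfolding load_def using Cauchy_Schwarz_ineq2[of "vec_l2 \<Omega> f" "\<chi> i. fst (x $ i)"] by simp
qed

lemma norm_source:
  assumes g: "g \<in> L2 \<Omega>" and t: "0 \<le> t"
  shows "\<bar>source \<Omega> t g y\<bar> \<le> t * norm_L2 \<Omega> g * norm y"
proof -
  have "\<bar>inner (to_l2 \<Omega> g) (fst y)\<bar> \<le> norm_L2 \<Omega> g * norm (fst y)"
    using Cauchy_Schwarz_ineq2[of "to_l2 \<Omega> g" "fst y"]
        by (simp add: norm_to_l2[OF open_lebesgue[OF open_\<Omega>] g])
  also have "\<dots> \<le> norm_L2 \<Omega> g * norm y"
    using norm_fst_le[of "fst y" "snd y"] norm_L2_nonneg by (intro mult_left_mono) auto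
  finally show ?thesis using t by (simp add: source_def abs_mult mult.assoc mult_left_mono)
qed

lemma jet_H10_jets: "u \<in> H10 \<Omega> \<Longrightarrow> jet \<Omega> u \<in> H10_jets \<Omega>"
  by (simp add: H10_iff[OF open_\<Omega>])

lemma to_l2_scalar_space: "u \<in> L2 \<Omega> \<Longrightarrow> to_l2 \<Omega> u \<in> scalar_space \<Omega>"
  by (simp add: scalar_space_def mul_indicator_to_l2[OF open_lebesgue[OF open_\<Omega>]])

lemma vec_jet_displacement_space: "d \<in> H10_vec \<Omega> \<Longrightarrow> vec_jet \<Omega> d \<in> displacement_space \<Omega>"
  by (simp add: displacement_space_def vec_jet_H10[OF open_\<Omega>])

lemma scalar_space_surj: "U \<in> scalar_space \<Omega> \<Longrightarrow> \<exists>u\<in>L2 \<Omega>. to_l2 \<Omega> u = U"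
  unfolding scalar_space_def using to_l2_surj[OF open_lebesgue[OF open_\<Omega>]] by blast

lemma displacement_space_surj: "x \<in> displacement_space \<Omega> \<Longrightarrow> \<exists>d\<in>H10_vec \<Omega>. vec_jet \<Omega> d = x"
  unfolding displacement_space_def using vec_jet_surj[OF open_\<Omega>] by blast

lemma vec_jet_inj:
  assumes "d \<in> H10_vec \<Omega>" "d' \<in> H10_vec \<Omega>" "vec_jet \<Omega> d' = vec_jet \<Omega> d"
  shows "eq_ae \<Omega> d' d"
proof -
  have "eq_ae \<Omega> (\<lambda>x. d' x $ i) (\<lambda>x. d x $ i)" for i
  proof -
    have "jet \<Omega> (\<lambda>x. d' x $ i) = jet \<Omega> (\<lambda>x. d x $ i)" using assms(3) by (simp add: vec_jet_def vec_eq_iff)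
    then have "to_l2 \<Omega> (\<lambda>x. d' x $ i) = to_l2 \<Omega> (\<lambda>x. d x $ i)" by (simp add: jet_def)
    then show ?thesis
      using assms(1,2) H10_L2(1)[OF open_\<Omega>]
          by (simp add: to_l2_eq_iff[OF open_lebesgue[OF open_\<Omega>]] H10_vec_def)
  qed
  then have "AE x in lebesgue_on \<Omega>. \<forall>i. d' x $ i = d x $ i"
    unfolding eq_ae_def by (subst AE_all_countable) simp
  then show ?thesis unfolding eq_ae_def by (simp add: vec_eq_iff)
qed

lemma jet_inj:
  assumes "u \<in> H10 \<Omega>" "u' \<in> H10 \<Omega>" "jet \<Omega> u' = jet \<Omega> u"
  shows "eq_ae \<Omega> u' u"
  using assms H10_L2(1)[OF open_\<Omega>] by (simp add: jet_def to_l2_eq_iff[OF open_lebesgue[OF open_\<Omega>]])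

context
  fixes K :: "real ^ 'd \<Rightarrow> real ^ 'd ^ 'd" and H :: "real ^ 'd ^ 'd ^ 'd ^ 'd"
      and kmin kmax cmin cmax \<rho> \<tau> \<beta> M R :: real
  assumes K: "permeability_tensor \<Omega> K kmin kmax" and H: "hooke_tensor H cmin cmax"
    and pos: "\<rho> > 0" "\<tau> > 0" "\<beta> > 0" "M \<ge> 0" and R: "\<forall>x\<in>\<Omega>. norm x \<le> R"
begin

lemma diffusion_form_coercive_H1:
  assumes v: "v \<in> H10_jets \<Omega>" and a: "0 \<le> a" "a \<le> \<tau> * kmin"
  shows "1 / (2 + 4 * R\<^sup>2) * a * (norm v)\<^sup>2 \<le> diffusion_form \<Omega> \<tau> K (2 * kmax) v v"
proof -
  have p: "0 < 2 + 4 * R\<^sup>2" by (simp add: add_pos_nonneg)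
  have "(norm v)\<^sup>2 \<le> (2 + 4 * R\<^sup>2) * (norm (snd v))\<^sup>2"
    using H10_jets_poincare[OF open_\<Omega> R v] zero_le_power2[of "norm (snd v)"]
    unfolding norm_jet1_power2 distrib_right by linarith
  then have "a * (norm v)\<^sup>2 \<le> a * ((2 + 4 * R\<^sup>2) * (norm (snd v))\<^sup>2)" using a by (intro mult_left_mono)
  then have "1 / (2 + 4 * R\<^sup>2) * a * (norm v)\<^sup>2 \<le> a * (norm (snd v))\<^sup>2"
    using p by (simp add: divide_le_eq mult_ac)
  also have "\<dots> \<le> \<tau> * kmin * (norm (snd v))\<^sup>2" using a by (intro mult_right_mono) auto
  also have "\<dots> \<le> diffusion_form \<Omega> \<tau> K (2 * kmax) v v"
    using pos by (intro diffusion_form_coercive[OF open_\<Omega> K v]) auto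
  finally show ?thesis .
qed

lemma elastic_form_coercive_H1:
  assumes x: "x \<in> displacement_space \<Omega>" and a: "0 \<le> a" "a \<le> \<rho> / \<tau>\<^sup>2" "a \<le> cmin"
  shows "1 / (2 + 4 * R\<^sup>2) * a * (norm x)\<^sup>2 \<le> elastic_form (\<rho> / \<tau>\<^sup>2) H x x"
proof -
  have "1 / (2 + 4 * R\<^sup>2) \<le> 1 / 2" by (intro divide_left_mono) (auto simp: add_pos_nonneg)
  then have "1 / (2 + 4 * R\<^sup>2) * (a * (norm x)\<^sup>2) \<le> 1 / 2 * (a * (norm x)\<^sup>2)"
    using a by (intro mult_right_mono) auto
  also have "\<dots> = a / 2 * (norm x)\<^sup>2" by simp
  also have "\<dots> \<le> elastic_form (\<rho> / \<tau>\<^sup>2) H x x"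
    using x by (intro elastic_form_coercive[OF open_\<Omega> H _ a]) (simp add: displacement_space_def)
  finally show ?thesis by (simp add: mult.assoc)
qed

lemma elliptic_saddle_poroelastic:
  "elliptic_saddle (displacement_space \<Omega>) (H10_jets \<Omega>) (scalar_space \<Omega>) (elastic_form (\<rho> / \<tau>\<^sup>2) H)
      (diffusion_form \<Omega> \<tau> K (2 * kmax))
     div_jet fst \<beta> M (coercivity_constant R \<rho> \<tau> cmin kmin)"
proof (rule elliptic_saddle.intro)
  have a: "0 < Min {\<rho> / \<tau>\<^sup>2, cmin, \<tau> * kmin}"
    using K H pos by (simp add: permeability_tensor_def hooke_tensor_def)
  then show "0 < coercivity_constant R \<rho> \<tau> cmin kmin" unfolding coercivity_constant_def
      by (intro mult_pos_pos) (auto simp: add_pos_nonneg)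
  have le: "Min {\<rho> / \<tau>\<^sup>2, cmin, \<tau> * kmin} \<le> \<rho> / \<tau>\<^sup>2" "Min {\<rho> / \<tau>\<^sup>2, cmin, \<tau> * kmin} \<le> cmin"
    "Min {\<rho> / \<tau>\<^sup>2, cmin, \<tau> * kmin} \<le> \<tau> * kmin" by (auto intro: Min_le)
  show "coercivity_constant R \<rho> \<tau> cmin kmin * (norm x)\<^sup>2
      \<le> elastic_form (\<rho> / \<tau>\<^sup>2) H x x" if "x \<in> displacement_space \<Omega>" for x
    unfolding coercivity_constant_def using that a le by (intro elastic_form_coercive_H1) auto
  show "coercivity_constant R \<rho> \<tau> cmin kmin * (norm y)\<^sup>2
      \<le> diffusion_form \<Omega> \<tau> K (2 * kmax) y y" if "y \<in> H10_jets \<Omega>" for y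
    unfolding coercivity_constant_def using that a le by (intro diffusion_form_coercive_H1) auto
  show "subspace (displacement_space \<Omega>)" "closed (displacement_space \<Omega>)" "subspace (H10_jets \<Omega>)"
      "closed (H10_jets \<Omega>)" "subspace (scalar_space \<Omega>)"
    by (rule subspace_displacement_space closed_displacement_space subspace_H10_jets[OF open_\<Omega>]
        closed_H10_jets[OF open_\<Omega>] subspace_scalar_space)+
  show "bounded_bilinear (elastic_form (\<rho> / \<tau>\<^sup>2) H)" "bounded_bilinear (diffusion_form \<Omega> \<tau> K (2 * kmax))"
    "bounded_linear (div_jet :: ((real ^ 'd) l2, 'd) jets ^ 'd \<Rightarrow> _)"
        "bounded_linear (fst :: ((real ^ 'd) l2, 'd) jets \<Rightarrow> _)"
    by (rule bounded_bilinear_elastic_form bounded_bilinear_diffusion_form[OF open_\<Omega> K]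
        bounded_linear_div_jet bounded_linear_fst)+
  show "div_jet x \<in> scalar_space \<Omega>" if "x \<in> displacement_space \<Omega>" for x
    using that by (simp add: scalar_space_def displacement_space_def div_jet_restricted[OF open_\<Omega>])
  show "fst y \<in> scalar_space \<Omega>" if "y \<in> H10_jets \<Omega>" for y
    using that by (simp add: scalar_space_def H10_jets_restricted[OF open_\<Omega>])
  show "0 \<le> \<beta>" "0 \<le> M" using pos by auto
qed

interpretation S: elliptic_saddle "displacement_space \<Omega>" "H10_jets \<Omega>" "scalar_space \<Omega>"
    "elastic_form (\<rho> / \<tau>\<^sup>2) H"
  "diffusion_form \<Omega> \<tau> K (2 * kmax)" div_jet fst \<beta> M "coercivity_constant R \<rho> \<tau> cmin kmin"
  by (rule elliptic_saddle_poroelastic)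

text \<open>Every element of the abstract spaces is the jet or class of an admissible test function, so
  the two families of equations are equivalent. The single equation tested on \<open>V\<close> splits into the
      first three
  abstract ones by setting two of the three test functions to zero.\<close>

lemma step_solution_iff:
  assumes f: "f \<in> L2 \<Omega>" and g: "g \<in> L2 \<Omega>" and p0: "p0 \<in> L2 \<Omega>" and \<phi>0: "\<phi>0 \<in> L2 \<Omega>"
    and u: "d \<in> H10_vec \<Omega>" "\<mu> \<in> H10 \<Omega>" "\<phi> \<in> L2 \<Omega>" and q: "q \<in> L2 \<Omega>"
  shows "step_solution \<Omega> \<rho> \<tau> \<beta> M K H f g p0 \<phi>0 (d, \<mu>, \<phi>) q \<longleftrightarrow>
    S.solves (load \<Omega> f) (source \<Omega> \<tau> g) (to_l2 \<Omega> p0) (to_l2 \<Omega> \<phi>0)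
      (vec_jet \<Omega> d) (jet \<Omega> \<mu>) (to_l2 \<Omega> \<phi>) (to_l2 \<Omega> q)"
proof -
  note o = open_lebesgue[OF open_\<Omega>]
  note ip = inner_to_l2[OF o]
  let ?x = "vec_jet \<Omega> d" and ?y = "jet \<Omega> \<mu>" and ?z = "to_l2 \<Omega> \<phi>" and ?q = "to_l2 \<Omega> q"
  \<comment> \<open>The defects of the three equations into which the equation on \<open>V\<close> splits.\<close>
  define e1 where "e1 x = elastic_form (\<rho> / \<tau>\<^sup>2) H ?x x + \<beta> * inner ?z (div_jet x)
      + inner ?q (div_jet x) - load \<Omega> f x" for x
  define e2 where "e2 y = diffusion_form \<Omega> \<tau> K (2 * kmax) ?y y + inner ?z (fst y) - source \<Omega> \<tau> g y" for y
  define e3 where "e3 z = \<beta> * inner (div_jet ?x) z - inner (fst ?y) z + M * inner ?z z - inner z ?q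
      + inner (to_l2 \<Omega> p0) z" for z
  interpret s: bounded_bilinear "elastic_form (\<rho> / \<tau>\<^sup>2) H" by (rule bounded_bilinear_elastic_form)
  interpret k: bounded_bilinear "diffusion_form \<Omega> \<tau> K (2 * kmax)"
      by (rule bounded_bilinear_diffusion_form[OF open_\<Omega> K])
  interpret D: bounded_linear "div_jet :: ((real ^ 'd) l2, 'd) jets ^ 'd \<Rightarrow> _"
      by (rule bounded_linear_div_jet)
  interpret F: bounded_linear "load \<Omega> f" by (rule bounded_linear_load)
  interpret G: bounded_linear "source \<Omega> \<tau> g" by (rule bounded_linear_source)
  have zero: "e1 0 = 0" "e2 0 = 0" "e3 0 = 0"
    by (simp_all add: e1_def e2_def e3_def s.zero_right k.zero_right D.zero F.zero G.zero)
  have eq1: "form_A \<Omega> \<rho> \<tau> \<beta> M K H (d, \<mu>, \<phi>) (d', \<mu>', \<phi>') + form_B \<Omega> (d', \<mu>', \<phi>') q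
        - (inner_L2 \<Omega> f d' + \<tau> * inner_L2 \<Omega> g \<mu>' - inner_L2 \<Omega> p0 \<phi>')
      = e1 (vec_jet \<Omega> d') + e2 (jet \<Omega> \<mu>') + e3 (to_l2 \<Omega> \<phi>')"
    if v: "d' \<in> H10_vec \<Omega>" "\<mu>' \<in> H10 \<Omega>" "\<phi>' \<in> L2 \<Omega>" for d' \<mu>' \<phi>'
  proof -
    note L = H10_L2(1)[OF open_\<Omega>] and dv = dvg_L2[OF open_\<Omega>]
    have ld: "load \<Omega> f (vec_jet \<Omega> d') = inner_L2 \<Omega> f d'"
      unfolding inner_L2_vec_field[OF open_\<Omega> f H10_vec_L2[OF open_\<Omega> v(1)]]
      by (simp add: load_def inner_vec_def vec_l2_def vec_jet_def jet_simps[OF open_\<Omega>])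
    have sr: "source \<Omega> \<tau> g (jet \<Omega> \<mu>') = \<tau> * inner_L2 \<Omega> g \<mu>'"
      using g L[OF v(2)] by (simp add: source_def jet_simps[OF open_\<Omega>] ip)
    have "inner ?z (div_jet (vec_jet \<Omega> d')) = inner_L2 \<Omega> \<phi> (dvg \<Omega> d')"
      "inner ?q (div_jet (vec_jet \<Omega> d')) = inner_L2 \<Omega> q (dvg \<Omega> d')"
      "inner (div_jet ?x) (to_l2 \<Omega> \<phi>') = inner_L2 \<Omega> (dvg \<Omega> d) \<phi>'"
      using u q v by (simp_all add: dv(2)[symmetric] ip dv(1))
    moreover have "inner ?z (fst (jet \<Omega> \<mu>')) = inner_L2 \<Omega> \<phi> \<mu>'"
        "inner (fst ?y) (to_l2 \<Omega> \<phi>') = inner_L2 \<Omega> \<mu> \<phi>'"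
      using u v L by (simp_all add: jet_simps[OF open_\<Omega>] ip)
    moreover have "inner ?z (to_l2 \<Omega> \<phi>') = inner_L2 \<Omega> \<phi> \<phi>'" "inner (to_l2 \<Omega> \<phi>') ?q = inner_L2 \<Omega> \<phi>' q"
      "inner (to_l2 \<Omega> p0) (to_l2 \<Omega> \<phi>') = inner_L2 \<Omega> p0 \<phi>'"
      using u v q p0 by (simp_all add: ip)
    ultimately show ?thesis
      by (simp add: e1_def e2_def e3_def elastic_form_vec_jet[OF open_\<Omega> u(1) v(1)]
          diffusion_form_jet[OF open_\<Omega> K u(2) v(2)] ld sr)
  qed
  have eq2: "form_B \<Omega> (d, \<mu>, \<phi>) q' + inner_L2 \<Omega> \<phi>0 q'
      = inner (to_l2 \<Omega> q') (div_jet ?x) - inner ?z (to_l2 \<Omega> q') + inner (to_l2 \<Omega> \<phi>0) (to_l2 \<Omega> q')"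
    if "q' \<in> L2 \<Omega>" for q'
    using that u \<phi>0 by (simp add: dvg_L2(2)[OF open_\<Omega> u(1), symmetric] dvg_L2(1)[OF open_\<Omega>] ip)
  have all_V: "(\<forall>d' \<mu>' \<phi>'. (d', \<mu>', \<phi>') \<in> V_space \<Omega> \<longrightarrow> e1 (vec_jet \<Omega> d') + e2 (jet \<Omega> \<mu>')
      + e3 (to_l2 \<Omega> \<phi>') = 0)
      \<longleftrightarrow> (\<forall>x\<in>displacement_space \<Omega>. e1 x = 0) \<and> (\<forall>y\<in>H10_jets \<Omega>. e2 y = 0) \<and> (\<forall>z\<in>scalar_space \<Omega>. e3 z
          = 0)" (is "?V \<longleftrightarrow> ?W")
  proof
    assume ?V
    have all: "e1 x + e2 y + e3 z = 0" if xyz: "x \<in> displacement_space \<Omega>" "y \<in> H10_jets \<Omega>"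
        "z \<in> scalar_space \<Omega>" for x y z
    proof -
      obtain d' \<mu>' \<phi>' where "d' \<in> H10_vec \<Omega>" "vec_jet \<Omega> d' = x" "\<mu>' \<in> H10 \<Omega>" "jet \<Omega> \<mu>' = y"
          "\<phi>' \<in> L2 \<Omega>" "to_l2 \<Omega> \<phi>' = z"
        using displacement_space_surj[OF xyz(1)] H10_jets_surj[OF open_\<Omega> xyz(2)]
            scalar_space_surj[OF xyz(3)] by blast
      then show ?thesis using \<open>?V\<close>[rule_format, of d' \<mu>' \<phi>'] by (simp add: V_space_def)
    qed
    have "0 \<in> displacement_space \<Omega>" "0 \<in> H10_jets \<Omega>" "0 \<in> scalar_space \<Omega>"
      using subspace_displacement_space subspace_H10_jets[OF open_\<Omega>] subspace_scalar_space
          subspace_0 by blast+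
    then show ?W using all[of _ 0 0] all[of 0 _ 0] all[of 0 0] zero by simp
  next
    assume ?W
    then show ?V by (auto simp: V_space_def vec_jet_displacement_space jet_H10_jets to_l2_scalar_space)
  qed
  have all_Q: "(\<forall>q'\<in>L2 \<Omega>. form_B \<Omega> (d, \<mu>, \<phi>) q' = - inner_L2 \<Omega> \<phi>0 q')
      \<longleftrightarrow> (\<forall>z\<in>scalar_space \<Omega>. inner z (div_jet ?x) - inner ?z z = - inner (to_l2 \<Omega> \<phi>0) z)" (is "?V \<longleftrightarrow> ?W")
  proof
    assume v: ?V
    show ?W
    proof
      fix z assume "z \<in> scalar_space \<Omega>"
      then obtain q' where q': "q' \<in> L2 \<Omega>" "to_l2 \<Omega> q' = z" using scalar_space_surj by blast
      then show "inner z (div_jet ?x) - inner ?z z = - inner (to_l2 \<Omega> \<phi>0) z"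
        using bspec[OF v q'(1)] eq2[OF q'(1)] by (simp only: q'(2))
    qed
  next
    assume w: ?W
    show ?V
    proof
      fix q' :: "real ^ 'd \<Rightarrow> real" assume q': "q' \<in> L2 \<Omega>"
      show "form_B \<Omega> (d, \<mu>, \<phi>) q' = - inner_L2 \<Omega> \<phi>0 q'"
        using bspec[OF w to_l2_scalar_space[OF q']] eq2[OF q'] by linarith
    qed
  qed
  have lhs: "(\<forall>d' \<mu>' \<phi>'. (d', \<mu>', \<phi>') \<in> V_space \<Omega> \<longrightarrow>
        form_A \<Omega> \<rho> \<tau> \<beta> M K H (d, \<mu>, \<phi>) (d', \<mu>', \<phi>') + form_B \<Omega> (d', \<mu>', \<phi>') q
          = inner_L2 \<Omega> f d' + \<tau> * inner_L2 \<Omega> g \<mu>' - inner_L2 \<Omega> p0 \<phi>') \<longleftrightarrow>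
      (\<forall>d' \<mu>' \<phi>'. (d', \<mu>', \<phi>') \<in> V_space \<Omega> \<longrightarrow> e1 (vec_jet \<Omega> d') + e2 (jet \<Omega> \<mu>') + e3 (to_l2 \<Omega> \<phi>') = 0)"
  proof (intro iff_allI imp_cong refl)
    fix d' \<mu>' \<phi>' assume "(d', \<mu>', \<phi>') \<in> V_space \<Omega>"
    then show "form_A \<Omega> \<rho> \<tau> \<beta> M K H (d, \<mu>, \<phi>) (d', \<mu>', \<phi>') + form_B \<Omega> (d', \<mu>', \<phi>') q
          = inner_L2 \<Omega> f d' + \<tau> * inner_L2 \<Omega> g \<mu>' - inner_L2 \<Omega> p0 \<phi>' \<longleftrightarrow>
        e1 (vec_jet \<Omega> d') + e2 (jet \<Omega> \<mu>') + e3 (to_l2 \<Omega> \<phi>') = 0"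
      using eq1[of d' \<mu>' \<phi>'] unfolding V_space_def mem_Times_iff fst_conv snd_conv by auto
  qed
  have mem: "(d, \<mu>, \<phi>) \<in> V_space \<Omega>" "?x \<in> displacement_space \<Omega>" "?y \<in> H10_jets \<Omega>"
      "?z \<in> scalar_space \<Omega>" "?q \<in> scalar_space \<Omega>"
    using u q by (auto simp: V_space_def vec_jet_displacement_space jet_H10_jets to_l2_scalar_space)
  have e: "e1 x = 0 \<longleftrightarrow> elastic_form (\<rho> / \<tau>\<^sup>2) H ?x x + \<beta> * inner ?z (div_jet x)
      + inner ?q (div_jet x) = load \<Omega> f x"
    "e2 y = 0 \<longleftrightarrow> diffusion_form \<Omega> \<tau> K (2 * kmax) ?y y + inner ?z (fst y) = source \<Omega> \<tau> g y"
    "e3 z = 0 \<longleftrightarrow> \<beta> * inner (div_jet ?x) z - inner (fst ?y) z + M * inner ?z z - inner z ?q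
        = - inner (to_l2 \<Omega> p0) z"
    for x y z
    unfolding e1_def e2_def e3_def by linarith+
  show ?thesis
    unfolding step_solution_def S.solves_def lhs all_V all_Q unfolding e using mem q by blast
qed

end

end

section \<open>Well-posedness and the a priori bound\<close>

lemma norm_VQ_le:
  assumes "open \<Omega>" "d \<in> H10_vec \<Omega>" "\<mu> \<in> H10 \<Omega>" "\<phi> \<in> L2 \<Omega>" "q \<in> L2 \<Omega>"
  shows "norm_VQ \<Omega> (d, \<mu>, \<phi>) q
    \<le> norm (vec_jet \<Omega> d) + norm (jet \<Omega> \<mu>) + norm (to_l2 \<Omega> \<phi>) + norm (to_l2 \<Omega> q)"
proof -
  have "norm (jet \<Omega> \<mu>) = norm_H1 \<Omega> \<mu>"
    using assms by (intro norm_jet) (auto simp: H10_def)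
  then have "norm_VQ \<Omega> (d, \<mu>, \<phi>) q = sqrt ((norm (vec_jet \<Omega> d))\<^sup>2 + (norm (jet \<Omega> \<mu>))\<^sup>2
      + (norm (to_l2 \<Omega> \<phi>))\<^sup>2 + (norm (to_l2 \<Omega> q))\<^sup>2)"
    using assms by (simp add: norm_VQ_def norm_vec_jet norm_to_l2 open_lebesgue add_nonneg_nonneg)
  also have "\<dots> \<le> norm (vec_jet \<Omega> d) + norm (jet \<Omega> \<mu>) + norm (to_l2 \<Omega> \<phi>) + norm (to_l2 \<Omega> q)"
    by (rule real_le_lsqrt) (auto simp: power2_sum add_nonneg_nonneg)
  finally show ?thesis .
qed

theorem theorem2p5:
  fixes \<Omega> :: "(real ^ 'd) set"
  assumes dim: "CARD('d) \<in> {2, 3}"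
    and domain: "bounded_lipschitz_domain \<Omega>"
  shows "\<exists>C>0. \<forall>\<rho> \<tau> \<beta> M K kmin kmax H cmin cmax N f g p0 \<phi>0.
     \<rho> > 0 \<and> \<tau> > 0 \<and> \<beta> > 0 \<and> M \<ge> 0 \<and>
     permeability_tensor \<Omega> K kmin kmax \<and> hooke_tensor H cmin cmax \<and>
     (\<forall>n\<in>{1..N::nat}. f n \<in> L2 \<Omega> \<and> g n \<in> L2 \<Omega>) \<and> p0 \<in> L2 \<Omega> \<and> \<phi>0 \<in> L2 \<Omega>
     \<longrightarrow> (\<forall>n\<in>{1..N}. \<exists>u q.
            step_solution \<Omega> \<rho> \<tau> \<beta> M K H (f n) (g n) p0 \<phi>0 u q \<and>
            (\<forall>u' q'. step_solution \<Omega> \<rho> \<tau> \<beta> M K H (f n) (g n) p0 \<phi>0 u' q'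
                       \<longrightarrow> eq_V \<Omega> u' u \<and> eq_ae \<Omega> q' q) \<and>
            (let \<alpha>0 = Min {\<rho> / \<tau>\<^sup>2, cmin, 2 * \<beta>, \<tau> * kmin, M};
                 \<alpha>1 = Max {\<rho> / \<tau>\<^sup>2, cmax, 2 * \<beta>, \<tau> * kmax, M}
             in M > 0 \<longrightarrow>
                norm_VQ \<Omega> u q \<le> C * Max {1 / \<alpha>0, 2 * sqrt \<alpha>1 / sqrt \<alpha>0, \<alpha>1} *
                  (norm_L2 \<Omega> (f n) + \<tau> * norm_L2 \<Omega> (g n) + norm_L2 \<Omega> p0 + norm_L2 \<Omega> \<phi>0)))"
proof -
  have open_\<Omega>: "open \<Omega>" and bounded: "bounded \<Omega>"
    using domain by (auto simp: bounded_lipschitz_domain_def)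
  note o = open_lebesgue[OF open_\<Omega>]
  obtain R where R: "\<forall>x\<in>\<Omega>. norm x \<le> R" using bounded by (auto simp: bounded_iff)
  define c where "c = 1 / (2 + 4 * R\<^sup>2)"
  have den: "0 < 2 + 4 * R\<^sup>2" by (simp add: add_pos_nonneg)
  then have c: "0 < c" "c \<le> 1" by (auto simp: c_def)
  define \<kappa> where "\<kappa> = real CARD('d)"
  define C where "C = (4 + \<kappa>) * ((2 + \<kappa>) / c) + 7"
  have "0 < C" using c by (simp add: C_def \<kappa>_def add_nonneg_pos)
  moreover have "\<exists>u q. step_solution \<Omega> \<rho> \<tau> \<beta> M K H f g p0 \<phi>0 u q \<and>
      (\<forall>u' q'. step_solution \<Omega> \<rho> \<tau> \<beta> M K H f g p0 \<phi>0 u' q' \<longrightarrow> eq_V \<Omega> u' u \<and> eq_ae \<Omega> q' q) \<and>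
      (let \<alpha>0 = Min {\<rho> / \<tau>\<^sup>2, cmin, 2 * \<beta>, \<tau> * kmin, M};
           \<alpha>1 = Max {\<rho> / \<tau>\<^sup>2, cmax, 2 * \<beta>, \<tau> * kmax, M}
       in M > 0 \<longrightarrow>
          norm_VQ \<Omega> u q \<le> C * Max {1 / \<alpha>0, 2 * sqrt \<alpha>1 / sqrt \<alpha>0, \<alpha>1} *
            (norm_L2 \<Omega> f + \<tau> * norm_L2 \<Omega> g + norm_L2 \<Omega> p0 + norm_L2 \<Omega> \<phi>0))"
    if pos: "\<rho> > 0" "\<tau> > 0" "\<beta> > 0" "M \<ge> 0" and K: "permeability_tensor \<Omega> K kmin kmax"
      and H: "hooke_tensor H cmin cmax" and data: "f \<in> L2 \<Omega>" "g \<in> L2 \<Omega>" "p0 \<in> L2 \<Omega>" "\<phi>0 \<in> L2 \<Omega>"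
    for \<rho> \<tau> \<beta> M K kmin kmax H cmin cmax f g p0 \<phi>0
  proof -
    let ?\<gamma> = "coercivity_constant R \<rho> \<tau> cmin kmin"
    interpret S: elliptic_saddle "displacement_space \<Omega>" "H10_jets \<Omega>" "scalar_space \<Omega>"
        "elastic_form (\<rho> / \<tau>\<^sup>2) H"
      "diffusion_form \<Omega> \<tau> K (2 * kmax)" div_jet fst \<beta> M ?\<gamma>
      by (rule elliptic_saddle_poroelastic[OF open_\<Omega> K H pos R])
    note iff = step_solution_iff[OF open_\<Omega> K H pos R data]
    let ?F = "load \<Omega> f" and ?G = "source \<Omega> \<tau> g" and ?p = "to_l2 \<Omega> p0" and ?w = "to_l2 \<Omega> \<phi>0"
    have pw: "?p \<in> scalar_space \<Omega>" "?w \<in> scalar_space \<Omega>" by (rule to_l2_scalar_space[OF open_\<Omega>] data)+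
    obtain x y z r where sol: "S.solves ?F ?G ?p ?w x y z r"
      using S.solves_exists[OF bounded_linear_load bounded_linear_source pw] by blast
    then have mem: "x \<in> displacement_space \<Omega>" "y \<in> H10_jets \<Omega>" "z \<in> scalar_space \<Omega>" "r \<in> scalar_space \<Omega>"
      by (auto simp: S.solves_def)
    obtain d where d: "d \<in> H10_vec \<Omega>" "vec_jet \<Omega> d = x"
        using displacement_space_surj[OF open_\<Omega> mem(1)] by blast
    obtain \<mu> where \<mu>: "\<mu> \<in> H10 \<Omega>" "jet \<Omega> \<mu> = y" using H10_jets_surj[OF open_\<Omega> mem(2)] by blast
    obtain \<phi> where \<phi>: "\<phi> \<in> L2 \<Omega>" "to_l2 \<Omega> \<phi> = z" using scalar_space_surj[OF open_\<Omega> mem(3)] by blast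
    obtain q where q: "q \<in> L2 \<Omega>" "to_l2 \<Omega> q = r" using scalar_space_surj[OF open_\<Omega> mem(4)] by blast
    have step: "step_solution \<Omega> \<rho> \<tau> \<beta> M K H f g p0 \<phi>0 (d, \<mu>, \<phi>) q"
      using iff[OF d(1) \<mu>(1) \<phi>(1) q(1)] sol by (simp add: d \<mu> \<phi> q)
    have unique: "eq_V \<Omega> u' (d, \<mu>, \<phi>) \<and> eq_ae \<Omega> q' q"
      if u': "step_solution \<Omega> \<rho> \<tau> \<beta> M K H f g p0 \<phi>0 u' q'" for u' q'
    proof -
      obtain d' \<mu>' \<phi>' where u'_eq: "u' = (d', \<mu>', \<phi>')" by (cases u') auto
      have mem': "d' \<in> H10_vec \<Omega>" "\<mu>' \<in> H10 \<Omega>" "\<phi>' \<in> L2 \<Omega>" "q' \<in> L2 \<Omega>"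
        using u' by (auto simp: step_solution_def u'_eq V_space_def)
      have "S.solves ?F ?G ?p ?w (vec_jet \<Omega> d') (jet \<Omega> \<mu>') (to_l2 \<Omega> \<phi>') (to_l2 \<Omega> q')"
        using iff[OF mem'] u' by (simp add: u'_eq)
      then have "vec_jet \<Omega> d' = vec_jet \<Omega> d" "jet \<Omega> \<mu>' = jet \<Omega> \<mu>" "to_l2 \<Omega> \<phi>' = to_l2 \<Omega> \<phi>"
          "to_l2 \<Omega> q' = to_l2 \<Omega> q"
        using S.solves_unique[OF sol _ pw] by (auto simp: d \<mu> \<phi> q)
      then show ?thesis
        using vec_jet_inj[OF open_\<Omega> d(1) mem'(1)] jet_inj[OF open_\<Omega> \<mu>(1) mem'(2)]
          to_l2_eq_iff[OF o mem'(3) \<phi>(1)] to_l2_eq_iff[OF o mem'(4) q(1)] by (simp add: u'_eq)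
    qed
    define a where "a = Min {\<rho> / \<tau>\<^sup>2, cmin, 2 * \<beta>, \<tau> * kmin, M}"
    define A where "A = Max {\<rho> / \<tau>\<^sup>2, cmax, 2 * \<beta>, \<tau> * kmax, M}"
    have bound: "norm_VQ \<Omega> (d, \<mu>, \<phi>) q \<le> C * Max {1 / a, 2 * sqrt A / sqrt a, A} *
        (norm_L2 \<Omega> f + \<tau> * norm_L2 \<Omega> g + norm_L2 \<Omega> p0 + norm_L2 \<Omega> \<phi>0)" if "M > 0"
    proof -
      let ?m = "Max {1 / a, 2 * sqrt A / sqrt a, A}"
      have a0: "0 < a" unfolding a_def
        using that pos K H by (simp add: permeability_tensor_def hooke_tensor_def)
      have "a \<le> M" unfolding a_def by (rule Min_le) auto
      moreover have MA: "M \<le> A" "2 * \<beta> \<le> A" unfolding A_def by (rule Max_ge; simp)+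
      ultimately have aA: "a \<le> A" by simp
      have "a \<le> Min {\<rho> / \<tau>\<^sup>2, cmin, \<tau> * kmin}" unfolding a_def by (rule Min_antimono) auto
      then have ca: "c * a \<le> ?\<gamma>"
        unfolding coercivity_constant_def c_def[symmetric] using c by (intro mult_left_mono) auto
      have "norm x + norm y + norm z + norm r
          \<le> ((4 + \<kappa>) * ((2 + \<kappa>) / c) + 7) * ?m * (norm_L2 \<Omega> f + \<tau> * norm_L2 \<Omega> g + norm ?p + norm ?w)"
      proof (rule S.solves_bound[OF sol pw])
        show "\<bar>?F x\<bar> \<le> norm_L2 \<Omega> f * norm x" for x by (rule norm_load[OF open_\<Omega> data(1)])
        show "\<bar>?G y\<bar> \<le> \<tau> * norm_L2 \<Omega> g * norm y" for y
          using pos by (intro norm_source[OF open_\<Omega> data(2)]) auto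
        show "0 \<le> \<tau> * norm_L2 \<Omega> g" using pos norm_L2_nonneg by (intro mult_nonneg_nonneg) auto
        show "norm (div_jet x) \<le> \<kappa> * norm x" for x :: "((real ^ 'd) l2, 'd) jets ^ 'd"
          unfolding \<kappa>_def by (rule norm_div_jet)
        show "norm (fst y) \<le> norm y" for y :: "((real ^ 'd) l2, 'd) jets"
          by (metis norm_fst_le prod.collapse)
        show "1 / a \<le> ?m" "2 * sqrt A / sqrt a \<le> ?m" "A \<le> ?m" by (rule Max_ge; simp)+
      qed (use c a0 aA ca MA pos norm_L2_nonneg \<kappa>_def in auto)
      then show ?thesis
        using norm_VQ_le[OF open_\<Omega> d(1) \<mu>(1) \<phi>(1) q(1)]
        by (simp add: d \<mu> \<phi> q C_def norm_to_l2[OF o] data)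
    qed
    show ?thesis
      using step unique bound unfolding Let_def a_def A_def by blast
  qed
  ultimately show ?thesis by blast
qed


end
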